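(* Let $(\boldsymbol X_1,Y_1),\dots,(\boldsymbol X_n,Y_n)$ be i.i.d. copies of $(\boldsymbol X,Y)$ satisfying the monotone single index model $Y=\psi_0(\boldsymbol\alpha_0^T\boldsymbol X)+\varepsilon$, $E[\varepsilon\mid\boldsymbol X]=0$, described in the context. Under Assumptions A1–A6 (listed in the context), as $n\to\infty$, $$\sup_{\boldsymbol\alpha\in\mathcal B(\boldsymbol\alpha_0,\delta_0)}\int\left\{\hat\psi_{n\boldsymbol\alpha}(\boldsymbol\alpha^T\boldsymbol x)-\psi_{\boldsymbol\alpha}(\boldsymbol\alpha^T\boldsymbol x)\right\}^2dG(\boldsymbol x)=O_p\left((\log n)^2n^{-2/3}\right).$$
   Context: Model: $Y=\psi_0(\boldsymbol\alpha_0^T\boldsymbol X)+\varepsilon$, where $\boldsymbol X$ is a $d$-dimensional random vector with distribution $G$ and support $\mathcal X\subset\mathbb R^d$, $E[\varepsilon\mid\boldsymbol X]=0$ $G$-almost surely, $\psi_0$ belongs to the set $\mathcal M$ of monotone increasing (non-decreasing) functions on $\mathbb R$, and $\boldsymbol\alpha_0\in\mathcal S_{d-1}=\{\boldsymbol\alpha\in\mathbb R^d:\|\boldsymbol\alpha\|=1\}$ (Euclidean norm). Least squares estimator of the link: for fixed $\boldsymbol\alpha$, $\hat\psi_{n\boldsymbol\alpha}$ minimizes $\psi\mapsto\frac1n\sum_{i=1}^n\{Y_i-\psi(\boldsymbol\alpha^T\boldsymbol X_i)\}^2$ over $\psi\in\mathcal M$; its values at the distinct points $\boldsymbol\alpha^T\boldsymbol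 X_i$ are unique, and it is taken to be a right-continuous step function elsewhere. Notation: $\psi_{\boldsymbol\alpha}(u):=E[\psi_0(\boldsymbol\alpha_0^T\boldsymbol X)\mid\boldsymbol\alpha^T\boldsymbol X=u]$; $\mathcal I_{\boldsymbol\alpha}:=\{\boldsymbol\alpha^T\boldsymbol x:\boldsymbol x\in\mathcal X\}$; $\mathcal B(\boldsymbol\alpha_0,\delta_0):=\{\boldsymbol\alpha:\|\boldsymbol\alpha-\boldsymbol\alpha_0\|\le\delta_0\}$. Assumptions: A1. $\mathcal X$ is convex with nonempty interior and there is $R>0$ with $\mathcal X\subset\mathcal B(0,R)$. A2. There is $K_0>0$ with $|\psi_0(u)|\le K_0$ for all $u\in\{\boldsymbol\alpha^T\boldsymbol x:\boldsymbol x\in\mathcal X,\boldsymbol\alpha\in\mathcal S_{d-1}\}$. A3. There is $\delta_0>0$ such that $\psi_{\boldsymbol\alpha}$ is monotone increasing on $\mathcal I_{\boldsymbol\alpha}$ for all $\boldsymbol\alpha\in\mathcal B(\boldsymbol\alpha_0,\delta_0)$. A4. With $a_0,b_0$ the infimum and supremum of $\mathcal I_{\boldsymbol\alpha_0}$, $\psi_0$ is continuously differentiable on $(a_0-\delta_0R,\,b_0+\delta_0R)$. A5. $\boldsymbol X$ has a density $g$, differentiable on $\mathcal X$, and there are positive constants $\underline c_0,\bar c_0,\underline c_1,\bar c_1$ with $\underline c_0\le g\le\bar c_0$ and $\underline c_1\le\partial g/\partial x_i\le\bar c_1$ on $\mathcal X$ for $i=1,\dots,d$. A6. There are $c_0,M_0>0$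 with $E[|Y|^m\mid\boldsymbol X=\boldsymbol x]\le m!\,M_0^{m-2}c_0$ for all integers $m\ge2$ and $G$-almost all $\boldsymbol x\in\mathcal X$. *)

theory Defs
  imports "HOL-Probability.Probability"
begin

definition measure_support :: "'a::topological_space measure \<Rightarrow> 'a set" where
  "measure_support N = {x. \<forall>U. open U \<longrightarrow> x \<in> U \<longrightarrow> emeasure N U > 0}"

definition sigma_gen :: "'w measure \<Rightarrow> ('w \<Rightarrow> 'b::topological_space) \<Rightarrow> 'w measure" where
  "sigma_gen M T = vimage_algebra (space M) T borel"

text \<open>
  \<open>h\<close> is a version of the regression function \<open>u \<mapsto> E[Z | T = u]\<close>; it is determined only up to a
  null set of the distribution of \<open>T\<close>.
\<close>

definition is_regression_function ::
    "'w measure \<Rightarrow> ('w \<Rightarrow> real) \<Rightarrow> ('w \<Rightarrow> 'b::topological_space) \<Rightarrow> ('b \<Rightarrow> real) \<Rightarrow> bool" where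
  "is_regression_function M Z T h \<longleftrightarrow>
     h \<in> borel_measurable borel \<and>
     (AE \<omega> in M. real_cond_exp M (sigma_gen M T) Z \<omega> = h (T \<omega>))"

text \<open>
  The design point whose fitted value is used at \<open>u\<close>: the largest design point not exceeding \<open>u\<close>,
  or the smallest design point when \<open>u\<close> lies to the left of all of them.
\<close>

definition design_point :: "nat \<Rightarrow> (nat \<Rightarrow> real) \<Rightarrow> real \<Rightarrow> real" where
  "design_point n t u =
     (if \<exists>i<n. t i \<le> u then Max {t i |i. i < n \<and> t i \<le> u} else Min (t ` {..<n}))"

text \<open>
  Monotone least squares fit to \<open>(t i, y i)\<close>, \<open>i < n\<close>. Minimality over \<open>mono\<close> fixes the values at the
  design points only; the last conjunct extends them to the right-continuous step function that is
  constant between consecutive design points and outside their range.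
\<close>

definition is_monotone_LSE ::
    "nat \<Rightarrow> (nat \<Rightarrow> real) \<Rightarrow> (nat \<Rightarrow> real) \<Rightarrow> (real \<Rightarrow> real) \<Rightarrow> bool" where
  "is_monotone_LSE n t y \<psi> \<longleftrightarrow>
     is_arg_min (\<lambda>\<phi>. (1 / real n) * (\<Sum>i<n. (y i - \<phi> (t i))\<^sup>2)) mono \<psi> \<and>
     (\<forall>u. \<psi> u = \<psi> (design_point n t u))"

text \<open>
  \<open>Z n = O\<^sub>p(r n)\<close> for nonnegative \<open>Z n\<close>. Outer probability is used because a supremum over an
  uncountable index set need not be measurable (and \<open>measure\<close> of a non-measurable set is \<open>0\<close>).
\<close>

definition bigO_outer_prob ::
    "'w measure \<Rightarrow> (nat \<Rightarrow> 'w \<Rightarrow> ennreal) \<Rightarrow> (nat \<Rightarrow> real) \<Rightarrow> bool" where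
  "bigO_outer_prob M Z r \<longleftrightarrow>
     (\<forall>e>0. \<exists>C>0. \<exists>N. \<forall>n\<ge>N.
        outer_measure_of M {\<omega> \<in> space M. Z n \<omega> > ennreal (C * r n)} \<le> ennreal e)"

end

theory Submission
  imports Defs
begin

text \<open>
  Perturbing the least squares fit on an initial segment gives one half of the min-max formula:
  for every \<open>u\<close> and every initial segment \<open>D\<close>, \<open>\<psi>hat u\<close> is at most the mean of the responses over
  an interval of design points containing those in \<open>D \<inter> [u, \<infinity>)\<close>. Hence, if counts and response
  sums over all intervals with expected number of observations \<open>q\<close> deviate from their means by
  at most a multiple of \<open>sqrt (q log n) + log n\<close>, then \<open>\<psi>hat u - sup \<psi>(D)\<close> is at most a multiple
  of \<open>sqrt (log n / q)\<close> with \<open>q\<close> the expected number of observations in \<open>D \<inter> [u, \<infinity>)\<close>. Take for \<open>D\<close> the sets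
  \<open>{\<psi> < c}\<close> with \<open>c\<close> on a grid of mesh \<open>n powr (-1/3)\<close>: each of the \<open>O(n powr (1/3))\<close> blocks contributes
  \<open>\<integral> log n / q \<approx> (log n)\<^sup>2 / n\<close> to the squared error besides the squared mesh. Reflection gives
  the lower half.

  The deviation bound holds simultaneously for all directions, because preimages of intervals
  under \<open>x \<mapsto> \<alpha> \<bullet> x\<close> are bracketed by polynomially many slabs with gaps of probability \<open>O(1/n)\<close>,
  the density being bounded, and Bernstein's inequality applies to each slab. No entropy
  integral is needed since the link functions never enter the union bound.
\<close>

section \<open>Monotone least squares on the line\<close>

text \<open>For a direction other than the true one the model is misspecified, but an event
  \<open>\<alpha> \<bullet> X \<in> J\<close> depends on \<open>\<alpha> \<bullet> X\<close> alone,
  so the response integrated over it equals the regression function of that direction integrated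
  over \<open>J\<close>. Each direction thus poses a monotone regression problem on the line with
  its own target, monotone by A3.

  The obstacle is that the interval over which the fit averages is selected by the fit itself.
  Deviations are therefore controlled for all intervals at once; and since the interval stays inside
  \<open>D\<close>, where the target is below \<open>c\<close>, the mean of the target over it is at
  most \<open>c\<close> wherever the interval begins.

  The responses are unbounded, so at the far end of the design the fit is only known to be of order
  \<open>log n\<close>. Charging this to every block would cost a third logarithm; it is charged
  once, on a tail of probability of order \<open>log n / n\<close>. That bound on the responses
  comes from the deviation inequality itself, for a hyperplane through an observation, an event of
  probability 0.\<close>

definition iso_fit :: "nat \<Rightarrow> (nat \<Rightarrow> real) \<Rightarrow> (nat \<Rightarrow> real) \<Rightarrow> (real \<Rightarrow> real) \<Rightarrow> bool" where
  "iso_fit n t y f \<longleftrightarrow> mono f \<and> (\<forall>u. \<exists>i<n. f u = f (t i)) \<and>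
     (\<forall>h. mono h \<longrightarrow> (\<Sum>i<n. (y i - f (t i))\<^sup>2) \<le> (\<Sum>i<n. (y i - h (t i))\<^sup>2))"

lemma design_point_mem:
  assumes "n \<ge> 1"
  shows "\<exists>i<n. design_point n t u = t i"
proof (cases "\<exists>i<n. t i \<le> u")
  case True
  have "Max {t i |i. i < n \<and> t i \<le> u} \<in> {t i |i. i < n \<and> t i \<le> u}"
    using True by (intro Max_in) auto
  then show ?thesis using True by (auto simp: design_point_def)
next
  case False
  have "Min (t ` {..<n}) \<in> t ` {..<n}"
    using assms by (intro Min_in) (auto simp: lessThan_empty_iff)
  then show ?thesis using False by (auto simp: design_point_def)
qed

lemma monotone_LSE_imp_iso_fit:
  assumes "n \<ge> 1" "is_monotone_LSE n t y f"
  shows "iso_fit n t y f"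
proof -
  have m: "mono f" and min: "\<And>h. mono h \<Longrightarrow>
      \<not> (1 / real n) * (\<Sum>i<n. (y i - h (t i))\<^sup>2) < (1 / real n) * (\<Sum>i<n. (y i - f (t i))\<^sup>2)"
    and step: "\<And>u. f u = f (design_point n t u)"
    using assms(2) unfolding is_monotone_LSE_def is_arg_min_def by blast+
  have "(\<Sum>i<n. (y i - f (t i))\<^sup>2) \<le> (\<Sum>i<n. (y i - h (t i))\<^sup>2)" if "mono h" for h
    using min[OF that] assms(1) by (simp add: not_less divide_le_cancel)
  moreover have "\<exists>i<n. f u = f (t i)" for u
    using design_point_mem[OF assms(1), of t u] step[of u] by auto
  ultimately show ?thesis using m unfolding iso_fit_def by blast
qed

text \<open>Reflection turns a right-continuous step function into a left-continuous one. This is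
  why \<open>iso_fit\<close> records only that every value is attained at a design point, a property
  that survives a change of sign.\<close>

lemma iso_fit_reflect:
  assumes "iso_fit n t y f"
  shows "iso_fit n (\<lambda>i. - t i) (\<lambda>i. - y i) (\<lambda>u. - f (- u))"
  unfolding iso_fit_def
proof (intro conjI allI impI)
  show "mono (\<lambda>u. - f (- u))"
    using assms by (auto simp: iso_fit_def mono_def)
  show "\<exists>i<n. - f (- u) = - f (- (- t i))" for u
    using assms by (auto simp: iso_fit_def)
  fix h :: "real \<Rightarrow> real" assume "mono h"
  then have "mono (\<lambda>u. - h (- u))" by (auto simp: mono_def)
  then have "(\<Sum>i<n. (y i - f (t i))\<^sup>2) \<le> (\<Sum>i<n. (y i + h (- t i))\<^sup>2)"
    using assms unfolding iso_fit_def by fastforce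
  then show "(\<Sum>i<n. (- y i - (- f (- (- t i))))\<^sup>2) \<le> (\<Sum>i<n. (- y i - h (- t i))\<^sup>2)"
    by (simp add: power2_commute power2_eq_square algebra_simps)
qed

text \<open>
  Lowering \<open>f\<close> slightly on the part of an initial segment \<open>D\<close> where \<open>f \<ge> f u\<close> keeps it monotone,
  since \<open>f\<close> has finite range; optimality then gives one half of the min-max formula.
\<close>

lemma iso_fit_le_block_mean:
  assumes fit: "iso_fit n t y f" and D: "\<And>v w. w \<in> D \<Longrightarrow> v \<le> w \<Longrightarrow> v \<in> D"
  shows "f u * card {i. i < n \<and> t i \<in> D \<and> f u \<le> f (t i)}
    \<le> (\<Sum>i | i < n \<and> t i \<in> D \<and> f u \<le> f (t i). y i)"
proof -
  define c where "c = f u"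
  define A where "A = {i. i < n \<and> t i \<in> D \<and> c \<le> f (t i)}"
  have fA: "finite A" by (simp add: A_def)
  have m: "mono f" and rng: "\<And>u. \<exists>i<n. f u = f (t i)"
    and min: "\<And>h. mono h \<Longrightarrow> (\<Sum>i<n. (y i - f (t i))\<^sup>2) \<le> (\<Sum>i<n. (y i - h (t i))\<^sup>2)"
    using fit by (auto simp: iso_fit_def)
  \<comment> \<open>The gap between \<open>c\<close> and the largest value of \<open>f\<close> below
    \<open>c\<close>; if \<open>f\<close> has no value below \<open>c\<close>, any positive number
    serves.\<close>
  obtain e0 where e0: "e0 > 0" "\<And>w. f w < c \<Longrightarrow> f w \<le> c - e0"
  proof (cases "\<exists>w. f w < c")
    case True
    define V where "V = {f (t i) |i. i < n \<and> f (t i) < c}"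
    have V: "finite V" "V \<noteq> {}" using True rng by (auto simp: V_def) (metis)
    have "Max V < c" using V by (auto simp: V_def)
    moreover have "f w \<le> Max V" if "f w < c" for w
      using rng[of w] that V(1) by (intro Max_ge) (auto simp: V_def)
    ultimately show ?thesis by (intro that[of "c - Max V"]) auto
  next
    case False
    then show ?thesis by (intro that[of 1]) auto
  qed
  have ineq: "0 \<le> 2 * (\<Sum>i\<in>A. y i - f (t i)) + e * card A" if e: "0 < e" "e \<le> e0" for e
  proof -
    define h where "h w = f w - (if w \<in> D \<and> c \<le> f w then e else 0)" for w
    \<comment> \<open>The critical pair is \<open>v \<le> w\<close> with \<open>w\<close> lowered
      and \<open>v\<close> not: then \<open>v \<in> D\<close>, hence \<open>f v < c\<close>, and the
      gap \<open>e0 \<ge> e\<close> leaves enough room.\<close>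
    have "mono h"
    proof (rule monoI)
      fix v w :: real assume vw: "v \<le> w"
      then have "f v \<le> f w" using m by (simp add: mono_def)
      then show "h v \<le> h w"
        using D[OF _ vw] e0(2)[of v] e by (auto simp: h_def)
    qed
    from min[OF this] have "0 \<le> (\<Sum>i<n. (y i - h (t i))\<^sup>2 - (y i - f (t i))\<^sup>2)"
      by (simp add: sum_subtractf)
    also have "\<dots> = (\<Sum>i<n. if i \<in> A then e * (2 * (y i - f (t i)) + e) else 0)"
      by (rule sum.cong) (auto simp: h_def A_def power2_eq_square algebra_simps)
    also have "\<dots> = (\<Sum>i\<in>A. e * (2 * (y i - f (t i)) + e))"
      by (subst sum.inter_restrict[symmetric]) (auto simp: A_def intro!: sum.cong)
    also have "\<dots> = e * (2 * (\<Sum>i\<in>A. y i - f (t i)) + e * card A)"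
      by (simp only: sum_distrib_left[symmetric] sum.distrib) (simp add: mult.commute)
    finally show ?thesis using e by (simp add: zero_le_mult_iff)
  qed
  have "0 \<le> (\<Sum>i\<in>A. y i - f (t i))"
  proof (rule ccontr)
    assume neg: "\<not> 0 \<le> (\<Sum>i\<in>A. y i - f (t i))"
    \<comment> \<open>With \<open>S\<close> the negative sum, \<open>e * card A\<close> is at most
      \<open>- S\<close>, so \<open>ineq\<close> yields \<open>0 \<le> 2 * S - S = S\<close>, a
      contradiction. The \<open>+ 1\<close> keeps the denominator positive.\<close>
    define e where "e = min e0 (- (\<Sum>i\<in>A. y i - f (t i)) / (card A + 1))"
    have "0 < e" "e \<le> e0" using neg e0 by (auto simp: e_def divide_neg_pos)
    have "e * card A \<le> e * (card A + 1)" using \<open>0 < e\<close> by simp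
    also have "\<dots> \<le> (- (\<Sum>i\<in>A. y i - f (t i)) / (card A + 1)) * (card A + 1)"
      by (rule mult_right_mono) (auto simp: e_def)
    also have "\<dots> = - (\<Sum>i\<in>A. y i - f (t i))" by simp
    finally show False using ineq[OF \<open>0 < e\<close> \<open>e \<le> e0\<close>] neg by linarith
  qed
  moreover have "c * card A \<le> (\<Sum>i\<in>A. f (t i))"
    using sum_mono[of A "\<lambda>_. c" "\<lambda>i. f (t i)"] by (simp add: A_def mult.commute)
  ultimately show ?thesis by (simp add: sum_subtractf A_def c_def)
qed

text \<open>The block mean inequality with \<open>D\<close> the whole line. The block is nonempty
  because \<open>f u\<close> is the value at some design point, so its cardinality can be
  cancelled.\<close>

lemma iso_fit_le_bound:
  assumes fit: "iso_fit n t y f" and b: "\<And>i. i < n \<Longrightarrow> y i \<le> b"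
  shows "f u \<le> b"
proof -
  let ?A = "{i. i < n \<and> t i \<in> UNIV \<and> f u \<le> f (t i)}"
  have "f u * card ?A \<le> (\<Sum>i\<in>?A. y i)"
    by (rule iso_fit_le_block_mean[OF fit]) auto
  also have "\<dots> \<le> b * card ?A"
    using sum_mono[of ?A y "\<lambda>_. b"] b by (simp add: mult.commute)
  finally have "f u * card ?A \<le> b * card ?A" .
  moreover have "card ?A > 0"
    using fit unfolding iso_fit_def card_gt_0_iff by (force intro: eq_refl)
  ultimately show ?thesis by simp
qed

text \<open>\<open>E\<close> may fail to contain its infimum, so no single tail need cover it. A
  nonempty compact \<open>K \<subseteq> E\<close> does have a least point \<open>u\<close>, whence
  \<open>K \<subseteq> D \<inter> {u..}\<close>; inner regularity then passes to
  \<open>E\<close>.\<close>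

lemma emeasure_upper_tail_le:
  fixes \<mu> :: "real measure"
  assumes "finite_measure \<mu>" and sets: "sets \<mu> = sets borel" and E: "E \<in> sets borel"
    and tail: "\<And>u. u \<in> E \<Longrightarrow> emeasure \<mu> (D \<inter> {u..}) \<le> \<tau>" and "E \<subseteq> D" and D: "D \<in> sets borel"
  shows "emeasure \<mu> E \<le> \<tau>"
proof -
  have "emeasure \<mu> E = (SUP K \<in> {K. K \<subseteq> E \<and> compact K}. emeasure \<mu> K)"
    using assms(1) by (intro inner_regular[OF sets _ E]) (simp add: finite_measure.emeasure_finite)
  also have "\<dots> \<le> \<tau>"
  proof (rule SUP_least, safe)
    fix K assume K: "K \<subseteq> E" "compact K"
    show "emeasure \<mu> K \<le> \<tau>"
    proof (cases "K = {}")
      case False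
      then obtain u where u: "u \<in> K" "\<And>v. v \<in> K \<Longrightarrow> u \<le> v"
        using compact_attains_inf[OF K(2)] by blast
      have "emeasure \<mu> K \<le> emeasure \<mu> (D \<inter> {u..})"
        using K u \<open>E \<subseteq> D\<close> D by (intro emeasure_mono) (auto simp: sets)
      also have "\<dots> \<le> \<tau>" using tail u K by auto
      finally show ?thesis .
    qed simp
  qed
  finally show ?thesis .
qed

lemma antimono_measure_upper_tail:
  assumes "finite_measure \<mu>" "sets \<mu> = sets borel" "(D :: real set) \<in> sets borel" "u \<le> v"
  shows "measure \<mu> (D \<inter> {v..}) \<le> measure \<mu> (D \<inter> {u..})"
  using assms by (intro finite_measure.finite_measure_mono) auto

lemma borel_measurable_upper_tail:
  assumes "finite_measure \<mu>" "sets \<mu> = sets borel" "(D :: real set) \<in> sets borel"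
  shows "(\<lambda>u. measure \<mu> (D \<inter> {u..})) \<in> borel_measurable borel"
proof -
  have "mono (\<lambda>u. - measure \<mu> (D \<inter> {u..}))"
    using antimono_measure_upper_tail[OF assms] by (auto simp: mono_def)
  then have "(\<lambda>u. - (- measure \<mu> (D \<inter> {u..}))) \<in> borel_measurable borel"
    by (intro borel_measurable_uminus borel_measurable_mono)
  then show ?thesis by simp
qed

text \<open>The survival function counterpart of the probability integral transform, with an
  inequality because of atoms. It is what makes the integral of the reciprocal tail mass, cut off
  near 0, only logarithmic.\<close>

lemma measure_upper_tail_le:
  assumes "finite_measure \<mu>" "sets \<mu> = sets borel" "(D :: real set) \<in> sets borel" "r \<ge> 0"
  shows "{u \<in> D. measure \<mu> (D \<inter> {u..}) < r} \<in> sets borel" (is "?E \<in> _")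
    and "emeasure \<mu> {u \<in> D. measure \<mu> (D \<inter> {u..}) < r} \<le> ennreal r"
proof -
  note [measurable] = borel_measurable_upper_tail[OF assms(1-3)] assms(3)
  show 1: "?E \<in> sets borel" by measurable
  show "emeasure \<mu> ?E \<le> ennreal r"
  proof (rule emeasure_upper_tail_le[OF assms(1,2) 1])
    show "emeasure \<mu> (D \<inter> {u..}) \<le> ennreal r" if "u \<in> ?E" for u
      using that assms(4) finite_measure.emeasure_eq_measure[OF assms(1)]
      by (auto intro: ennreal_leI)
  qed (use assms(3) in auto)
qed

section \<open>Upper error of a monotone fit under deviation bounds\<close>

lemma dyadic_scale:
  fixes q l :: real
  assumes "l > 0" "l \<le> q" "q < 2 ^ T * l"
  shows "\<exists>k<T. 2 ^ k * l \<le> q \<and> q < 2 ^ Suc k * l"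
  using assms(3)
proof (induction T)
  case (Suc T)
  then show ?case by (cases "q < 2 ^ T * l") (auto simp: less_Suc_eq not_less)
qed (use assms in auto)

text \<open>The sample enters as fixed numbers and the deviation bounds as hypotheses.
  \<open>sum_le\<close> and \<open>f_le\<close> are one-sided since only
  \<open>max 0 (f u - \<psi> u)\<close> is bounded here; reflected data supply the other half.
  \<open>\<mu>\<close> will be the law of the projected covariate and \<open>L\<close> will be
  \<open>ln n\<close>.\<close>

locale monotone_fit_sample = prob_space \<mu> for \<mu> :: "real measure" +
  fixes n :: nat and t y :: "nat \<Rightarrow> real" and f \<psi> :: "real \<Rightarrow> real" and K B L :: real
  assumes sets_mu: "sets \<mu> = sets borel"
    and fit: "iso_fit n t y f"
    and psi_mono: "mono \<psi>" and psi_le: "\<And>u. \<bar>\<psi> u\<bar> \<le> K"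
    and B: "B \<ge> 1" and L: "L \<ge> 1"
    and count: "\<And>J. is_interval J \<Longrightarrow>
      \<bar>card {i. i < n \<and> t i \<in> J} - n * measure \<mu> J\<bar> \<le> B * (sqrt (n * measure \<mu> J * L) + L)"
    and sum_le: "\<And>J. is_interval J \<Longrightarrow> (\<Sum>i | i < n \<and> t i \<in> J. y i)
      \<le> n * (\<integral>w. \<psi> w * indicator J w \<partial>\<mu>) + B * (sqrt (n * measure \<mu> J * L) + L)"
    and f_le: "\<And>u. f u \<le> B * L"
begin

lemma K_nonneg: "K \<ge> 0"
  using psi_le[of 0] by linarith

lemma pos_n: "n > 0"
  using fit by (auto simp: iso_fit_def)

lemma f_mono: "mono f"
  using fit by (simp add: iso_fit_def)

text \<open>The threshold is set so that \<open>sqrt (p * L)\<close> is at least \<open>L\<close>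
  and at most \<open>p / (4 * B)\<close>. The allowed deviation is then at most
  \<open>2 * B * sqrt (p * L)\<close>, hence at most half of the expected count
  \<open>p\<close>.\<close>

lemma sqrt_ratio_le:
  assumes "p \<ge> 16 * B\<^sup>2 * L"
  shows "B * (sqrt (p * L) + L) \<le> p / 2" "B * (sqrt (p * L) + L) \<le> 2 * B * p * sqrt (L / p)"
proof -
  have B2: "B\<^sup>2 \<ge> 1" using B by simp
  have "16 * L \<le> 16 * B\<^sup>2 * L" using B2 L by (simp add: mult_le_cancel_right1)
  then have p: "16 * L \<le> p" "p > 0" using assms L by linarith+
  have "L = sqrt (L * L)" using L by simp
  also have "\<dots> \<le> sqrt (p * L)" using p L by (intro real_sqrt_le_mono mult_right_mono) auto
  finally have 1: "L \<le> sqrt (p * L)" .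
  have "4 * B * sqrt (p * L) = sqrt (p * (16 * B\<^sup>2 * L))"
    using B by (simp add: real_sqrt_mult)
  also have "\<dots> \<le> sqrt (p * p)" using p assms by (intro real_sqrt_le_mono mult_left_mono) auto
  finally have 2: "4 * B * sqrt (p * L) \<le> p" using p by simp
  have "B * (sqrt (p * L) + L) \<le> B * (2 * sqrt (p * L))" using 1 B by (intro mult_left_mono) auto
  then have 3: "B * (sqrt (p * L) + L) \<le> 2 * B * sqrt (p * L)" by simp
  then show "B * (sqrt (p * L) + L) \<le> p / 2" using 2 by linarith
  have "sqrt (p * L) = p * sqrt (L / p)"
    using p L by (simp add: real_sqrt_mult real_sqrt_divide field_simps)
  then show "B * (sqrt (p * L) + L) \<le> 2 * B * p * sqrt (L / p)" using 3 by (simp add: mult.assoc)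
qed

text \<open>The averaging interval \<open>J\<close> is cut out of \<open>D\<close> by the fit; it
  contains \<open>D \<inter> {u..}\<close> because \<open>f\<close> is monotone. This inclusion
  bounds its mass from below, while \<open>J \<subseteq> D\<close> bounds the mean of
  \<open>\<psi>\<close> over it by \<open>c\<close>.\<close>

lemma fit_le:
  assumes D: "\<And>v w. w \<in> D \<Longrightarrow> v \<le> w \<Longrightarrow> v \<in> D"
    and c: "\<And>w. w \<in> D \<Longrightarrow> \<psi> w \<le> c" "\<bar>c\<bar> \<le> K + 1"
    and q: "n * measure \<mu> (D \<inter> {u..}) \<ge> 16 * B\<^sup>2 * L"
  shows "f u \<le> c + 4 * B * (K + 2) * sqrt (L / (n * measure \<mu> (D \<inter> {u..})))"
proof -
  define J where "J = D \<inter> {w. f u \<le> f w}"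
  have J: "is_interval J"
    unfolding is_interval_1 J_def using D f_mono by (auto simp: mono_def) (meson order_trans)+
  then have Jb: "J \<in> sets \<mu>" using real_interval_borel_measurable sets_mu by blast
  define p where "p = n * measure \<mu> J"
  define N :: real where "N = card {i. i < n \<and> t i \<in> J}"
  define q' where "q' = n * measure \<mu> (D \<inter> {u..})"
  have "measure \<mu> (D \<inter> {u..}) \<le> measure \<mu> J"
    using f_mono Jb by (intro finite_measure_mono) (auto simp: J_def mono_def)
  then have qp: "q' \<le> p" by (simp add: q'_def p_def mult_left_mono)
  have q0: "q' > 0" "q' \<ge> 16 * B\<^sup>2 * L"
    using q B L unfolding q'_def by (smt (verit) mult_pos_pos zero_less_power)+
  then have p0: "p > 0" "p \<ge> 16 * B\<^sup>2 * L" using qp by auto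
  define d where "d = B * (sqrt (p * L) + L)"
  have d: "d \<le> p / 2" "d \<le> 2 * B * p * sqrt (L / p)" "d \<ge> 0"
    using sqrt_ratio_le[OF p0(2)] B L p0 by (auto simp: d_def)
  have N: "\<bar>N - p\<bar> \<le> d" using count[OF J] by (simp add: N_def p_def d_def)
  then have N2: "N \<ge> p / 2" using d by linarith
  have "(\<integral>w. \<psi> w * indicator J w \<partial>\<mu>) \<le> (\<integral>w. c * indicator J w \<partial>\<mu>)"
  proof (rule integral_mono)
    have "\<psi> \<in> borel_measurable \<mu>"
      using borel_measurable_mono[OF psi_mono] measurable_cong_sets[OF sets_mu refl] by blast
    then show "integrable \<mu> (\<lambda>w. \<psi> w * indicator J w)"
      using Jb psi_le K_nonneg
      by (intro integrable_const_bound[where B=K]) (auto split: split_indicator)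
    show "integrable \<mu> (\<lambda>w. c * indicator J w)"
      using Jb by (intro integrable_mult_right integrable_real_indicator) (auto simp: less_top[symmetric])
  qed (use c in \<open>auto split: split_indicator simp: J_def\<close>)
  also have "\<dots> = c * measure \<mu> J" using Jb by simp
  finally have "n * (\<integral>w. \<psi> w * indicator J w \<partial>\<mu>) \<le> n * (c * measure \<mu> J)"
    by (rule mult_left_mono) simp
  then have int: "n * (\<integral>w. \<psi> w * indicator J w \<partial>\<mu>) \<le> c * p" by (simp add: p_def mult_ac)
  have "f u * N \<le> (\<Sum>i | i < n \<and> t i \<in> J. y i)"
    using iso_fit_le_block_mean[where D=D and u=u, OF fit D] by (simp add: N_def J_def conj_ac)
  also have "\<dots> \<le> n * (\<integral>w. \<psi> w * indicator J w \<partial>\<mu>) + d"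
    using sum_le[OF J] by (simp add: d_def p_def)
  also have "\<dots> \<le> c * p + d" using int by simp
  \<comment> \<open>\<open>c\<close> may be negative, so the expected count is exchanged for the
    actual one at the price of \<open>\<bar>c\<bar> * d\<close>.\<close>
  also have "c * p \<le> c * N + \<bar>c\<bar> * d"
  proof -
    have "c * (p - N) \<le> \<bar>c\<bar> * \<bar>p - N\<bar>" by (simp add: abs_mult[symmetric])
    also have "\<dots> \<le> \<bar>c\<bar> * d" using N by (intro mult_left_mono) auto
    finally show ?thesis by (simp add: algebra_simps)
  qed
  finally have "(f u - c) * N \<le> (\<bar>c\<bar> + 1) * d" by (simp add: algebra_simps)
  also have "\<dots> \<le> (K + 2) * d" using c d by (intro mult_right_mono) auto
  also have "\<dots> \<le> (K + 2) * (2 * B * p * sqrt (L / p))" using d K_nonneg by (intro mult_left_mono) auto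
  also have "\<dots> = (4 * B * (K + 2) * sqrt (L / p)) * (p / 2)" by simp
  also have "\<dots> \<le> (4 * B * (K + 2) * sqrt (L / p)) * N"
    using N2 B K_nonneg L p0 by (intro mult_left_mono) auto
  finally have "f u - c \<le> 4 * B * (K + 2) * sqrt (L / p)"
    using N2 p0 by (simp only: mult_le_cancel_right)
  \<comment> \<open>The data-dependent interval disappears here: its expected count is replaced by
    the smaller one of \<open>D \<inter> {u..}\<close>.\<close>
  also have "\<dots> \<le> 4 * B * (K + 2) * sqrt (L / q')"
    using B K_nonneg L q0 p0 qp by (intro mult_left_mono real_sqrt_le_mono divide_left_mono) auto
  finally show ?thesis by (simp add: q'_def)
qed

end

section \<open>Summation over blocks and dyadic scales\<close>

context monotone_fit_sample begin

text \<open>The unit \<open>16 * B\<^sup>2 * L\<close> is the expected count from which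
  \<open>fit_le\<close> applies, so level 0 is the part of \<open>D\<close> where averaging inside
  \<open>D\<close> gives no information.\<close>

definition segment_end :: "real set \<Rightarrow> nat \<Rightarrow> real set" where
  "segment_end D k = {u \<in> D. measure \<mu> (D \<inter> {u..}) < 2 ^ k * (16 * B\<^sup>2 * L) / n}"

lemma segment_end_measure:
  assumes "D \<in> sets borel"
  shows "segment_end D k \<in> sets \<mu>" "measure \<mu> (segment_end D k) \<le> 2 ^ k * (16 * B\<^sup>2 * L) / n"
proof -
  have r: "0 \<le> 2 ^ k * (16 * B\<^sup>2 * L) / n" using B L by simp
  note * = measure_upper_tail_le[OF finite_measure_axioms sets_mu assms r]
  show "segment_end D k \<in> sets \<mu>" using *(1) by (simp add: segment_end_def sets_mu)
  show "measure \<mu> (segment_end D k) \<le> 2 ^ k * (16 * B\<^sup>2 * L) / n"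
    using *(2) r by (simp add: segment_end_def emeasure_eq_measure)
qed

text \<open>
  Within a block \<open>D\<close> on which \<open>\<psi>\<close> stays below \<open>c\<close>, the squared error is of order \<open>L / q\<close> with
  \<open>q\<close> the expected number of observations between \<open>u\<close> and the end of the block; the dyadic
  sum dominates \<open>L / q\<close>, and each of its terms integrates to order \<open>L / n\<close>.
\<close>

definition block_err :: "real set \<Rightarrow> nat \<Rightarrow> real \<Rightarrow> real" where
  "block_err D T u =
     (\<Sum>k<T. 2 * (4 * B * (K + 2))\<^sup>2 * L / (2 ^ k * (16 * B\<^sup>2 * L)) * indicator (segment_end D (Suc k)) u)
     + (2 * K + 4 * B * (K + 2))\<^sup>2 * indicator (segment_end D 0) u"

lemma block_err_nonneg: "block_err D T u \<ge> 0"
  using L by (auto simp: block_err_def intro!: add_nonneg_nonneg sum_nonneg mult_nonneg_nonneg)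

text \<open>The weight of a dyadic term halves from one scale to the next while the bound on the
  mass of its set doubles, so every scale costs the same
  \<open>4 * (4 * B * (K + 2))\<^sup>2 * L / n\<close>. With \<open>T\<close> of order
  \<open>log n\<close>, this is the source of the second logarithm.\<close>

lemma block_err_integral:
  assumes D: "D \<in> sets borel"
  shows "integrable \<mu> (block_err D T)"
    and "(\<integral>u. block_err D T u \<partial>\<mu>)
      \<le> (4 * (4 * B * (K + 2))\<^sup>2 * T + 16 * B\<^sup>2 * (2 * K + 4 * B * (K + 2))\<^sup>2) * L / n"
proof -
  define a where "a k = 2 * (4 * B * (K + 2))\<^sup>2 * L / (2 ^ k * (16 * B\<^sup>2 * L))" for k :: nat
  have int: "integrable \<mu> (\<lambda>u. b * indicator (segment_end D k) u :: real)" for b k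
    using segment_end_measure(1)[OF D]
    by (intro integrable_mult_right integrable_real_indicator) (auto simp: less_top[symmetric])
  have integral_ind: "(\<integral>u. b * indicator (segment_end D k) u \<partial>\<mu>) = b * measure \<mu> (segment_end D k)" for b :: real and k
    using segment_end_measure(1)[OF D] by simp
  have eq: "block_err D T = (\<lambda>u. (\<Sum>k<T. a k * indicator (segment_end D (Suc k)) u)
      + (2 * K + 4 * B * (K + 2))\<^sup>2 * indicator (segment_end D 0) u)"
    by (simp add: block_err_def a_def fun_eq_iff)
  show "integrable \<mu> (block_err D T)"
    unfolding eq by (intro Bochner_Integration.integrable_add Bochner_Integration.integrable_sum int)
  have "(\<integral>u. block_err D T u \<partial>\<mu>) = (\<Sum>k<T. a k * measure \<mu> (segment_end D (Suc k)))
      + (2 * K + 4 * B * (K + 2))\<^sup>2 * measure \<mu> (segment_end D 0)"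
    unfolding eq
    by (simp only: Bochner_Integration.integral_add[OF Bochner_Integration.integrable_sum[OF int] int]
        Bochner_Integration.integral_sum[OF int] integral_ind)
  also have "\<dots> \<le> (\<Sum>k<T. 4 * (4 * B * (K + 2))\<^sup>2 * L / n)
      + (2 * K + 4 * B * (K + 2))\<^sup>2 * (2 ^ 0 * (16 * B\<^sup>2 * L) / n)"
  proof (intro add_mono sum_mono mult_left_mono segment_end_measure(2)[OF D])
    fix k
    have "a k \<ge> 0" using L by (simp add: a_def)
    then have "a k * measure \<mu> (segment_end D (Suc k)) \<le> a k * (2 ^ Suc k * (16 * B\<^sup>2 * L) / n)"
      by (intro mult_left_mono segment_end_measure(2)[OF D])
    also have "\<dots> = 4 * (4 * B * (K + 2))\<^sup>2 * L / n"
      using B L by (simp add: a_def field_simps)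
    finally show "a k * measure \<mu> (segment_end D (Suc k)) \<le> 4 * (4 * B * (K + 2))\<^sup>2 * L / n" .
  qed simp
  also have "\<dots> = (4 * (4 * B * (K + 2))\<^sup>2 * T + 16 * B\<^sup>2 * (2 * K + 4 * B * (K + 2))\<^sup>2) * L / n"
    by (simp add: algebra_simps add_divide_distrib)
  finally show "(\<integral>u. block_err D T u \<partial>\<mu>)
      \<le> (4 * (4 * B * (K + 2))\<^sup>2 * T + 16 * B\<^sup>2 * (2 * K + 4 * B * (K + 2))\<^sup>2) * L / n" .
qed

text \<open>Near the end of \<open>D\<close> too few observations remain in \<open>D\<close>; there
  the whole line serves as initial segment, with \<open>c = K\<close>, and gives a bounded error.
  Only where even the whole line has too few observations to the right is the bound
  \<open>B * L\<close> on \<open>f\<close> used. That term is kept out of \<open>block_err\<close>: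
  added over order \<open>n powr (1/3)\<close> blocks it would be of order
  \<open>L ^ 3 * n powr (-2/3)\<close>.\<close>

lemma error_pointwise:
  assumes eta: "0 < \<eta>" "\<eta> \<le> 1" and T: "2 ^ T > real n"
    and D: "D = {w. \<psi> w < c}" and u: "u \<in> D" "c \<le> \<psi> u + \<eta>"
  shows "(max 0 (f u - \<psi> u))\<^sup>2
    \<le> 2 * \<eta>\<^sup>2 + block_err D T u + (B * L + K)\<^sup>2 * indicator (segment_end UNIV 0) u"
proof -
  define l where "l = 16 * B\<^sup>2 * L"
  define A where "A = 4 * B * (K + 2)"
  have A: "A \<ge> 0" using B K_nonneg by (simp add: A_def)
  have "B\<^sup>2 \<ge> 1" using B by simp
  then have BL: "1 * L \<le> B\<^sup>2 * L" using L by (intro mult_right_mono) auto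
  then have l: "l \<ge> 1" "l \<ge> L" using L unfolding l_def mult.assoc by linarith+
  define q where "q = n * measure \<mu> (D \<inter> {u..})"
  define q1 where "q1 = n * measure \<mu> (UNIV \<inter> {u..})"
  have segment_end_iff: "v \<in> segment_end V k \<longleftrightarrow> v \<in> V \<and> n * measure \<mu> (V \<inter> {v..}) < 2 ^ k * l" for v V k
    using pos_n by (auto simp: segment_end_def l_def field_simps)
  have ge2: "(2 * K + A)\<^sup>2 * indicator (segment_end D 0) u \<ge> 0" by simp
  have ge3: "(B * L + K)\<^sup>2 * indicator (segment_end UNIV 0) u \<ge> 0" by simp
  have sq: "(max 0 (f u - \<psi> u))\<^sup>2 \<le> b\<^sup>2" if "f u - \<psi> u \<le> b" "b \<ge> 0" for b
    using that by (intro power_mono) auto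
  have psi: "- K \<le> \<psi> u" "\<psi> u \<le> K" using psi_le[of u] by auto
  consider "q \<ge> l" | "q < l" "q1 \<ge> l" | "q1 < l" by linarith
  then show ?thesis
  proof cases
    case 1
    have "\<bar>c\<bar> \<le> K + 1" using psi u D eta by (auto simp: abs_le_iff)
    then have "f u \<le> c + A * sqrt (L / q)"
      using 1 unfolding q_def l_def A_def by (intro fit_le) (use D psi_mono in \<open>auto simp: mono_def intro: le_less_trans\<close>)
    then have "f u - \<psi> u \<le> \<eta> + A * sqrt (L / q)" using u by simp
    from sq[OF this] have "(max 0 (f u - \<psi> u))\<^sup>2 \<le> (\<eta> + A * sqrt (L / q))\<^sup>2"
      using eta A L 1 l by simp
    also have "\<dots> \<le> 2 * \<eta>\<^sup>2 + 2 * (A * sqrt (L / q))\<^sup>2"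
      using sum_squares_bound[of \<eta> "A * sqrt (L / q)"] by (simp add: power2_sum)
    also have "2 * (A * sqrt (L / q))\<^sup>2 = 2 * A\<^sup>2 * L / q"
      using 1 l L by (simp add: power_mult_distrib)
    also have "\<dots> \<le> block_err D T u"
    proof -
      \<comment> \<open>The expected count never exceeds \<open>n < 2 ^ T\<close>, so
        \<open>T\<close> dyadic scales above the threshold \<open>l\<close> reach every
        \<open>q\<close>.\<close>
      have "q \<le> n" using prob_le_1[of "D \<inter> {u..}"] by (simp add: q_def mult_left_le)
      also have "\<dots> < 2 ^ T * 1" using T by simp
      also have "\<dots> \<le> 2 ^ T * l" using l by (intro mult_left_mono) auto
      finally obtain k where k: "k < T" "2 ^ k * l \<le> q" "q < 2 ^ Suc k * l"
        using dyadic_scale[of l q T] 1 l by auto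
      have "2 * A\<^sup>2 * L / q \<le> 2 * A\<^sup>2 * L / (2 ^ k * l)"
        using k l L by (intro divide_left_mono mult_pos_pos) auto
      also have "\<dots> = 2 * A\<^sup>2 * L / (2 ^ k * l) * indicator (segment_end D (Suc k)) u"
        using k u by (simp add: segment_end_iff q_def)
      also have "\<dots> \<le> (\<Sum>k<T. 2 * A\<^sup>2 * L / (2 ^ k * l) * indicator (segment_end D (Suc k)) u)"
        using k l L by (intro member_le_sum) auto
      finally show ?thesis using ge2 unfolding block_err_def A_def l_def by linarith
    qed
    finally show ?thesis using ge3 by linarith
  next
    case 2
    have "f u \<le> K + A * sqrt (L / q1)"
      using 2 psi_le K_nonneg unfolding q1_def l_def A_def
      by (intro fit_le) (auto simp: abs_le_iff)
    also have "\<dots> \<le> K + A * 1"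
      using 2 l L A by (intro add_left_mono mult_left_mono) auto
    finally have "f u - \<psi> u \<le> 2 * K + A" using psi by simp
    from sq[OF this] have "(max 0 (f u - \<psi> u))\<^sup>2 \<le> (2 * K + A)\<^sup>2 * indicator (segment_end D 0) u"
      using A K_nonneg 2 u by (simp add: segment_end_iff q_def)
    also have "\<dots> \<le> block_err D T u"
      using L by (auto simp: block_err_def A_def intro!: sum_nonneg mult_nonneg_nonneg)
    finally show ?thesis using ge3 eta by (smt (verit) zero_le_power2)
  next
    case 3
    have "f u - \<psi> u \<le> B * L + K" using f_le[of u] psi by simp
    from sq[OF this] have "(max 0 (f u - \<psi> u))\<^sup>2 \<le> (B * L + K)\<^sup>2 * indicator (segment_end UNIV 0) u"
      using B L K_nonneg 3 by (simp add: segment_end_iff q1_def)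
    then show ?thesis using block_err_nonneg[of D T u] by (smt (verit) zero_le_power2)
  qed
qed

lemma error_integral_le:
  fixes N T :: nat and \<eta> :: real
  assumes eta: "0 < \<eta>" "\<eta> \<le> 1" and T: "2 ^ T > real n" and N: "N * \<eta> > 2 * K"
  shows "(\<integral>\<^sup>+u. ennreal ((max 0 (f u - \<psi> u))\<^sup>2) \<partial>\<mu>) \<le> ennreal (2 * \<eta>\<^sup>2
    + N * ((4 * (4 * B * (K + 2))\<^sup>2 * T + 16 * B\<^sup>2 * (2 * K + 4 * B * (K + 2))\<^sup>2) * L / n)
    + (B * L + K)\<^sup>2 * (16 * B\<^sup>2 * L / n))"
proof -
  define D where "D j = {w. \<psi> w < - K + real j * \<eta>}" for j :: nat
  have D: "D j \<in> sets borel" for j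
    unfolding D_def using borel_measurable_mono[OF psi_mono] by measurable
  define F where "F u = 2 * \<eta>\<^sup>2 + (\<Sum>j=1..N. block_err (D j) T u)
    + (B * L + K)\<^sup>2 * indicator (segment_end UNIV 0) u" for u
  have pw: "(max 0 (f u - \<psi> u))\<^sup>2 \<le> F u" for u
  proof -
    \<comment> \<open>The first grid level strictly above \<open>\<psi> u\<close>, since
      \<open>D j\<close> is defined by a strict inequality; it is at most \<open>\<eta>\<close> too
      high. The condition on \<open>N\<close> keeps it on the grid.\<close>
    define j where "j = nat \<lfloor>(\<psi> u + K) / \<eta>\<rfloor> + 1"
    have psi: "0 \<le> \<psi> u + K" "\<psi> u + K \<le> 2 * K" using psi_le[of u] by auto
    have 1: "real j - 1 \<le> (\<psi> u + K) / \<eta>" "(\<psi> u + K) / \<eta> < real j"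
      using psi eta by (auto simp: j_def) linarith
    then have 2: "u \<in> D j" "- K + real j * \<eta> \<le> \<psi> u + \<eta>"
      using eta by (auto simp: D_def field_simps)
    have "(real j - 1) * \<eta> < N * \<eta>" using 1(1) eta N psi by (simp add: field_simps)
    then have "j \<in> {1..N}" using eta by (auto simp: j_def)
    \<comment> \<open>The index depends on \<open>u\<close>; summing over all \<open>j\<close>
      removes the dependence and costs the factor \<open>N\<close> in the integral.\<close>
    then have "block_err (D j) T u \<le> (\<Sum>j=1..N. block_err (D j) T u)"
      by (intro member_le_sum block_err_nonneg) auto
    then show ?thesis
      using error_pointwise[OF eta T D_def 2] by (simp add: F_def)
  qed
  have int: "integrable \<mu> (\<lambda>u. (B * L + K)\<^sup>2 * indicator (segment_end UNIV 0) u :: real)"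
    using segment_end_measure(1)[of UNIV 0]
    by (intro integrable_mult_right integrable_real_indicator) (auto simp: less_top[symmetric])
  have intb: "integrable \<mu> (\<lambda>u. block_err (D j) T u)" for j
    using block_err_integral(1)[OF D] .
  have ints: "integrable \<mu> (\<lambda>u. \<Sum>j=1..N. block_err (D j) T u)"
    by (intro Bochner_Integration.integrable_sum intb)
  have intc: "integrable \<mu> (\<lambda>u. 2 * \<eta>\<^sup>2)" by simp
  have intF: "integrable \<mu> F"
    unfolding F_def by (intro Bochner_Integration.integrable_add intc ints int)
  have "(\<integral>\<^sup>+u. ennreal ((max 0 (f u - \<psi> u))\<^sup>2) \<partial>\<mu>) \<le> (\<integral>\<^sup>+u. ennreal (F u) \<partial>\<mu>)"
    by (intro nn_integral_mono ennreal_leI pw)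
  also have "\<dots> = ennreal (\<integral>u. F u \<partial>\<mu>)"
    by (intro nn_integral_eq_integral intF AE_I2) (use pw zero_le_power2 order_trans in blast)
  also have "(\<integral>u. F u \<partial>\<mu>) = 2 * \<eta>\<^sup>2 + (\<Sum>j=1..N. \<integral>u. block_err (D j) T u \<partial>\<mu>)
      + (B * L + K)\<^sup>2 * measure \<mu> (segment_end UNIV 0)"
    unfolding F_def using segment_end_measure(1)[of UNIV 0]
    by (simp only: Bochner_Integration.integral_add[OF Bochner_Integration.integrable_add[OF intc ints] int]
        Bochner_Integration.integral_add[OF intc ints] Bochner_Integration.integral_sum[OF intb])
      (simp add: prob_space)
  also have "\<dots> \<le> 2 * \<eta>\<^sup>2
    + (\<Sum>j=1..N. (4 * (4 * B * (K + 2))\<^sup>2 * T + 16 * B\<^sup>2 * (2 * K + 4 * B * (K + 2))\<^sup>2) * L / n)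
    + (B * L + K)\<^sup>2 * (2 ^ 0 * (16 * B\<^sup>2 * L) / n)"
    by (intro add_mono order_refl sum_mono block_err_integral(2) D mult_left_mono segment_end_measure(2)) auto
  finally show ?thesis by (simp add: ennreal_leI)
qed

text \<open>With \<open>x = n powr (1/3)\<close> and mesh \<open>1 / x\<close>, the squared mesh is
  \<open>1 / x\<^sup>2\<close>, about \<open>2 * K * x\<close> blocks cost order
  \<open>L\<^sup>2 / x ^ 3\<close> each, and the right edge costs order
  \<open>L ^ 3 / x ^ 3\<close>. The crude \<open>L \<le> 3 * x\<close> is enough for the edge and
  explains \<open>48 = 16 * 3\<close>.\<close>

lemma error_integral_rate:
  assumes L_eq: "L = ln n"
  shows "(\<integral>\<^sup>+u. ennreal ((max 0 (f u - \<psi> u))\<^sup>2) \<partial>\<mu>) \<le>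
    ennreal ((2 + (2 * K + 2) * (16 * (4 * B * (K + 2))\<^sup>2 + 16 * B\<^sup>2 * (2 * K + 4 * B * (K + 2))\<^sup>2)
      + (B + K)\<^sup>2 * 48 * B\<^sup>2) * (L\<^sup>2 * n powr (-2/3)))"
proof -
  define x where "x = real n powr (1/3)"
  have n1: "real n \<ge> 1" using pos_n by simp
  have x: "x \<ge> 1" using n1 by (simp add: x_def ge_one_powr_ge_zero)
  have x3: "real n = x ^ 3" using n1 by (simp add: x_def powr_realpow[symmetric] powr_powr)
  have x2: "n powr (-2/3) = 1 / x\<^sup>2"
    using n1 by (simp add: x_def powr_realpow[symmetric] powr_powr powr_minus_divide)
  have Lx: "L \<le> 3 * x"
  proof -
    have "ln (real n) = 3 * ln x" using x by (simp add: x3 ln_realpow)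
    also have "\<dots> \<le> 3 * x" using ln_le_minus_one[of x] x by simp
    finally show ?thesis by (simp add: L_eq)
  qed
  define T where "T = nat \<lfloor>log 2 n\<rfloor> + 1"
  have "log 2 n < real T" using n1 by (simp add: T_def) linarith
  then have "2 powr (log 2 n) < 2 powr real T" by simp
  then have T: "2 ^ T > real n" using n1 by (simp add: powr_realpow)
  have "ln 2 \<ge> (1/2::real)" using ln2_ge_two_thirds by simp
  then have "log 2 n \<le> 2 * L" using L by (simp add: log_def L_eq field_simps)
  \<comment> \<open>\<open>T\<close> is at most \<open>log 2 n + 1\<close>, hence at most
    \<open>2 * L + 1\<close>, and \<open>L \<ge> 1\<close> absorbs the rest.\<close>
  then have TL: "real T \<le> 4 * L" using n1 L by (simp add: T_def) linarith
  define N where "N = nat \<lfloor>2 * K * x\<rfloor> + 1"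
  have "2 * K * x < N" using x K_nonneg by (simp add: N_def) linarith
  then have N: "N * (1 / x) > 2 * K" using x by (simp add: field_simps)
  have "real N \<le> 2 * K * x + 1" using x K_nonneg by (simp add: N_def)
  then have Nx: "real N \<le> (2 * K + 2) * x" using x K_nonneg by (simp add: algebra_simps)
  have L2: "1 \<le> L\<^sup>2" "L \<le> L\<^sup>2" using L by (auto simp: self_le_power)
  define a where "a = (4 * B * (K + 2))\<^sup>2"
  define b where "b = 16 * B\<^sup>2 * (2 * K + 4 * B * (K + 2))\<^sup>2"
  have ab: "a \<ge> 0" "b \<ge> 0" by (auto simp: a_def b_def)
  have 1: "2 * (1/x)\<^sup>2 \<le> 2 * (L\<^sup>2 / x\<^sup>2)" using L2 x by (simp add: field_simps)
  have "(4 * a * T + b) * L \<le> (4 * a * (4 * L) + b * L) * L"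
    using TL ab L by (intro mult_right_mono add_mono mult_left_mono) (auto simp: mult_le_cancel_left1)
  also have "\<dots> = (16 * a + b) * L\<^sup>2" by (simp add: power2_eq_square algebra_simps)
  finally have "real N * ((4 * a * T + b) * L) \<le> ((2 * K + 2) * x) * ((16 * a + b) * L\<^sup>2)"
    using Nx ab L K_nonneg x by - (rule mult_mono, auto)
  then have "real N * ((4 * a * T + b) * L) / n \<le> ((2 * K + 2) * x) * ((16 * a + b) * L\<^sup>2) / n"
    by (intro divide_right_mono) auto
  also have "\<dots> = (2 * K + 2) * (16 * a + b) * (L\<^sup>2 / x\<^sup>2)"
    using x by (simp add: x3 power2_eq_square power3_eq_cube)
  finally have 2: "N * ((4 * a * T + b) * L / n) \<le> (2 * K + 2) * (16 * a + b) * (L\<^sup>2 / x\<^sup>2)" by simp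
  have "B * L + K \<le> (B + K) * L" using L K_nonneg by (simp add: algebra_simps mult_le_cancel_left1)
  then have "(B * L + K)\<^sup>2 \<le> ((B + K) * L)\<^sup>2" using B L K_nonneg by (intro power_mono) auto
  then have "(B * L + K)\<^sup>2 * (16 * B\<^sup>2 * L) \<le> ((B + K) * L)\<^sup>2 * (16 * B\<^sup>2 * (3 * x))"
    using Lx L by (intro mult_mono) auto
  then have "(B * L + K)\<^sup>2 * (16 * B\<^sup>2 * L) / n \<le> ((B + K) * L)\<^sup>2 * (16 * B\<^sup>2 * (3 * x)) / n"
    by (intro divide_right_mono) auto
  also have "\<dots> = (B + K)\<^sup>2 * 48 * B\<^sup>2 * (L\<^sup>2 / x\<^sup>2)"
    using x by (simp add: x3 power2_eq_square power3_eq_cube)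
  finally have 3: "(B * L + K)\<^sup>2 * (16 * B\<^sup>2 * L / n) \<le> (B + K)\<^sup>2 * 48 * B\<^sup>2 * (L\<^sup>2 / x\<^sup>2)" by simp
  have eta: "0 < 1 / x" "1 / x \<le> 1" using x by auto
  have "2 * (1 / x)\<^sup>2 + N * ((4 * a * T + b) * L / n) + (B * L + K)\<^sup>2 * (16 * B\<^sup>2 * L / n)
      \<le> (2 + (2 * K + 2) * (16 * a + b) + (B + K)\<^sup>2 * 48 * B\<^sup>2) * (L\<^sup>2 / x\<^sup>2)"
    using 1 2 3 by (simp only: distrib_right)
  then show ?thesis
    using error_integral_le[OF eta T N] unfolding a_def b_def x2
    by (simp add: order_trans[OF _ ennreal_leI])
qed

end

section \<open>Two-sided error by reflection\<close>

definition fit_const :: "real \<Rightarrow> real \<Rightarrow> real" where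
  "fit_const K B = 2 + (2 * K + 2) * (16 * (4 * B * (K + 2))\<^sup>2 + 16 * B\<^sup>2 * (2 * K + 4 * B * (K + 2))\<^sup>2)
      + (B + K)\<^sup>2 * 48 * B\<^sup>2"

lemma is_interval_uminus_vimage: "is_interval (J :: real set) \<Longrightarrow> is_interval (uminus -` J)"
  unfolding is_interval_1 by (metis neg_le_iff_le vimage_eq)

text \<open>The square of \<open>f u - \<psi> u\<close> is the sum of the squares of its positive
  and negative parts. The negative part is the positive part for the data with all signs changed,
  whose covariate law is the image of \<open>\<mu>\<close> under negation. Each half contributes
  \<open>fit_const K B\<close>, which involves neither \<open>n\<close> nor the sample.\<close>

lemma monotone_fit_error:
  assumes "prob_space \<mu>" and sets: "sets \<mu> = sets borel" and fit: "iso_fit n t y f"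
    and psi: "mono \<psi>" "\<And>u. \<bar>\<psi> u\<bar> \<le> K" and B: "B \<ge> 1" and L: "L \<ge> 1" "L = ln n"
    and count: "\<And>J. is_interval J \<Longrightarrow>
      \<bar>card {i. i < n \<and> t i \<in> J} - n * measure \<mu> J\<bar> \<le> B * (sqrt (n * measure \<mu> J * L) + L)"
    and sums: "\<And>J. is_interval J \<Longrightarrow> \<bar>(\<Sum>i | i < n \<and> t i \<in> J. y i)
      - n * (\<integral>w. \<psi> w * indicator J w \<partial>\<mu>)\<bar> \<le> B * (sqrt (n * measure \<mu> J * L) + L)"
    and y: "\<And>i. i < n \<Longrightarrow> \<bar>y i\<bar> \<le> B * L"
  shows "(\<integral>\<^sup>+u. ennreal ((f u - \<psi> u)\<^sup>2) \<partial>\<mu>) \<le> ennreal (2 * fit_const K B * (L\<^sup>2 * n powr (-2/3)))"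
proof -
  interpret prob_space \<mu> by fact
  define a where "a = fit_const K B * (L\<^sup>2 * n powr (-2/3))"
  have K: "K \<ge> 0" using psi(2)[of 0] by linarith
  have a: "a \<ge> 0" using K by (simp add: a_def fit_const_def)
  have mono_meas: "h \<in> borel_measurable \<mu>" if "mono h" for h :: "real \<Rightarrow> real"
    using borel_measurable_mono[OF that] measurable_cong_sets[OF sets refl] by blast
  have f: "mono f" using fit by (simp add: iso_fit_def)
  interpret up: monotone_fit_sample \<mu> n t y f \<psi> K B L
  proof
    show "(\<Sum>i | i < n \<and> t i \<in> J. y i) \<le> n * (\<integral>w. \<psi> w * indicator J w \<partial>\<mu>) + B * (sqrt (n * prob J * L) + L)"
      if "is_interval J" for J
      using sums[OF that] by linarith
    show "f u \<le> B * L" for u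
      using y by (intro iso_fit_le_bound[OF fit]) (auto simp: abs_le_iff)
  qed (use sets fit psi B L count in auto)
  define \<nu> where "\<nu> = distr \<mu> borel uminus"
  have um [measurable]: "uminus \<in> borel_measurable \<mu>"
    unfolding measurable_cong_sets[OF sets refl] by measurable
  have nu: "measure \<nu> J = measure \<mu> (uminus -` J)" if "is_interval J" for J
    using measure_distr[OF um real_interval_borel_measurable[OF that]] sets_eq_imp_space_eq[OF sets]
    by (simp add: \<nu>_def)
  interpret lo: monotone_fit_sample \<nu> n "\<lambda>i. - t i" "\<lambda>i. - y i" "\<lambda>u. - f (- u)" "\<lambda>u. - \<psi> (- u)" K B L
  proof -
    interpret \<nu>: prob_space \<nu> unfolding \<nu>_def by (rule prob_space_distr) measurable
    show "monotone_fit_sample \<nu> n (\<lambda>i. - t i) (\<lambda>i. - y i) (\<lambda>u. - f (- u)) (\<lambda>u. - \<psi> (- u)) K B L"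
    proof
      show "iso_fit n (\<lambda>i. - t i) (\<lambda>i. - y i) (\<lambda>u. - f (- u))" by (rule iso_fit_reflect[OF fit])
      show "mono (\<lambda>u. - \<psi> (- u))" using psi(1) by (auto simp: mono_def)
      show "- f (- u) \<le> B * L" for u
        using y by (intro iso_fit_le_bound[OF iso_fit_reflect[OF fit]]) (auto simp: abs_le_iff)
      \<comment> \<open>Negation maps intervals to intervals, so the two-sided hypotheses carry over
        to the reflected data.\<close>
      fix J :: "real set" assume J: "is_interval J"
      note J' = is_interval_uminus_vimage[OF J]
      have eq: "{i. i < n \<and> - t i \<in> J} = {i. i < n \<and> t i \<in> uminus -` J}" by auto
      show "\<bar>card {i. i < n \<and> - t i \<in> J} - n * measure \<nu> J\<bar> \<le> B * (sqrt (n * measure \<nu> J * L) + L)"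
        using count[OF J'] by (simp only: eq nu[OF J])
      have "(\<integral>w. - \<psi> (- w) * indicator J w \<partial>\<nu>) = (\<integral>w. - \<psi> (- (- w)) * indicator J (- w) \<partial>\<mu>)"
        unfolding \<nu>_def
      proof (rule integral_distr[OF um])
        have "(\<lambda>u. \<psi> (- u)) \<in> borel_measurable borel"
          using borel_measurable_mono[OF psi(1)] by measurable
        then show "(\<lambda>w. - \<psi> (- w) * indicator J w) \<in> borel_measurable borel"
          using real_interval_borel_measurable[OF J] by measurable
      qed
      also have "\<dots> = - (\<integral>w. \<psi> w * indicator (uminus -` J) w \<partial>\<mu>)"
        by (simp add: indicator_def)
      finally have "(\<integral>w. - \<psi> (- w) * indicator J w \<partial>\<nu>) = - (\<integral>w. \<psi> w * indicator (uminus -` J) w \<partial>\<mu>)" .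
      then show "(\<Sum>i | i < n \<and> - t i \<in> J. - y i)
          \<le> n * (\<integral>w. - \<psi> (- w) * indicator J w \<partial>\<nu>) + B * (sqrt (n * measure \<nu> J * L) + L)"
        using sums[OF J'] unfolding eq nu[OF J] by (simp add: sum_negf)
    qed (use psi(2) B L in \<open>auto simp: \<nu>_def\<close>)
  qed
  have 1: "(\<integral>\<^sup>+u. ennreal ((max 0 (f u - \<psi> u))\<^sup>2) \<partial>\<mu>) \<le> ennreal a"
    using up.error_integral_rate[OF L(2)] by (simp add: a_def fit_const_def)
  let ?h = "\<lambda>u. ennreal ((max 0 (- f (- u) - - \<psi> (- u)))\<^sup>2)"
  have [measurable]: "(\<lambda>u. \<psi> (- u)) \<in> borel_measurable borel" "(\<lambda>u. f (- u)) \<in> borel_measurable borel"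
    using borel_measurable_mono[OF psi(1)] borel_measurable_mono[OF f] by measurable
  have "(\<integral>\<^sup>+u. ennreal ((max 0 (\<psi> u - f u))\<^sup>2) \<partial>\<mu>) = (\<integral>\<^sup>+u. ?h (- u) \<partial>\<mu>)"
    by simp
  also have "\<dots> = (\<integral>\<^sup>+u. ?h u \<partial>\<nu>)"
    unfolding \<nu>_def by (rule nn_integral_distr[OF um, of ?h, symmetric]) measurable
  also have "\<dots> \<le> ennreal a"
    using lo.error_integral_rate[OF L(2)] by (simp add: a_def fit_const_def)
  finally have 2: "(\<integral>\<^sup>+u. ennreal ((max 0 (\<psi> u - f u))\<^sup>2) \<partial>\<mu>) \<le> ennreal a" .
  note [measurable] = mono_meas[OF f] mono_meas[OF psi(1)]
  have "(\<integral>\<^sup>+u. ennreal ((f u - \<psi> u)\<^sup>2) \<partial>\<mu>)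
      = (\<integral>\<^sup>+u. ennreal ((max 0 (f u - \<psi> u))\<^sup>2) + ennreal ((max 0 (\<psi> u - f u))\<^sup>2) \<partial>\<mu>)"
    by (intro nn_integral_cong) (simp add: max_def power2_commute)
  also have "\<dots> = (\<integral>\<^sup>+u. ennreal ((max 0 (f u - \<psi> u))\<^sup>2) \<partial>\<mu>) + (\<integral>\<^sup>+u. ennreal ((max 0 (\<psi> u - f u))\<^sup>2) \<partial>\<mu>)"
    by (intro nn_integral_add) measurable
  also have "\<dots> \<le> ennreal a + ennreal a" by (intro add_mono 1 2)
  also have "\<dots> = ennreal (2 * fit_const K B * (L\<^sup>2 * n powr (-2/3)))"
    using a by (simp add: a_def ennreal_plus[symmetric] del: ennreal_plus)
  finally show ?thesis .
qed

section \<open>Bernstein's inequality\<close>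

lemma exp_tail_sums:
  fixes x :: real
  shows "(\<lambda>m. x ^ (m + 2) / fact (m + 2)) sums (exp x - 1 - x)"
proof -
  have "(\<lambda>m. x ^ m / fact m) sums exp x"
    using exp_converges[of x] by (simp add: divide_inverse mult.commute)
  from sums_split_initial_segment[OF this, of 2] show ?thesis
    by (simp add: numeral_2_eq_2 diff_diff_eq)
qed

context prob_space
begin

lemma integrable_of_second_moment:
  assumes [measurable]: "W \<in> borel_measurable M" and "\<And>x. 0 \<le> W x"
    and "(\<integral>\<^sup>+x. ennreal (W x ^ 2) \<partial>M) < \<infinity>"
  shows "integrable M W"
proof -
  have "integrable M (\<lambda>x. (W x)\<^sup>2)"
    using assms by (intro integrableI_bounded) auto
  then show ?thesis by (rule square_integrable_imp_integrable[rotated]) simp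
qed

text \<open>The series of \<open>exp\<close> turns the factorial moment bound into a geometric series.\<close>

lemma bernstein_mgf_upper:
  fixes W :: "'a \<Rightarrow> real"
  assumes [measurable]: "W \<in> borel_measurable M" and W: "\<And>x. 0 \<le> W x"
    and mom: "\<And>m. m \<ge> 2 \<Longrightarrow> (\<integral>\<^sup>+x. ennreal (W x ^ m) \<partial>M) \<le> ennreal (fact m * b ^ (m - 2) * v)"
    and b: "b \<ge> 0" "v \<ge> 0" and l: "0 \<le> l" "l * b \<le> 1/2"
  shows "(\<integral>\<^sup>+x. ennreal (exp (l * (W x - expectation W))) \<partial>M) \<le> ennreal (exp (2 * l\<^sup>2 * v))"
proof -
  have int: "integrable M W"
    using mom[of 2] by (intro integrable_of_second_moment W) (auto intro: le_less_trans)
  define m1 where "m1 = expectation W"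
  have "(\<integral>\<^sup>+x. ennreal (exp (l * W x) - 1 - l * W x) \<partial>M)
      = (\<integral>\<^sup>+x. (\<Sum>m. ennreal ((l * W x) ^ (m + 2) / fact (m + 2))) \<partial>M)"
    using W l by (intro nn_integral_cong suminf_ennreal_eq[symmetric] exp_tail_sums) auto
  also have "\<dots> = (\<Sum>m. \<integral>\<^sup>+x. ennreal ((l * W x) ^ (m + 2) / fact (m + 2)) \<partial>M)"
    by (intro nn_integral_suminf) measurable
  also have "\<dots> \<le> (\<Sum>m. ennreal (l\<^sup>2 * v * (1/2) ^ m))"
  proof (intro suminf_le allI)
    fix m
    have "(\<integral>\<^sup>+x. ennreal ((l * W x) ^ (m + 2) / fact (m + 2)) \<partial>M)
        = (\<integral>\<^sup>+x. ennreal (l ^ (m + 2) / fact (m + 2)) * ennreal (W x ^ (m + 2)) \<partial>M)"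
      using l W by (intro nn_integral_cong)
        (simp add: ennreal_mult[symmetric] power_mult_distrib del: power_Suc power_add fact_Suc add_2_eq_Suc')
    also have "\<dots> = ennreal (l ^ (m + 2) / fact (m + 2)) * (\<integral>\<^sup>+x. ennreal (W x ^ (m + 2)) \<partial>M)"
      by (intro nn_integral_cmult) measurable
    also have "\<dots> \<le> ennreal (l ^ (m + 2) / fact (m + 2)) * ennreal (fact (m + 2) * b ^ m * v)"
      using mom[of "m + 2"] by (intro mult_left_mono) auto
    also have "\<dots> = ennreal (l ^ (m + 2) / fact (m + 2) * (fact (m + 2) * b ^ m * v))"
      using l b by (intro ennreal_mult[symmetric]) auto
    also have "l ^ (m + 2) / fact (m + 2) * (fact (m + 2) * b ^ m * v) = l\<^sup>2 * v * (l * b) ^ m"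
      by (simp add: power_add power_mult_distrib power2_eq_square del: fact_Suc)
    also have "ennreal (l\<^sup>2 * v * (l * b) ^ m) \<le> ennreal (l\<^sup>2 * v * (1/2) ^ m)"
      using l b by (intro ennreal_leI mult_left_mono power_mono) auto
    finally show "(\<integral>\<^sup>+x. ennreal ((l * W x) ^ (m + 2) / fact (m + 2)) \<partial>M) \<le> ennreal (l\<^sup>2 * v * (1/2) ^ m)" .
  qed auto
  also have "\<dots> = ennreal (2 * l\<^sup>2 * v)"
  proof (rule suminf_ennreal_eq)
    show "(\<lambda>m. l\<^sup>2 * v * (1/2) ^ m) sums (2 * l\<^sup>2 * v)"
      using sums_mult[OF geometric_sums[of "1/2::real"], of "l\<^sup>2 * v"] by (simp add: mult_ac)
  qed (use b in auto)
  finally have 1: "(\<integral>\<^sup>+x. ennreal (exp (l * W x) - 1 - l * W x) \<partial>M) \<le> ennreal (2 * l\<^sup>2 * v)" .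
  \<comment> \<open>The exponential is split into \<open>1 + l * W x\<close> and this remainder.
    Both are nonnegative, so the integral may be split in \<open>ennreal\<close>; the linear part
    gives the mean exactly and is cancelled by centring.\<close>
  have ge: "0 \<le> exp z - 1 - z" for z :: real using exp_ge_add_one_self[of z] by linarith
  have "(\<integral>\<^sup>+x. ennreal (exp (l * W x)) \<partial>M)
      = (\<integral>\<^sup>+x. ennreal (1 + l * W x) + ennreal (exp (l * W x) - 1 - l * W x) \<partial>M)"
    using W l ge by (intro nn_integral_cong) (subst ennreal_plus[symmetric], auto)
  also have "\<dots> = (\<integral>\<^sup>+x. ennreal (1 + l * W x) \<partial>M) + (\<integral>\<^sup>+x. ennreal (exp (l * W x) - 1 - l * W x) \<partial>M)"
    by (intro nn_integral_add) measurable
  also have "(\<integral>\<^sup>+x. ennreal (1 + l * W x) \<partial>M) = ennreal (1 + l * m1)"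
    using int W l by (subst nn_integral_eq_integral) (auto simp: m1_def prob_space)
  also have "\<dots> + (\<integral>\<^sup>+x. ennreal (exp (l * W x) - 1 - l * W x) \<partial>M) \<le> ennreal (1 + l * m1) + ennreal (2 * l\<^sup>2 * v)"
    using 1 by (intro add_left_mono)
  also have "\<dots> = ennreal (1 + l * m1 + 2 * l\<^sup>2 * v)"
    using W l b Bochner_Integration.integral_nonneg[of M W] by (intro ennreal_plus[symmetric]) (auto simp: m1_def)
  also have "\<dots> \<le> ennreal (exp (l * m1 + 2 * l\<^sup>2 * v))"
    using exp_ge_add_one_self[of "l * m1 + 2 * l\<^sup>2 * v"] by (intro ennreal_leI) linarith
  finally have 2: "(\<integral>\<^sup>+x. ennreal (exp (l * W x)) \<partial>M) \<le> ennreal (exp (l * m1 + 2 * l\<^sup>2 * v))" .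
  have "(\<integral>\<^sup>+x. ennreal (exp (l * (W x - m1))) \<partial>M)
      = (\<integral>\<^sup>+x. ennreal (exp (- (l * m1))) * ennreal (exp (l * W x)) \<partial>M)"
    by (intro nn_integral_cong) (simp add: ennreal_mult[symmetric] exp_add[symmetric] algebra_simps)
  also have "\<dots> = ennreal (exp (- (l * m1))) * (\<integral>\<^sup>+x. ennreal (exp (l * W x)) \<partial>M)"
    by (intro nn_integral_cmult) measurable
  also have "\<dots> \<le> ennreal (exp (- (l * m1))) * ennreal (exp (l * m1 + 2 * l\<^sup>2 * v))"
    by (intro mult_left_mono 2) simp
  also have "\<dots> = ennreal (exp (2 * l\<^sup>2 * v))"
    by (simp add: ennreal_mult[symmetric] exp_add[symmetric])
  finally show ?thesis by (simp add: m1_def)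
qed

text \<open>The difference of the two sides vanishes at 0 and has derivative
  \<open>exp (- z) - (1 - z)\<close>, which is nonnegative by convexity.\<close>

lemma exp_minus_le_quadratic:
  fixes z :: real
  assumes "z \<ge> 0"
  shows "exp (- z) \<le> 1 - z + z\<^sup>2 / 2"
proof -
  define g where "g z = 1 - z + z\<^sup>2 / 2 - exp (- z)" for z :: real
  have "g 0 \<le> g z"
  proof (rule DERIV_nonneg_imp_nondecreasing[OF assms])
    fix x :: real
    have "(g has_real_derivative (- 1 + x + exp (- x))) (at x)"
      unfolding g_def by (auto intro!: derivative_eq_intros)
    moreover have "0 \<le> - 1 + x + exp (- x)" using exp_ge_add_one_self[of "- x"] by simp
    ultimately show "\<exists>y. (g has_real_derivative y) (at x) \<and> 0 \<le> y" by blast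
  qed
  then show ?thesis by (simp add: g_def)
qed

text \<open>For a nonnegative variable the lower deviation is governed by the second moment, for
  every \<open>l \<ge> 0\<close>, because the quadratic bound on \<open>exp (- z)\<close> holds on
  the whole half-line. The bound \<open>2 * v\<close> is the moment condition of
  \<open>bernstein_mgf_upper\<close> at \<open>m = 2\<close>, and the conclusion is relaxed to the
  same right-hand side.\<close>

lemma bernstein_mgf_lower:
  fixes W :: "'a \<Rightarrow> real"
  assumes [measurable]: "W \<in> borel_measurable M" and W: "\<And>x. 0 \<le> W x"
    and mom: "(\<integral>\<^sup>+x. ennreal (W x ^ 2) \<partial>M) \<le> ennreal (2 * v)" and v: "v \<ge> 0" and l: "0 \<le> l"
  shows "(\<integral>\<^sup>+x. ennreal (exp (- l * (W x - expectation W))) \<partial>M) \<le> ennreal (exp (2 * l\<^sup>2 * v))"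
proof -
  have int: "integrable M W"
    using mom by (intro integrable_of_second_moment W) (auto intro: le_less_trans)
  have int2: "integrable M (\<lambda>x. (W x)\<^sup>2)"
    using mom by (intro integrableI_bounded) (auto intro: le_less_trans)
  define m1 where "m1 = expectation W"
  have "ennreal (expectation (\<lambda>x. (W x)\<^sup>2)) \<le> ennreal (2 * v)"
    using mom int2 by (subst (asm) nn_integral_eq_integral) auto
  then have m2: "expectation (\<lambda>x. (W x)\<^sup>2) \<le> 2 * v" using v by simp
  have "(\<integral>\<^sup>+x. ennreal (exp (- l * (W x - m1))) \<partial>M)
      \<le> (\<integral>\<^sup>+x. ennreal (exp (l * m1) * (1 - l * W x + l\<^sup>2 / 2 * (W x)\<^sup>2)) \<partial>M)"
  proof (intro nn_integral_mono ennreal_leI)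
    fix x
    have "exp (- l * (W x - m1)) = exp (l * m1) * exp (- (l * W x))"
      by (simp add: exp_add[symmetric] algebra_simps)
    also have "\<dots> \<le> exp (l * m1) * (1 - l * W x + l\<^sup>2 / 2 * (W x)\<^sup>2)"
      using exp_minus_le_quadratic[of "l * W x"] W[of x] l
      by (intro mult_left_mono) (auto simp: power_mult_distrib)
    finally show "exp (- l * (W x - m1)) \<le> exp (l * m1) * (1 - l * W x + l\<^sup>2 / 2 * (W x)\<^sup>2)" .
  qed
  also have "\<dots> = ennreal (expectation (\<lambda>x. exp (l * m1) * (1 - l * W x + l\<^sup>2 / 2 * (W x)\<^sup>2)))"
  proof (intro nn_integral_eq_integral AE_I2 mult_nonneg_nonneg)
    show "0 \<le> 1 - l * W x + l\<^sup>2 / 2 * (W x)\<^sup>2" for x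
      using exp_minus_le_quadratic[of "l * W x"] W[of x] l exp_ge_zero[of "- (l * W x)"]
      by (intro order_trans[OF exp_ge_zero[of "- (l * W x)"]]) (simp add: power_mult_distrib)
  qed (use int int2 in auto)
  also have "\<dots> = ennreal (exp (l * m1) * (1 - l * m1 + l\<^sup>2 / 2 * expectation (\<lambda>x. (W x)\<^sup>2)))"
    using int int2 by (simp add: m1_def prob_space)
  also have "\<dots> \<le> ennreal (exp (l * m1) * exp (- (l * m1) + 2 * l\<^sup>2 * v))"
  proof (intro ennreal_leI mult_left_mono)
    have "l\<^sup>2 / 2 * expectation (\<lambda>x. (W x)\<^sup>2) \<le> l\<^sup>2 / 2 * (2 * v)" by (intro mult_left_mono m2) auto
    also have "\<dots> \<le> 2 * l\<^sup>2 * v" using v by simp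
    finally show "1 - l * m1 + l\<^sup>2 / 2 * expectation (\<lambda>x. (W x)\<^sup>2) \<le> exp (- (l * m1) + 2 * l\<^sup>2 * v)"
      using exp_ge_add_one_self[of "- (l * m1) + 2 * l\<^sup>2 * v"] by linarith
  qed simp
  also have "\<dots> = ennreal (exp (2 * l\<^sup>2 * v))" by (simp add: exp_add[symmetric])
  finally show ?thesis by (simp add: m1_def)
qed

lemma indep_sum_chernoff:
  fixes U :: "nat \<Rightarrow> 'a \<Rightarrow> real"
  assumes ind: "indep_vars (\<lambda>_. borel) U {..<n}"
    and mgf: "\<And>i. i < n \<Longrightarrow> (\<integral>\<^sup>+x. ennreal (exp (U i x)) \<partial>M) \<le> ennreal (exp k)"
  shows "emeasure M {x \<in> space M. s \<le> (\<Sum>i<n. U i x)} \<le> ennreal (exp (n * k - s))"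
proof -
  have [measurable]: "U i \<in> borel_measurable M" if "i < n" for i
    using ind that by (auto simp: indep_vars_def)
  have ind': "indep_vars (\<lambda>_. borel) (\<lambda>i x. ennreal (exp (U i x))) {..<n}"
    using indep_vars_compose[OF ind, of "\<lambda>_ z. ennreal (exp z)" "\<lambda>_. borel"] by (simp add: o_def)
  have "emeasure M {x \<in> space M. s \<le> (\<Sum>i<n. U i x)}
      = emeasure M {x \<in> space M. 1 \<le> ennreal (exp (- s)) * (\<Prod>i<n. ennreal (exp (U i x)))}"
    by (intro arg_cong[where f="emeasure M"] Collect_cong conj_cong refl)
      (simp add: prod_ennreal exp_sum[symmetric] ennreal_mult[symmetric] exp_add[symmetric] ennreal_1[symmetric] del: ennreal_1)
  also have "\<dots> \<le> ennreal (exp (- s)) * (\<integral>\<^sup>+x. (\<Prod>i<n. ennreal (exp (U i x))) * indicator (space M) x \<partial>M)"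
    by (intro nn_integral_Markov_inequality) measurable
  also have "(\<integral>\<^sup>+x. (\<Prod>i<n. ennreal (exp (U i x))) * indicator (space M) x \<partial>M) = (\<integral>\<^sup>+x. (\<Prod>i<n. ennreal (exp (U i x))) \<partial>M)"
    by (intro nn_integral_cong) simp
  also have "\<dots> = (\<Prod>i<n. \<integral>\<^sup>+x. ennreal (exp (U i x)) \<partial>M)"
    by (intro indep_vars_nn_integral ind') auto
  also have "\<dots> \<le> (\<Prod>i<n. ennreal (exp k))" using mgf by (intro prod_mono_ennreal) auto
  also have "\<dots> = ennreal (exp (n * k))" by (simp add: ennreal_power exp_of_nat_mult)
  finally show ?thesis
    by (simp add: mult_left_mono ennreal_mult[symmetric] exp_add[symmetric])
qed

text \<open>The parameter \<open>l\<close> stays free: its best value depends on how large the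
  variance is compared with the wanted exponent, and is chosen in
  \<open>bernstein_sqrt_rate\<close>.\<close>

lemma bernstein_two_sided:
  fixes W :: "nat \<Rightarrow> 'a \<Rightarrow> real"
  assumes ind: "indep_vars (\<lambda>_. borel) W {..<n}" and W: "\<And>i x. 0 \<le> W i x"
    and mean: "\<And>i. i < n \<Longrightarrow> expectation (W i) = m1"
    and mom: "\<And>i m. i < n \<Longrightarrow> m \<ge> 2 \<Longrightarrow>
      (\<integral>\<^sup>+x. ennreal (W i x ^ m) \<partial>M) \<le> ennreal (fact m * b ^ (m - 2) * v)"
    and b: "b \<ge> 0" "v \<ge> 0" and l: "0 < l" "l * b \<le> 1/2"
  shows "emeasure M {x \<in> space M. s \<le> \<bar>(\<Sum>i<n. W i x) - n * m1\<bar>} \<le> ennreal (2 * exp (n * (2 * l\<^sup>2 * v) - l * s))"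
proof -
  have [measurable]: "W i \<in> borel_measurable M" if "i < n" for i
    using ind that by (auto simp: indep_vars_def)
  have up: "emeasure M {x \<in> space M. l * s \<le> (\<Sum>i<n. l * (W i x - m1))} \<le> ennreal (exp (n * (2 * l\<^sup>2 * v) - l * s))"
  proof (rule indep_sum_chernoff)
    show "indep_vars (\<lambda>_. borel) (\<lambda>i x. l * (W i x - m1)) {..<n}"
      using indep_vars_compose[OF ind, of "\<lambda>_ z. l * (z - m1)" "\<lambda>_. borel"] by (simp add: o_def)
    show "(\<integral>\<^sup>+x. ennreal (exp (l * (W i x - m1))) \<partial>M) \<le> ennreal (exp (2 * l\<^sup>2 * v))" if "i < n" for i
      using bernstein_mgf_upper[of "W i" b v l] W mom[OF that] b l that mean[OF that] by simp
  qed
  have lo: "emeasure M {x \<in> space M. l * s \<le> (\<Sum>i<n. - l * (W i x - m1))} \<le> ennreal (exp (n * (2 * l\<^sup>2 * v) - l * s))"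
  proof (rule indep_sum_chernoff)
    show "indep_vars (\<lambda>_. borel) (\<lambda>i x. - l * (W i x - m1)) {..<n}"
      using indep_vars_compose[OF ind, of "\<lambda>_ z. - l * (z - m1)" "\<lambda>_. borel"] by (simp add: o_def)
    show "(\<integral>\<^sup>+x. ennreal (exp (- l * (W i x - m1))) \<partial>M) \<le> ennreal (exp (2 * l\<^sup>2 * v))" if "i < n" for i
      using bernstein_mgf_lower[of "W i" v l] W mom[OF that, of 2] b l that mean[OF that]
      by (simp add: fact_numeral)
  qed
  have eq: "(\<Sum>i<n. c * (W i x - m1)) = c * ((\<Sum>i<n. W i x) - n * m1)" for c x
    by (simp add: sum_distrib_left[symmetric] sum_subtractf)
  have "{x \<in> space M. s \<le> \<bar>(\<Sum>i<n. W i x) - n * m1\<bar>}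
      \<subseteq> {x \<in> space M. l * s \<le> (\<Sum>i<n. l * (W i x - m1))} \<union> {x \<in> space M. l * s \<le> (\<Sum>i<n. - l * (W i x - m1))}"
  proof (rule subsetI, elim CollectE conjE)
    fix x assume x: "x \<in> space M" and s: "s \<le> \<bar>(\<Sum>i<n. W i x) - n * m1\<bar>"
    let ?d = "(\<Sum>i<n. W i x) - n * m1"
    have "s \<le> ?d \<or> s \<le> - ?d" using s by linarith
    then have "l * s \<le> l * ?d \<or> l * s \<le> l * (- ?d)" using l by simp
    then show "x \<in> {x \<in> space M. l * s \<le> (\<Sum>i<n. l * (W i x - m1))} \<union> {x \<in> space M. l * s \<le> (\<Sum>i<n. - l * (W i x - m1))}"
      using x unfolding eq by (simp add: right_diff_distrib)
  qed
  then have "emeasure M {x \<in> space M. s \<le> \<bar>(\<Sum>i<n. W i x) - n * m1\<bar>}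
      \<le> emeasure M ({x \<in> space M. l * s \<le> (\<Sum>i<n. l * (W i x - m1))} \<union> {x \<in> space M. l * s \<le> (\<Sum>i<n. - l * (W i x - m1))})"
    by (intro emeasure_mono) measurable
  also have "\<dots> \<le> ennreal (exp (n * (2 * l\<^sup>2 * v) - l * s)) + ennreal (exp (n * (2 * l\<^sup>2 * v) - l * s))"
    by (intro order_trans[OF emeasure_subadditive] add_mono up lo) measurable
  also have "\<dots> = ennreal (2 * exp (n * (2 * l\<^sup>2 * v) - l * s))" by (simp add: ennreal_plus[symmetric] del: ennreal_plus)
  finally show ?thesis .
qed

end

section \<open>Bracketing slabs\<close>

definition slab :: "'a::euclidean_space \<Rightarrow> real \<Rightarrow> real \<Rightarrow> 'a set" where
  "slab \<beta> a b = {x. a \<le> \<beta> \<bullet> x \<and> \<beta> \<bullet> x \<le> b}"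

lemma closed_slab: "closed (slab \<beta> a b)"
  unfolding slab_def
  by (intro closed_Collect_conj closed_Collect_le continuous_intros)

lemma sets_slab [measurable]: "slab \<beta> a b \<in> sets borel"
  by (intro borel_closed closed_slab)

lemma fmeasurable_cball: "cball (x :: 'a::euclidean_space) r \<in> fmeasurable lborel"
  by (intro fmeasurableI emeasure_bounded_finite) auto

text \<open>Disjoint translates of the slab along its normal all fit into the ball of twice the radius.\<close>

lemma slab_volume:
  fixes \<beta> :: "'a::euclidean_space"
  assumes \<beta>: "norm \<beta> = 1" and R: "R > 0" and w: "w > 0"
  shows "measure lborel (cball 0 R \<inter> slab \<beta> s (s + w)) \<le> 2 * w / R * measure lborel (cball (0::'a) (2 * R))"
proof -
  define S where "S = cball 0 R \<inter> slab \<beta> s (s + w)"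
  have S: "S \<in> sets borel"
    by (auto simp: S_def intro!: sets.Int sets_slab)
  \<comment> \<open>The slabs are closed, so consecutive translates are spaced by twice the width to
    be disjoint.\<close>
  define c where "c k = (2 * w * real k) *\<^sub>R \<beta>" for k :: nat
  define A where "A k = {x. x - c k \<in> S}" for k
  have A: "A k \<in> sets lborel" for k
    using S unfolding A_def by measurable
  have meas: "measure lborel (A k) = measure lborel S" for k
  proof -
    have "measure lborel (A k) = measure (distr lborel borel ((+) (c k))) (A k)"
      by (simp add: lborel_distr_plus)
    also have "\<dots> = measure lborel ((+) (c k) -` A k \<inter> space lborel)"
      using A[of k] by (intro measure_distr) auto
    also have "(+) (c k) -` A k \<inter> space lborel = S" by (auto simp: A_def)
    finally show ?thesis .
  qed
  have fin: "emeasure lborel (A k) < \<infinity>" for k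
  proof -
    have "bounded S" by (auto simp: S_def)
    then have "bounded ((+) (c k) ` S)" by (rule bounded_translation)
    also have "(+) (c k) ` S = A k" by (auto simp: A_def image_iff) (metis add.commute diff_add_cancel)
    finally show ?thesis by (rule emeasure_bounded_finite)
  qed
  have bb: "\<beta> \<bullet> \<beta> = 1" using \<beta> by (simp add: dot_square_norm)
  have A_iff: "x \<in> A k \<longleftrightarrow> norm (x - c k) \<le> R \<and> s + 2 * w * k \<le> \<beta> \<bullet> x \<and> \<beta> \<bullet> x \<le> s + 2 * w * k + w" for x k
    by (auto simp: A_def S_def slab_def c_def inner_diff_right bb)
  have disj: "disjoint_family A"
    unfolding disjoint_family_on_def
  proof (intro ballI impI)
    have lt: "A k \<inter> A m = {}" if "k < m" for k m
    proof -
      have "real k + 1 \<le> real m" using that by simp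
      then have "2 * w * (real k + 1) \<le> 2 * w * real m" using w by (intro mult_left_mono) auto
      then show ?thesis using w by (auto simp: A_iff algebra_simps)
    qed
    show "A k \<inter> A m = {}" if "k \<noteq> m" for k m
      using lt[of k m] lt[of m k] that by (cases "k < m") auto
  qed
  \<comment> \<open>The number of steps for which the centre \<open>c k\<close> stays within
    distance \<open>R\<close> of the origin; counting \<open>k = 0\<close>, there are at least
    \<open>R / (2 * w)\<close> translates.\<close>
  define N where "N = nat \<lfloor>R / (2 * w)\<rfloor>"
  have N: "real N \<le> R / (2 * w)" "R / (2 * w) \<le> real N + 1"
    using R w by (auto simp: N_def)
  have sub: "(\<Union>k\<le>N. A k) \<subseteq> cball 0 (2 * R)"
  proof
    fix x assume "x \<in> (\<Union>k\<le>N. A k)"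
    then obtain k where k: "k \<le> N" "x \<in> A k" by auto
    have "real k \<le> R / (2 * w)" using k N by (meson of_nat_le_iff order_trans)
    then have "norm (c k) \<le> R" using w \<beta> by (simp add: c_def field_simps)
    then show "x \<in> cball 0 (2 * R)"
      using k norm_triangle_sub[of x "c k"] by (auto simp: A_iff)
  qed
  have "(real N + 1) * measure lborel S = (\<Sum>k\<le>N. measure lborel (A k))" by (simp add: meas)
  also have "\<dots> = measure lborel (\<Union>k\<le>N. A k)"
    using A fin disj by (intro measure_finite_Union[symmetric]) (auto simp: disjoint_family_on_def less_top)
  also have "\<dots> \<le> measure lborel (cball (0::'a) (2 * R))"
    using sub A by (intro measure_mono_fmeasurable fmeasurable_cball) auto
  finally have "(real N + 1) * measure lborel S \<le> measure lborel (cball (0::'a) (2 * R))" .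
  moreover have "R / (2 * w) * measure lborel S \<le> (real N + 1) * measure lborel S"
    using N by (intro mult_right_mono) auto
  ultimately have "R / (2 * w) * measure lborel S \<le> measure lborel (cball (0::'a) (2 * R))" by linarith
  then show ?thesis using R w by (simp add: S_def field_simps)
qed

text \<open>Rounding every coordinate down to a multiple of \<open>h / DIM('a)\<close> moves a point
  by at most \<open>h\<close> in the l1 norm, hence in the Euclidean norm. Each coordinate takes
  \<open>2 * N + 1\<close> values with \<open>N\<close> at most one more than
  \<open>r * DIM('a) / h\<close>, whence the \<open>+ 3\<close>.\<close>

lemma finite_grid_net:
  fixes r h :: real
  assumes "h > 0" "r \<ge> 0"
  shows "\<exists>T :: 'a::euclidean_space set. finite T
    \<and> real (card T) \<le> (2 * (r * DIM('a) / h) + 3) ^ DIM('a) \<and> (\<forall>x\<in>cball 0 r. \<exists>t\<in>T. dist x t \<le> h)"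
proof -
  define e where "e = h / DIM('a)"
  have e: "e > 0" using assms by (simp add: e_def)
  define N where "N = \<lceil>r / e\<rceil>"
  have "r / e \<ge> 0" using e assms by simp
  then have N: "N \<ge> 0" "r / e \<le> N" "N \<le> r / e + 1" unfolding N_def by linarith+
  define F where "F k = (\<Sum>b\<in>Basis. (e * of_int (k b)) *\<^sub>R b)" for k :: "'a \<Rightarrow> int"
  define P where "P = PiE (Basis :: 'a set) (\<lambda>_. {-N..N})"
  have P: "finite P" by (auto simp: P_def intro!: finite_PiE)
  have "card (F ` P) \<le> card P" by (rule card_image_le[OF P])
  also have "card P = nat (2 * N + 1) ^ DIM('a)" by (simp add: P_def card_PiE)
  finally have "real (card (F ` P)) \<le> real (nat (2 * N + 1) ^ DIM('a))" by linarith
  also have "\<dots> = (2 * real_of_int N + 1) ^ DIM('a)" using N by simp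
  also have "\<dots> \<le> (2 * (r / e) + 3) ^ DIM('a)" using N by (intro power_mono) auto
  finally have card: "real (card (F ` P)) \<le> (2 * (r * DIM('a) / h) + 3) ^ DIM('a)"
    by (simp add: e_def)
  have "\<exists>t\<in>F ` P. dist x t \<le> h" if x: "x \<in> cball 0 r" for x
  proof -
    define k where "k = restrict (\<lambda>b. \<lfloor>x \<bullet> b / e\<rfloor>) Basis"
    have "- N \<le> \<lfloor>x \<bullet> b / e\<rfloor> \<and> \<lfloor>x \<bullet> b / e\<rfloor> \<le> N" if "b \<in> Basis" for b
    proof -
      have "\<bar>x \<bullet> b\<bar> \<le> r" using x Basis_le_norm[OF that, of x] by simp
      then have "\<bar>x \<bullet> b / e\<bar> \<le> r / e" using e by (simp add: divide_right_mono)
      then have "\<bar>x \<bullet> b / e\<bar> \<le> N" using N by linarith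
      then show ?thesis by linarith
    qed
    then have "k \<in> P" by (auto simp: P_def k_def)
    have "norm (x - F k) \<le> (\<Sum>b\<in>Basis. \<bar>(x - F k) \<bullet> b\<bar>)" by (rule norm_le_l1)
    also have "\<dots> \<le> (\<Sum>b\<in>(Basis::'a set). e)"
    proof (rule sum_mono)
      fix b :: 'a assume b: "b \<in> Basis"
      have "F k \<bullet> b = e * \<lfloor>x \<bullet> b / e\<rfloor>"
        using b by (simp add: F_def inner_sum_left_Basis k_def)
      moreover have "e * (x \<bullet> b / e - 1) \<le> e * \<lfloor>x \<bullet> b / e\<rfloor>" "e * \<lfloor>x \<bullet> b / e\<rfloor> \<le> e * (x \<bullet> b / e)"
        by (rule mult_left_mono; use e in linarith)+
      ultimately show "\<bar>(x - F k) \<bullet> b\<bar> \<le> e" using e by (simp add: inner_diff_left algebra_simps)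
    qed
    also have "\<dots> = h" by (simp add: e_def)
    finally show ?thesis using \<open>k \<in> P\<close> by (auto simp: dist_norm)
  qed
  then show ?thesis using card P by blast
qed

text \<open>In \<open>w = h * (R + 2)\<close> the part \<open>h * R\<close> pays for the change of
  direction inside the ball, one \<open>h\<close> for the change of end point, and the other
  \<open>h\<close> makes the inner inclusion strict, since \<open>J\<close> may lack its end points.
  The gap between the brackets lies in two slabs of direction \<open>\<beta>\<close> and width
  \<open>4 * w\<close> around \<open>a\<close> and \<open>b\<close>; this is the origin of the
  16.\<close>

lemma slab_sandwich:
  fixes \<beta> \<beta>' :: "'a::euclidean_space"
  assumes \<beta>: "norm \<beta> = 1" and R: "R > 0" and h: "h > 0"
    and J: "is_interval J" "J \<inter> {-R..R} \<noteq> {}"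
    and ab: "a = Inf (J \<inter> {-R..R})" "b = Sup (J \<inter> {-R..R})"
    and near: "dist \<beta> \<beta>' \<le> h" "\<bar>a - a'\<bar> \<le> h" "\<bar>b - b'\<bar> \<le> h" and w: "w = h * (R + 2)"
  shows "cball 0 R \<inter> slab \<beta>' (a' + w) (b' - w) \<subseteq> {x. \<beta> \<bullet> x \<in> J}"
    and "cball 0 R \<inter> {x. \<beta> \<bullet> x \<in> J} \<subseteq> slab \<beta>' (a' - w) (b' + w)"
    and "measure lborel (cball 0 R \<inter> (slab \<beta>' (a' - w) (b' + w) - slab \<beta>' (a' + w) (b' - w)))
      \<le> 16 * (R + 2) / R * measure lborel (cball (0::'a) (2 * R)) * h"
proof -
  have bnd: "\<bar>\<beta> \<bullet> x\<bar> \<le> R" if "x \<in> cball 0 R" for x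
    using Cauchy_Schwarz_ineq2[of \<beta> x] \<beta> that by simp
  have close: "\<bar>\<beta>' \<bullet> x - \<beta> \<bullet> x\<bar> \<le> h * R" if "x \<in> cball 0 R" for x
  proof -
    have "\<bar>(\<beta>' - \<beta>) \<bullet> x\<bar> \<le> norm (\<beta>' - \<beta>) * norm x" by (rule Cauchy_Schwarz_ineq2)
    also have "\<dots> \<le> h * R" using near that by (intro mult_mono) (auto simp: dist_norm norm_minus_commute h less_imp_le)
    finally show ?thesis by (simp add: inner_diff_left)
  qed
  have bdd: "bdd_below (J \<inter> {-R..R})" "bdd_above (J \<inter> {-R..R})"
    by (auto intro: bdd_belowI[of _ "-R"] bdd_aboveI[of _ R])
  have mem: "a \<le> u" "u \<le> b" if "u \<in> J" "\<bar>u\<bar> \<le> R" for u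
    using that bdd unfolding ab by (auto intro!: cInf_lower cSup_upper)
  have inside: "u \<in> J" if u: "a < u" "u < b" for u
  proof -
    obtain p where p: "p \<in> J" "p < u" using cInf_lessD[OF J(2), of u] u unfolding ab by auto
    obtain q where q: "q \<in> J" "u < q" using less_cSupD[OF J(2), of u] u unfolding ab by auto
    show ?thesis using J(1) p q unfolding is_interval_1 by (meson less_imp_le)
  qed
  have w': "w = h * R + h + h" by (simp add: w algebra_simps)
  show "cball 0 R \<inter> slab \<beta>' (a' + w) (b' - w) \<subseteq> {x. \<beta> \<bullet> x \<in> J}"
  proof clarify
    fix x assume x: "x \<in> cball 0 R" "x \<in> slab \<beta>' (a' + w) (b' - w)"
    show "\<beta> \<bullet> x \<in> J"
      using close[OF x(1)] x(2) near h by (intro inside) (auto simp: slab_def w')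
  qed
  show "cball 0 R \<inter> {x. \<beta> \<bullet> x \<in> J} \<subseteq> slab \<beta>' (a' - w) (b' + w)"
  proof clarify
    fix x assume x: "x \<in> cball 0 R" "\<beta> \<bullet> x \<in> J"
    show "x \<in> slab \<beta>' (a' - w) (b' + w)"
      using close[OF x(1)] mem[OF x(2) bnd[OF x(1)]] near h by (auto simp: slab_def w')
  qed
  let ?V = "measure lborel (cball (0::'a) (2 * R))"
  have w0: "w > 0" using h R by (simp add: w)
  have "cball 0 R \<inter> (slab \<beta>' (a' - w) (b' + w) - slab \<beta>' (a' + w) (b' - w))
     \<subseteq> (cball 0 R \<inter> slab \<beta> (a - 2 * w) (a - 2 * w + 4 * w)) \<union> (cball 0 R \<inter> slab \<beta> (b - 2 * w) (b - 2 * w + 4 * w))"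
  proof
    fix x assume x: "x \<in> cball 0 R \<inter> (slab \<beta>' (a' - w) (b' + w) - slab \<beta>' (a' + w) (b' - w))"
    then show "x \<in> (cball 0 R \<inter> slab \<beta> (a - 2 * w) (a - 2 * w + 4 * w)) \<union> (cball 0 R \<inter> slab \<beta> (b - 2 * w) (b - 2 * w + 4 * w))"
      using close[of x] near h w' unfolding slab_def Int_iff Un_iff Diff_iff mem_Collect_eq by (smt (verit))
  qed
  then have "measure lborel (cball 0 R \<inter> (slab \<beta>' (a' - w) (b' + w) - slab \<beta>' (a' + w) (b' - w)))
    \<le> measure lborel ((cball 0 R \<inter> slab \<beta> (a - 2 * w) (a - 2 * w + 4 * w)) \<union> (cball 0 R \<inter> slab \<beta> (b - 2 * w) (b - 2 * w + 4 * w)))"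
    by (intro measure_mono_fmeasurable fmeasurable_Int_fmeasurable fmeasurable.Un fmeasurable_cball)
       (auto intro!: sets.Int sets.Diff sets_slab)
  also have "\<dots> \<le> measure lborel (cball 0 R \<inter> slab \<beta> (a - 2 * w) (a - 2 * w + 4 * w))
      + measure lborel (cball 0 R \<inter> slab \<beta> (b - 2 * w) (b - 2 * w + 4 * w))"
    by (intro measure_Un_le) (auto intro!: sets.Int sets_slab)
  also have "\<dots> \<le> 2 * (4 * w) / R * ?V + 2 * (4 * w) / R * ?V"
    using w0 by (intro add_mono slab_volume \<beta> R) auto
  also have "\<dots> = 16 * (R + 2) / R * ?V * h" by (simp add: w algebra_simps)
  finally show "measure lborel (cball 0 R \<inter> (slab \<beta>' (a' - w) (b' + w) - slab \<beta>' (a' + w) (b' - w)))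
      \<le> 16 * (R + 2) / R * ?V * h" .
qed

text \<open>Only the part of \<open>J\<close> within \<open>{-R..R}\<close> matters on the ball, so
  a direction together with the two end points has norm at most \<open>1 + 2 * R\<close>. A net of
  mesh \<open>1 / n\<close> in the product space covers these triples, and the exponent of
  \<open>n\<close> is the dimension of that space.\<close>

lemma slab_bracketing:
  fixes R :: real
  assumes R: "R > 0"
  shows "\<exists>A. \<forall>n\<ge>1. \<exists>\<T> :: 'a::euclidean_space set set. finite \<T> \<and> real (card \<T>) \<le> A * real n ^ (DIM('a) + 2) \<and> \<T> \<subseteq> sets borel \<and>
    (\<forall>\<beta> J. norm \<beta> = 1 \<longrightarrow> is_interval J \<longrightarrow> (\<exists>I\<in>\<T>. \<exists>U\<in>\<T>. cball 0 R \<inter> I \<subseteq> {x. \<beta> \<bullet> x \<in> J}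
      \<and> cball 0 R \<inter> {x. \<beta> \<bullet> x \<in> J} \<subseteq> U
      \<and> measure lborel (cball 0 R \<inter> (U - I)) \<le> 16 * (R + 2) / R * measure lborel (cball (0::'a) (2 * R)) / n))"
proof (rule exI, intro allI impI)
  fix n :: nat assume n: "n \<ge> 1"
  define p where "p = DIM('a) + 2"
  define r where "r = 1 + 2 * R"
  define h where "h = 1 / real n"
  have h: "h > 0" using n by (simp add: h_def)
  have "DIM('a \<times> real \<times> real) = p" by (simp add: p_def)
  then obtain T :: "('a \<times> real \<times> real) set" where T: "finite T" "real (card T) \<le> (2 * (r * p / h) + 3) ^ p"
      and net: "\<And>x. norm x \<le> r \<Longrightarrow> \<exists>t\<in>T. dist x t \<le> h"
    using finite_grid_net[of h r, where 'a="'a \<times> real \<times> real"] h R by (auto simp: r_def)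
  define w where "w = h * (R + 2)"
  \<comment> \<open>The empty set serves as both brackets for intervals that miss
    \<open>{-R..R}\<close>.\<close>
  define \<T> where "\<T> = insert {} ((\<lambda>(\<beta>, a, b). slab \<beta> (a + w) (b - w)) ` T \<union> (\<lambda>(\<beta>, a, b). slab \<beta> (a - w) (b + w)) ` T)"
  have "card \<T> \<le> 1 + card ((\<lambda>(\<beta>, a, b). slab \<beta> (a + w) (b - w)) ` T \<union> (\<lambda>(\<beta>, a, b). slab \<beta> (a - w) (b + w)) ` T)"
    unfolding \<T>_def using T(1) by (simp add: card_insert_if)
  also have "\<dots> \<le> 1 + (card T + card T)"
    using card_Un_le card_image_le[OF T(1)] by (meson add_left_mono add_mono order_trans)
  finally have "card \<T> \<le> 1 + (card T + card T)" .
  then have "real (card \<T>) \<le> 1 + 2 * real (card T)" by linarith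
  also have "\<dots> \<le> 1 + 2 * ((2 * r * p + 3) * n) ^ p"
  proof -
    have "2 * (r * p / h) + 3 \<le> (2 * r * p + 3) * n" using n by (simp add: h_def algebra_simps)
    then have "(2 * (r * p / h) + 3) ^ p \<le> ((2 * r * p + 3) * n) ^ p"
      using R h by (intro power_mono) (auto simp: r_def)
    then show ?thesis using T(2) by linarith
  qed
  also have "\<dots> \<le> 1 * real n ^ p + 2 * (2 * r * p + 3) ^ p * real n ^ p"
    using n by (simp add: power_mult_distrib)
  finally have card: "real (card \<T>) \<le> (1 + 2 * (2 * r * p + 3) ^ p) * real n ^ p"
    by (simp add: algebra_simps)
  have br: "\<exists>I\<in>\<T>. \<exists>U\<in>\<T>. cball 0 R \<inter> I \<subseteq> {x. \<beta> \<bullet> x \<in> J}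
      \<and> cball 0 R \<inter> {x. \<beta> \<bullet> x \<in> J} \<subseteq> U
      \<and> measure lborel (cball 0 R \<inter> (U - I)) \<le> 16 * (R + 2) / R * measure lborel (cball (0::'a) (2 * R)) / n"
    if \<beta>: "norm \<beta> = 1" and J: "is_interval J" for \<beta> J
  proof (cases "J \<inter> {-R..R} = {}")
    case True
    have "cball 0 R \<inter> {x. \<beta> \<bullet> x \<in> J} = {}"
    proof safe
      fix x assume x: "x \<in> cball 0 R" "\<beta> \<bullet> x \<in> J"
      then have "\<bar>\<beta> \<bullet> x\<bar> \<le> R" using Cauchy_Schwarz_ineq2[of \<beta> x] \<beta> by simp
      then have "\<beta> \<bullet> x \<in> J \<inter> {-R..R}" using x by (auto simp: abs_le_iff)
      then show "x \<in> {}" using True by blast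
    qed
    then show ?thesis using R by (intro bexI[of _ "{}"]) (auto simp: \<T>_def)
  next
    case False
    define a where "a = Inf (J \<inter> {-R..R})"
    define b where "b = Sup (J \<inter> {-R..R})"
    have "\<bar>a\<bar> \<le> R" "\<bar>b\<bar> \<le> R"
      unfolding a_def b_def using False by (auto intro!: cInf_abs_ge cSup_abs_le)
    then have "norm (\<beta>, a, b) \<le> r"
      using norm_Pair_le[of \<beta> "(a, b)"] norm_Pair_le[of a b] \<beta> by (simp add: r_def)
    then obtain \<beta>' a' b' where t: "(\<beta>', a', b') \<in> T" "dist (\<beta>, a, b) (\<beta>', a', b') \<le> h"
      using net by (metis prod_cases3)
    have near: "dist \<beta> \<beta>' \<le> h" "\<bar>a - a'\<bar> \<le> h" "\<bar>b - b'\<bar> \<le> h"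
      using t(2) dist_fst_le[of "(\<beta>, a, b)" "(\<beta>', a', b')"] dist_snd_le[of "(\<beta>, a, b)" "(\<beta>', a', b')"]
        dist_fst_le[of "(a, b)" "(a', b')"] dist_snd_le[of "(a, b)" "(a', b')"]
      by (auto simp: dist_real_def)
    note sw = slab_sandwich[OF \<beta> R h J False a_def b_def near w_def]
    show ?thesis
    proof (rule bexI[of _ "slab \<beta>' (a' + w) (b' - w)"], rule bexI[of _ "slab \<beta>' (a' - w) (b' + w)"])
      show "slab \<beta>' (a' + w) (b' - w) \<in> \<T>" "slab \<beta>' (a' - w) (b' + w) \<in> \<T>"
        using t(1) by (force simp: \<T>_def)+
    qed (use sw in \<open>simp add: h_def\<close>)
  qed
  have "\<T> \<subseteq> sets borel" by (auto simp: \<T>_def intro!: sets_slab)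
  then show "\<exists>\<T> :: 'a set set. finite \<T> \<and> real (card \<T>) \<le> (1 + 2 * (2 * (1 + 2 * R) * (DIM('a) + 2) + 3) ^ (DIM('a) + 2)) * real n ^ (DIM('a) + 2) \<and> \<T> \<subseteq> sets borel \<and>
    (\<forall>\<beta> J. norm \<beta> = 1 \<longrightarrow> is_interval J \<longrightarrow> (\<exists>I\<in>\<T>. \<exists>U\<in>\<T>. cball 0 R \<inter> I \<subseteq> {x. \<beta> \<bullet> x \<in> J}
      \<and> cball 0 R \<inter> {x. \<beta> \<bullet> x \<in> J} \<subseteq> U
      \<and> measure lborel (cball 0 R \<inter> (U - I)) \<le> 16 * (R + 2) / R * measure lborel (cball (0::'a) (2 * R)) / n))"
    using card br T(1) unfolding p_def r_def
    by (intro exI[of _ \<T>] conjI allI impI) (auto simp: \<T>_def)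
qed

section \<open>Uniform deviations over slabs\<close>

text \<open>The parameter is the smaller of \<open>sqrt (L / q)\<close> and
  \<open>1 / (2 * b)\<close>, the scales of the Gaussian and the exponential regime. In both,
  \<open>l\<^sup>2 * q \<le> L\<close> limits the variance term to \<open>2 * c * L\<close>, and
  \<open>L \<le> 2 * b * l * (sqrt (q * L) + L)\<close> makes the threshold term at least
  \<open>(a + 2 * c) * L\<close>; the exponent \<open>- a * L\<close> remains.\<close>

lemma (in prob_space) bernstein_sqrt_rate:
  fixes W :: "nat \<Rightarrow> 'a \<Rightarrow> real"
  assumes ind: "indep_vars (\<lambda>_. borel) W {..<n}" and W: "\<And>i x. 0 \<le> W i x"
    and mean: "\<And>i. i < n \<Longrightarrow> expectation (W i) = m1"
    and mom: "\<And>i m. i < n \<Longrightarrow> m \<ge> 2 \<Longrightarrow>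
      (\<integral>\<^sup>+x. ennreal (W i x ^ m) \<partial>M) \<le> ennreal (fact m * b ^ (m - 2) * (c * p))"
    and b: "b \<ge> 1" "c \<ge> 0" "p \<ge> 0" and L: "L \<ge> 0" and a: "a \<ge> 0" and s: "s = 2 * b * (a + 2 * c) * (sqrt (n * p * L) + L)"
  shows "emeasure M {x \<in> space M. s \<le> \<bar>(\<Sum>i<n. W i x) - n * m1\<bar>} \<le> ennreal (2 * exp (- a * L))"
proof -
  define q where "q = n * p"
  have q: "q \<ge> 0" using b by (simp add: q_def)
  have choice: "\<exists>l>0. l * b \<le> 1/2 \<and> l\<^sup>2 * q \<le> L \<and> L \<le> 2 * b * l * (sqrt (q * L) + L)" if "L > 0"
  \<comment> \<open>\<open>q > 0\<close> has to be part of the case: division by 0 yields 0, and the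
    first alternative would then propose \<open>l = 0\<close>.\<close>
  proof (cases "sqrt (L / q) \<le> 1 / (2 * b) \<and> q > 0")
    case True
    have "L = sqrt (L / q) * sqrt (q * L)" using True L by (simp add: real_sqrt_mult[symmetric])
    also have "\<dots> \<le> 1 * sqrt (L / q) * (sqrt (q * L) + L)"
      using L True by (simp add: mult_left_mono)
    also have "\<dots> \<le> 2 * b * sqrt (L / q) * (sqrt (q * L) + L)"
      using b L True by (intro mult_right_mono) auto
    finally show ?thesis
      using True b L that by (intro exI[of _ "sqrt (L / q)"]) (auto simp: field_simps)
  next
    case False
    have "(1 / (2 * b))\<^sup>2 * q \<le> L"
    proof (cases "q > 0")
      case True
      then have "1 / (2 * b) < sqrt (L / q)" using False by auto
      then have "(1 / (2 * b))\<^sup>2 \<le> (sqrt (L / q))\<^sup>2" using b by (intro power_mono) auto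
      also have "\<dots> = L / q" using True L by simp
      finally show ?thesis using True by (simp add: field_simps)
    qed (use q L in auto)
    moreover have "L \<le> 2 * b * (1 / (2 * b)) * (sqrt (q * L) + L)" using b q L by simp
    ultimately show ?thesis using b by (intro exI[of _ "1 / (2 * b)"]) auto
  qed
  show ?thesis
  proof (cases "L = 0")
    case True
    have "emeasure M {x \<in> space M. s \<le> \<bar>(\<Sum>i<n. W i x) - n * m1\<bar>} \<le> 1" by (rule emeasure_le_1)
    also have "\<dots> \<le> ennreal (2 * exp (- a * L))" by (simp add: True)
    finally show ?thesis .
  next
    case False
    then obtain l where l: "l > 0" "l * b \<le> 1/2" "l\<^sup>2 * q \<le> L" "L \<le> 2 * b * l * (sqrt (q * L) + L)"
      using L choice by auto
    have "n * (2 * l\<^sup>2 * (c * p)) - l * s = 2 * c * (l\<^sup>2 * q) - (a + 2 * c) * (2 * b * l * (sqrt (q * L) + L))"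
      by (simp add: s q_def algebra_simps)
    also have "\<dots> \<le> 2 * c * L - (a + 2 * c) * L"
      using l a b by (intro diff_mono mult_left_mono) auto
    finally have "n * (2 * l\<^sup>2 * (c * p)) - l * s \<le> - a * L" by (simp add: algebra_simps)
    moreover have "emeasure M {x \<in> space M. s \<le> \<bar>(\<Sum>i<n. W i x) - n * m1\<bar>}
        \<le> ennreal (2 * exp (n * (2 * l\<^sup>2 * (c * p)) - l * s))"
      using b l by (intro bernstein_two_sided[OF ind W mean mom]) auto
    ultimately show ?thesis
      by (elim order_trans) (intro ennreal_leI, simp)
  qed
qed

text \<open>\<open>moments\<close> and \<open>density\<close> are A6 and the upper bound of A5
  integrated over events \<open>X \<in> S\<close>, the form in which Bernstein's inequality and the
  brackets consume them. \<open>b \<ge> 1\<close> makes \<open>fact m * b ^ (m - 2)\<close> at least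
  1.\<close>

locale iid_sample = prob_space M for M :: "'w measure" +
  fixes X :: "'w \<Rightarrow> 'a::euclidean_space" and Y :: "'w \<Rightarrow> real"
    and Xs :: "nat \<Rightarrow> 'w \<Rightarrow> 'a" and Ys :: "nat \<Rightarrow> 'w \<Rightarrow> real" and b c R D :: real
  assumes X [measurable]: "X \<in> borel_measurable M" and Y [measurable]: "Y \<in> borel_measurable M"
    and indep: "indep_vars (\<lambda>_. borel) (\<lambda>i \<omega>. (Xs i \<omega>, Ys i \<omega>)) UNIV"
    and ident: "\<And>i. distr M borel (\<lambda>\<omega>. (Xs i \<omega>, Ys i \<omega>)) = distr M borel (\<lambda>\<omega>. (X \<omega>, Y \<omega>))"
    and b: "b \<ge> 1" and c: "c \<ge> 0"
    and moments: "\<And>m S. m \<ge> 2 \<Longrightarrow> S \<in> sets borel \<Longrightarrow>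
      (\<integral>\<^sup>+\<omega>. ennreal (\<bar>Y \<omega>\<bar> ^ m) * indicator S (X \<omega>) \<partial>M) \<le> ennreal (fact m * b ^ (m - 2) * (c * prob (X -` S \<inter> space M)))"
    and R: "R > 0" and X_ball: "AE \<omega> in M. X \<omega> \<in> cball 0 R"
    and D: "D \<ge> 0"
    and density: "\<And>S. S \<in> sets borel \<Longrightarrow> S \<subseteq> cball 0 R \<Longrightarrow> prob (X -` S \<inter> space M) \<le> D * measure lborel S"
begin

lemma sample_measurable [measurable]:
  "Xs i \<in> borel_measurable M" "Ys i \<in> borel_measurable M"
proof -
  have "(\<lambda>\<omega>. (Xs i \<omega>, Ys i \<omega>)) \<in> borel_measurable M"
    using indep by (auto simp: indep_vars_def)
  then have "(\<lambda>\<omega>. (Xs i \<omega>, Ys i \<omega>)) \<in> M \<rightarrow>\<^sub>M borel \<Otimes>\<^sub>M borel" by (simp add: borel_prod)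
  from measurable_compose[OF this measurable_fst] measurable_compose[OF this measurable_snd]
  show "Xs i \<in> borel_measurable M" "Ys i \<in> borel_measurable M" by auto
qed

lemma pair_measurable: "(\<lambda>\<omega>. (Xs i \<omega>, Ys i \<omega>)) \<in> borel_measurable M" "(\<lambda>\<omega>. (X \<omega>, Y \<omega>)) \<in> borel_measurable M"
  by measurable

lemma nn_integral_sample:
  assumes "h \<in> borel_measurable borel"
  shows "(\<integral>\<^sup>+\<omega>. h (Xs i \<omega>, Ys i \<omega>) \<partial>M) = (\<integral>\<^sup>+\<omega>. h (X \<omega>, Y \<omega>) \<partial>M)"
  using nn_integral_distr[OF pair_measurable(1), of h] nn_integral_distr[OF pair_measurable(2), of h] assms
  by (simp add: ident)

lemma integral_sample:
  fixes h :: "'a \<times> real \<Rightarrow> real"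
  assumes "h \<in> borel_measurable borel"
  shows "(\<integral>\<omega>. h (Xs i \<omega>, Ys i \<omega>) \<partial>M) = (\<integral>\<omega>. h (X \<omega>, Y \<omega>) \<partial>M)"
  using integral_distr[OF pair_measurable(1), of h] integral_distr[OF pair_measurable(2), of h] assms
  by (simp add: ident)

lemma sample_ball: "AE \<omega> in M. Xs i \<omega> \<in> cball 0 R"
proof -
  have "(\<integral>\<^sup>+\<omega>. indicator (- cball 0 R) (Xs i \<omega>) \<partial>M) = (\<integral>\<^sup>+\<omega>. indicator (- cball 0 R) (X \<omega>) \<partial>M)"
  proof (rule nn_integral_sample[of "\<lambda>z. indicator (- cball 0 R) (fst z)" i, simplified])
    show "(\<lambda>z::'a \<times> real. indicator (- cball 0 R) (fst z) :: ennreal) \<in> borel_measurable borel"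
      unfolding borel_prod[symmetric] by measurable
  qed
  also have "\<dots> = 0"
    using X_ball by (subst nn_integral_0_iff_AE) (auto simp: indicator_def)
  finally show ?thesis
    by (subst (asm) nn_integral_0_iff_AE) (auto simp: indicator_def split: if_splits)
qed

text \<open>The weight \<open>f\<close> will be the constant 1, the positive part and the negative
  part. Nonnegativity makes weighted sums monotone in the set, as bracketing requires; the bound by
  \<open>max 1 \<bar>y\<bar>\<close> gives one moment estimate for all three.\<close>

context
  fixes f :: "real \<Rightarrow> real"
  assumes f_meas [measurable]: "f \<in> borel_measurable borel"
    and f_nonneg: "\<And>y. 0 \<le> f y" and f_le: "\<And>y. f y \<le> max 1 \<bar>y\<bar>"
begin

abbreviation wsum :: "nat \<Rightarrow> 'a set \<Rightarrow> 'w \<Rightarrow> real" where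
  "wsum n S \<omega> \<equiv> (\<Sum>i<n. f (Ys i \<omega>) * indicator S (Xs i \<omega>))"

abbreviation wmean :: "'a set \<Rightarrow> real" where
  "wmean S \<equiv> expectation (\<lambda>\<omega>. f (Y \<omega>) * indicator S (X \<omega>))"

abbreviation mass :: "'a set \<Rightarrow> real" where
  "mass S \<equiv> prob (X -` S \<inter> space M)"

lemma mass_integral: "S \<in> sets borel \<Longrightarrow> (\<integral>\<^sup>+\<omega>. indicator S (X \<omega>) \<partial>M) = ennreal (mass S)"
proof -
  assume [measurable]: "S \<in> sets borel"
  have "(\<integral>\<^sup>+\<omega>. indicator S (X \<omega>) \<partial>M) = (\<integral>\<^sup>+\<omega>. indicator (X -` S \<inter> space M) \<omega> \<partial>M)"
    by (intro nn_integral_cong) (auto simp: indicator_def)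
  then show ?thesis by (simp add: emeasure_eq_measure)
qed

lemma weighted_moments:
  assumes m: "m \<ge> 2" and [measurable]: "S \<in> sets borel"
  shows "(\<integral>\<^sup>+\<omega>. ennreal ((f (Y \<omega>) * indicator S (X \<omega>)) ^ m) \<partial>M) \<le> ennreal (fact m * b ^ (m - 2) * ((c + 1) * mass S))"
proof -
  have fm: "f y ^ m \<le> 1 + \<bar>y\<bar> ^ m" for y
  proof -
    have "f y ^ m \<le> (max 1 \<bar>y\<bar>) ^ m" by (intro power_mono f_le f_nonneg)
    also have "\<dots> \<le> 1 + \<bar>y\<bar> ^ m" by (auto simp: max_def)
    finally show ?thesis .
  qed
  have "(\<integral>\<^sup>+\<omega>. ennreal ((f (Y \<omega>) * indicator S (X \<omega>)) ^ m) \<partial>M)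
    \<le> (\<integral>\<^sup>+\<omega>. indicator S (X \<omega>) + ennreal (\<bar>Y \<omega>\<bar> ^ m) * indicator S (X \<omega>) \<partial>M)"
  proof (rule nn_integral_mono)
    fix \<omega>
    show "ennreal ((f (Y \<omega>) * indicator S (X \<omega>)) ^ m) \<le> indicator S (X \<omega>) + ennreal (\<bar>Y \<omega>\<bar> ^ m) * indicator S (X \<omega>)"
    proof (cases "X \<omega> \<in> S")
      case True
      have "ennreal (f (Y \<omega>) ^ m) \<le> ennreal (1 + \<bar>Y \<omega>\<bar> ^ m)" by (rule ennreal_leI[OF fm])
      also have "\<dots> = 1 + ennreal (\<bar>Y \<omega>\<bar> ^ m)" by (subst ennreal_plus) auto
      finally show ?thesis using True by simp
    qed (use m in auto)
  qed
  also have "\<dots> = (\<integral>\<^sup>+\<omega>. indicator S (X \<omega>) \<partial>M) + (\<integral>\<^sup>+\<omega>. ennreal (\<bar>Y \<omega>\<bar> ^ m) * indicator S (X \<omega>) \<partial>M)"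
    by (intro nn_integral_add) measurable
  also have "\<dots> \<le> ennreal (mass S) + ennreal (fact m * b ^ (m - 2) * (c * mass S))"
    using moments[OF m, of S] by (intro add_mono) (auto simp: mass_integral)
  also have "\<dots> = ennreal (mass S + fact m * b ^ (m - 2) * (c * mass S))"
    using b c by (intro ennreal_plus[symmetric]) auto
  also have "\<dots> \<le> ennreal (fact m * b ^ (m - 2) * ((c + 1) * mass S))"
  proof (intro ennreal_leI)
    have "1 * 1 \<le> fact m * b ^ (m - 2)"
      using b by (intro mult_mono fact_ge_1 one_le_power) auto
    then have "1 * mass S \<le> fact m * b ^ (m - 2) * mass S" by (intro mult_right_mono) auto
    then show "mass S + fact m * b ^ (m - 2) * (c * mass S) \<le> fact m * b ^ (m - 2) * ((c + 1) * mass S)"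
      by (simp add: algebra_simps)
  qed
  finally show ?thesis .
qed

lemma weighted_integrable:
  assumes [measurable]: "S \<in> sets borel"
  shows "integrable M (\<lambda>\<omega>. f (Y \<omega>) * indicator S (X \<omega>))"
  using weighted_moments[of 2 S] f_nonneg
  by (intro integrable_of_second_moment) (auto intro: le_less_trans)

text \<open>\<open>f \<le> 1 + f\<^sup>2\<close> reduces the mean to the mass and the second moment,
  so the constant is \<open>1 + 2 * (c + 1)\<close>.\<close>

lemma wmean_le:
  assumes [measurable]: "S \<in> sets borel"
  shows "wmean S \<le> (2 * c + 3) * mass S"
proof -
  have "ennreal (wmean S) = (\<integral>\<^sup>+\<omega>. ennreal (f (Y \<omega>) * indicator S (X \<omega>)) \<partial>M)"
    using f_nonneg by (intro nn_integral_eq_integral[symmetric] weighted_integrable) auto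
  also have "\<dots> \<le> (\<integral>\<^sup>+\<omega>. indicator S (X \<omega>) + ennreal ((f (Y \<omega>) * indicator S (X \<omega>)) ^ 2) \<partial>M)"
  proof (rule nn_integral_mono)
    fix \<omega>
    have "f (Y \<omega>) \<le> 1 + (f (Y \<omega>))\<^sup>2"
      using sum_squares_bound[of 1 "f (Y \<omega>)"] f_nonneg[of "Y \<omega>"] by simp
    then have "ennreal (f (Y \<omega>)) \<le> ennreal (1 + (f (Y \<omega>))\<^sup>2)" by (rule ennreal_leI)
    also have "\<dots> = 1 + ennreal ((f (Y \<omega>))\<^sup>2)" by (subst ennreal_plus) auto
    finally show "ennreal (f (Y \<omega>) * indicator S (X \<omega>)) \<le> indicator S (X \<omega>) + ennreal ((f (Y \<omega>) * indicator S (X \<omega>)) ^ 2)"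
      by (auto simp: indicator_def)
  qed
  also have "\<dots> = (\<integral>\<^sup>+\<omega>. indicator S (X \<omega>) \<partial>M) + (\<integral>\<^sup>+\<omega>. ennreal ((f (Y \<omega>) * indicator S (X \<omega>)) ^ 2) \<partial>M)"
    by (intro nn_integral_add) measurable
  also have "\<dots> \<le> ennreal (mass S) + ennreal (2 * (c + 1) * mass S)"
    using weighted_moments[of 2 S] by (intro add_mono) (auto simp: mass_integral algebra_simps)
  also have "\<dots> = ennreal ((2 * c + 3) * mass S)"
    using c by (subst ennreal_plus[symmetric]) (auto simp: algebra_simps)
  finally show ?thesis using c by (simp add: ennreal_le_iff)
qed

lemma weighted_sum_deviation:
  assumes [measurable]: "S \<in> sets borel" and "L \<ge> 0" "a \<ge> 0"
  shows "emeasure M {\<omega> \<in> space M. 2 * b * (a + 2 * (c + 1)) * (sqrt (n * mass S * L) + L) \<le> \<bar>wsum n S \<omega> - n * wmean S\<bar>}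
    \<le> ennreal (2 * exp (- a * L))"
proof (rule bernstein_sqrt_rate[where b=b and c="c + 1" and p="mass S" and a=a])
  let ?h = "\<lambda>z::'a \<times> real. f (snd z) * indicator S (fst z)"
  have [measurable]: "?h \<in> borel_measurable borel"
    unfolding borel_prod[symmetric] by measurable
  have "indep_vars (\<lambda>_. borel) (\<lambda>i \<omega>. ?h (Xs i \<omega>, Ys i \<omega>)) UNIV"
    by (rule indep_vars_compose2[OF indep]) measurable
  then have "indep_vars (\<lambda>_. borel) (\<lambda>i \<omega>. ?h (Xs i \<omega>, Ys i \<omega>)) {..<n}"
    by (rule indep_vars_subset) simp
  then show "indep_vars (\<lambda>_. borel) (\<lambda>i \<omega>. f (Ys i \<omega>) * indicator S (Xs i \<omega>)) {..<n}"
    by simp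
  show "expectation (\<lambda>\<omega>. f (Ys i \<omega>) * indicator S (Xs i \<omega>)) = wmean S" for i
    using integral_sample[of ?h i] by simp
  show "(\<integral>\<^sup>+\<omega>. ennreal ((f (Ys i \<omega>) * indicator S (Xs i \<omega>)) ^ m) \<partial>M) \<le> ennreal (fact m * b ^ (m - 2) * ((c + 1) * mass S))"
    if "m \<ge> 2" for i m
    using nn_integral_sample[of "\<lambda>z. ennreal (?h z ^ m)" i] weighted_moments[OF that assms(1)] by simp
  show "0 \<le> f (Ys i \<omega>) * indicator S (Xs i \<omega>)" for i \<omega>
    using f_nonneg by simp
qed (use b c assms in simp_all)

text \<open>A union bound over the finite class. Samples with a point outside the ball form a null
  event, which is put into \<open>A\<close> because the brackets are compared inside the ball
  only.\<close>

lemma net_deviation: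
  assumes "finite \<T>" "\<T> \<subseteq> sets borel" "L \<ge> 0" "a \<ge> 0"
  shows "\<exists>A\<in>sets M. emeasure M A \<le> ennreal (real (card \<T>) * (2 * exp (- a * L))) \<and>
    (\<forall>\<omega>\<in>space M - A. (\<forall>i<n. Xs i \<omega> \<in> cball 0 R) \<and>
      (\<forall>S\<in>\<T>. \<bar>wsum n S \<omega> - n * wmean S\<bar> \<le> 2 * b * (a + 2 * (c + 1)) * (sqrt (n * mass S * L) + L)))"
proof -
  define s where "s S = 2 * b * (a + 2 * (c + 1)) * (sqrt (n * mass S * L) + L)" for S
  define bad where "bad S = {\<omega> \<in> space M. s S \<le> \<bar>wsum n S \<omega> - n * wmean S\<bar>}" for S
  define out where "out = {\<omega> \<in> space M. \<exists>i<n. Xs i \<omega> \<notin> cball 0 R}"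
  have bad: "bad S \<in> sets M" "emeasure M (bad S) \<le> ennreal (2 * exp (- a * L))" if "S \<in> \<T>" for S
  proof -
    have [measurable]: "S \<in> sets borel" using that assms by auto
    show "bad S \<in> sets M" unfolding bad_def by measurable
    show "emeasure M (bad S) \<le> ennreal (2 * exp (- a * L))"
      unfolding bad_def s_def using assms by (intro weighted_sum_deviation) auto
  qed
  have "out = (\<Union>i\<in>{..<n}. Xs i -` (- cball 0 R) \<inter> space M)" unfolding out_def by auto
  also have "\<dots> \<in> sets M"
    by (intro sets.finite_UN measurable_sets[OF sample_measurable(1)]) auto
  finally have out: "out \<in> sets M" .
  have ae: "AE \<omega> in M. \<forall>i<n. Xs i \<omega> \<in> cball 0 R"
    using sample_ball by (simp add: AE_all_countable)
  have eq: "{\<omega> \<in> space M. \<not> (\<forall>i<n. Xs i \<omega> \<in> cball 0 R)} = out"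
    unfolding out_def by blast
  have out0: "emeasure M out = 0"
    using AE_iff_measurable[OF out eq] ae by (rule iffD1)
  have "emeasure M (out \<union> (\<Union>S\<in>\<T>. bad S)) \<le> emeasure M out + emeasure M (\<Union>S\<in>\<T>. bad S)"
    using bad out assms(1) by (intro emeasure_subadditive) auto
  also have "\<dots> \<le> 0 + (\<Sum>S\<in>\<T>. emeasure M (bad S))"
    using bad assms(1) out0 by (intro add_mono emeasure_subadditive_finite) auto
  also have "\<dots> \<le> (\<Sum>S\<in>\<T>. ennreal (2 * exp (- a * L)))"
    unfolding add_0 by (intro sum_mono bad(2))
  also have "\<dots> = ennreal (real (card \<T>) * (2 * exp (- a * L)))"
    by (simp add: ennreal_mult ennreal_of_nat_eq_real_of_nat[symmetric])
  finally have meas: "emeasure M (out \<union> (\<Union>S\<in>\<T>. bad S)) \<le> ennreal (real (card \<T>) * (2 * exp (- a * L)))" .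
  show ?thesis
  proof (rule bexI[of _ "out \<union> (\<Union>S\<in>\<T>. bad S)"], intro conjI ballI)
    show "out \<union> (\<Union>S\<in>\<T>. bad S) \<in> sets M"
      by (intro sets.Un out sets.finite_UN assms(1) bad(1))
    fix \<omega> assume \<omega>: "\<omega> \<in> space M - (out \<union> (\<Union>S\<in>\<T>. bad S))"
    then show "\<forall>i<n. Xs i \<omega> \<in> cball 0 R" unfolding out_def by blast
    fix S assume "S \<in> \<T>"
    then have "\<not> s S \<le> \<bar>wsum n S \<omega> - n * wmean S\<bar>" using \<omega> unfolding bad_def by blast
    then show "\<bar>wsum n S \<omega> - n * wmean S\<bar> \<le> 2 * b * (a + 2 * (c + 1)) * (sqrt (n * mass S * L) + L)"
      unfolding s_def by linarith
  qed (rule meas)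
qed

text \<open>On the sample the weighted sum over a slab lies between those over its two brackets. The
  means over the brackets differ by order \<open>1 / n\<close>; multiplied by \<open>n\<close> this
  is a constant, absorbed by \<open>ln n \<ge> 1\<close>.\<close>

lemma uniform_slab_deviation:
  "\<exists>B\<ge>1. \<forall>n\<ge>3. \<exists>A\<in>sets M. emeasure M A \<le> ennreal (B / n) \<and>
    (\<forall>\<omega>\<in>space M - A. \<forall>\<beta> J. norm \<beta> = 1 \<longrightarrow> is_interval J \<longrightarrow>
      \<bar>wsum n {x. \<beta> \<bullet> x \<in> J} \<omega> - n * wmean {x. \<beta> \<bullet> x \<in> J}\<bar>
        \<le> B * (sqrt (n * mass {x. \<beta> \<bullet> x \<in> J} * ln n) + ln n))"
proof -
  define C where "C = 16 * (R + 2) / R * measure lborel (cball (0::'a) (2 * R))"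
  have C: "C \<ge> 0" using R by (simp add: C_def)
  obtain A0 where br: "\<And>n. n \<ge> 1 \<Longrightarrow> \<exists>\<T> :: 'a set set. finite \<T> \<and> real (card \<T>) \<le> A0 * real n ^ (DIM('a) + 2) \<and> \<T> \<subseteq> sets borel \<and>
    (\<forall>\<beta> J. norm \<beta> = 1 \<longrightarrow> is_interval J \<longrightarrow> (\<exists>I\<in>\<T>. \<exists>U\<in>\<T>. cball 0 R \<inter> I \<subseteq> {x. \<beta> \<bullet> x \<in> J}
      \<and> cball 0 R \<inter> {x. \<beta> \<bullet> x \<in> J} \<subseteq> U
      \<and> measure lborel (cball 0 R \<inter> (U - I)) \<le> C / n))"
    using slab_bracketing[OF R, where 'a='a] unfolding C_def by blast
  \<comment> \<open>One more than the exponent in the cardinality of the bracketing class, so that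
    the union bound leaves \<open>1 / n\<close>.\<close>
  define a where "a = real (DIM('a) + 3)"
  \<comment> \<open>Bounds \<open>n\<close> times the probability of the gap between two
    brackets.\<close>
  define k where "k = D * C"
  define B0 where "B0 = 2 * b * (a + 2 * (c + 1))"
  define B where "B = B0 * (k + 2) + (2 * c + 3) * k + 2 * \<bar>A0\<bar> + 1"
  have k: "k \<ge> 0" using C D by (simp add: k_def)
  have B0: "B0 \<ge> 0" using b c by (simp add: B0_def a_def)
  have B: "B \<ge> 1" "B \<ge> 2 * \<bar>A0\<bar>" "B \<ge> B0 * (k + 2) + (2 * c + 3) * k"
    using B0 k c by (auto simp: B_def)
  have "B \<ge> B0" using B0 k c unfolding B_def by (simp add: algebra_simps)
  show ?thesis
  proof (intro exI[of _ B] conjI allI impI B)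
    fix n :: nat assume n: "n \<ge> 3"
    define L where "L = ln (real n)"
    have L: "L \<ge> 1"
      using n exp_le ln_ge_iff[of "real n" 1] by (simp add: L_def)
    obtain \<T> :: "'a set set" where T: "finite \<T>" "real (card \<T>) \<le> A0 * real n ^ (DIM('a) + 2)" "\<T> \<subseteq> sets borel"
      and bracket: "\<And>\<beta> J. norm \<beta> = 1 \<Longrightarrow> is_interval J \<Longrightarrow> (\<exists>I\<in>\<T>. \<exists>U\<in>\<T>. cball 0 R \<inter> I \<subseteq> {x. \<beta> \<bullet> x \<in> J}
      \<and> cball 0 R \<inter> {x. \<beta> \<bullet> x \<in> J} \<subseteq> U \<and> measure lborel (cball 0 R \<inter> (U - I)) \<le> C / n)"
      using br[of n] n by force
    obtain A where A: "A \<in> sets M" "emeasure M A \<le> ennreal (real (card \<T>) * (2 * exp (- a * L)))"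
      and ball: "\<And>\<omega> i. \<omega> \<in> space M - A \<Longrightarrow> i < n \<Longrightarrow> Xs i \<omega> \<in> cball 0 R"
      and dev: "\<And>\<omega> S. \<omega> \<in> space M - A \<Longrightarrow> S \<in> \<T> \<Longrightarrow> \<bar>wsum n S \<omega> - n * wmean S\<bar> \<le> B0 * (sqrt (n * mass S * L) + L)"
      using net_deviation[OF T(1,3), of L a n] L unfolding B0_def a_def by force
    have "real (card \<T>) * (2 * exp (- a * L)) \<le> B / n"
    proof -
      have "exp (- a * L) = 1 / real n ^ (DIM('a) + 3)"
        using n unfolding a_def L_def
        by (simp add: exp_minus ln_realpow[symmetric] inverse_eq_divide del: of_nat_add)
      then have "real (card \<T>) * (2 * exp (- a * L)) \<le> (A0 * real n ^ (DIM('a) + 2)) * (2 / real n ^ (DIM('a) + 3))"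
        using T(2) n by (simp add: divide_right_mono)
      also have "\<dots> = 2 * A0 / n" using n by (simp add: power_add power3_eq_cube power2_eq_square)
      also have "\<dots> \<le> B / n" using B n by (intro divide_right_mono) auto
      finally show ?thesis .
    qed
    then have "emeasure M A \<le> ennreal (B / n)" using A(2) by (meson ennreal_leI order_trans)
    moreover have "\<bar>wsum n {x. \<beta> \<bullet> x \<in> J} \<omega> - n * wmean {x. \<beta> \<bullet> x \<in> J}\<bar>
        \<le> B * (sqrt (n * mass {x. \<beta> \<bullet> x \<in> J} * L) + L)"
      if \<omega>: "\<omega> \<in> space M - A" and \<beta>: "norm \<beta> = 1" and J: "is_interval J" for \<omega> \<beta> J
    proof -
      define S where "S = {x. \<beta> \<bullet> x \<in> J}"
      have "S = (\<lambda>x. \<beta> \<bullet> x) -` J \<inter> space borel" by (auto simp: S_def)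
      also have "\<dots> \<in> sets borel"
        by (rule measurable_sets[OF _ real_interval_borel_measurable[OF J]]) measurable
      finally have S [measurable]: "S \<in> sets borel" .
      obtain I U where IU: "I \<in> \<T>" "U \<in> \<T>" "cball 0 R \<inter> I \<subseteq> S" "cball 0 R \<inter> S \<subseteq> U"
        "measure lborel (cball 0 R \<inter> (U - I)) \<le> C / n"
        using bracket[OF \<beta> J] unfolding S_def by blast
      have [measurable]: "I \<in> sets borel" "U \<in> sets borel" using IU T by auto
      have m: "mass (cball 0 R \<inter> (U - I)) \<le> k / n"
      proof -
        have "mass (cball 0 R \<inter> (U - I)) \<le> D * measure lborel (cball 0 R \<inter> (U - I))"
          by (intro density) auto
        also have "\<dots> \<le> D * (C / n)" by (intro mult_left_mono IU D)
        finally show ?thesis by (simp add: k_def)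
      qed
      have "wmean (cball 0 R \<inter> (U - I)) \<le> (2 * c + 3) * mass (cball 0 R \<inter> (U - I))"
        by (intro wmean_le) measurable
      also have "\<dots> \<le> (2 * c + 3) * (k / n)" using m c by (intro mult_left_mono) auto
      finally have gap: "n * wmean (cball 0 R \<inter> (U - I)) \<le> (2 * c + 3) * k"
        using n by (simp add: field_simps)
      \<comment> \<open>Used for the pairs \<open>U\<close>, \<open>S\<close> and \<open>S\<close>,
        \<open>I\<close>: inside the ball the larger set is contained in the smaller one up to the
        gap.\<close>
      have wle: "wmean P \<le> wmean Q + wmean (cball 0 R \<inter> (U - I))"
        if [measurable]: "P \<in> sets borel" "Q \<in> sets borel" and "cball 0 R \<inter> P \<subseteq> Q \<union> (U - I)" for P Q
      proof -
        have [measurable]: "cball 0 R \<inter> (U - I) \<in> sets borel" by measurable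
        have "wmean P \<le> (\<integral>\<omega>. f (Y \<omega>) * indicator Q (X \<omega>) + f (Y \<omega>) * indicator (cball 0 R \<inter> (U - I)) (X \<omega>) \<partial>M)"
        proof (intro integral_mono_AE Bochner_Integration.integrable_add weighted_integrable)
          show "AE \<omega> in M. f (Y \<omega>) * indicator P (X \<omega>)
              \<le> f (Y \<omega>) * indicator Q (X \<omega>) + f (Y \<omega>) * indicator (cball 0 R \<inter> (U - I)) (X \<omega>)"
            using X_ball
          proof eventually_elim
            case (elim \<omega>)
            then have "indicator P (X \<omega>) \<le> (indicator Q (X \<omega>) + indicator (cball 0 R \<inter> (U - I)) (X \<omega>) :: real)"
              using that(3) by (auto simp: indicator_def)
            from mult_left_mono[OF this f_nonneg] show ?case by (simp only: distrib_left)
          qed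
        qed measurable
        also have "\<dots> = wmean Q + wmean (cball 0 R \<inter> (U - I))"
          by (intro Bochner_Integration.integral_add weighted_integrable) measurable
        finally show ?thesis .
      qed
      have "cball 0 R \<inter> U \<subseteq> S \<union> (U - I)" "cball 0 R \<inter> S \<subseteq> I \<union> (U - I)"
        using IU(3,4) by blast+
      then have "wmean U \<le> wmean S + wmean (cball 0 R \<inter> (U - I))" "wmean S \<le> wmean I + wmean (cball 0 R \<inter> (U - I))"
        using wle[of U S] wle[of S I] by simp_all
      then have "n * wmean U \<le> n * (wmean S + wmean (cball 0 R \<inter> (U - I)))"
         "n * wmean S \<le> n * (wmean I + wmean (cball 0 R \<inter> (U - I)))"
        by (auto intro!: mult_left_mono)
      then have means: "n * wmean U \<le> n * wmean S + (2 * c + 3) * k" "n * wmean S \<le> n * wmean I + (2 * c + 3) * k"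
        using gap by (auto simp: distrib_left)
      have "mass I \<le> mass S"
      proof (rule finite_measure_mono_AE)
        show "AE \<omega> in M. \<omega> \<in> X -` I \<inter> space M \<longrightarrow> \<omega> \<in> X -` S \<inter> space M"
          using X_ball by eventually_elim (use IU(3) in blast)
      qed measurable
      then have "n * mass I * L \<le> n * mass S * L" using L by (intro mult_right_mono mult_left_mono) auto
      then have qI: "sqrt (n * mass I * L) \<le> sqrt (n * mass S * L)" by simp
      have "mass U \<le> prob ((X -` S \<inter> space M) \<union> (X -` (cball 0 R \<inter> (U - I)) \<inter> space M))"
      proof (rule finite_measure_mono_AE)
        show "AE \<omega> in M. \<omega> \<in> X -` U \<inter> space M \<longrightarrow>
            \<omega> \<in> (X -` S \<inter> space M) \<union> (X -` (cball 0 R \<inter> (U - I)) \<inter> space M)"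
          using X_ball by eventually_elim (use IU(3) in blast)
      qed measurable
      also have "\<dots> \<le> mass S + mass (cball 0 R \<inter> (U - I))" by (intro measure_Un_le) measurable
      finally have "mass U \<le> mass S + k / n" using m by simp
      then have "n * mass U \<le> n * (mass S + k / n)" by (intro mult_left_mono) auto
      then have "n * mass U \<le> n * mass S + k" using n by (simp add: distrib_left)
      then have "n * mass U * L \<le> (n * mass S + k) * L" using L by (intro mult_right_mono) auto
      then have "sqrt (n * mass U * L) \<le> sqrt (n * mass S * L + k * L)" by (simp add: distrib_right)
      also have "\<dots> \<le> sqrt (n * mass S * L) + sqrt (k * L)"
        using k L by (intro sqrt_add_le_add_sqrt) auto
      \<comment> \<open>The gap's share under the square root is moved into the linear term
        \<open>L\<close> of the deviation bound.\<close>
      also have "sqrt (k * L) \<le> k + L"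
        using k L by (intro real_le_lsqrt) (auto simp: power2_eq_square algebra_simps)
      also have "k + L \<le> (k + 1) * L" using mult_left_mono[OF L k] by (simp add: algebra_simps)
      finally have qU: "sqrt (n * mass U * L) \<le> sqrt (n * mass S * L) + (k + 1) * L" by simp
      have ind: "indicator I (Xs i \<omega>) \<le> (indicator S (Xs i \<omega>) :: real)"
        "indicator S (Xs i \<omega>) \<le> (indicator U (Xs i \<omega>) :: real)" if "i < n" for i
        using ball[OF \<omega> that] IU(3,4) by (auto simp: indicator_def)
      have sums: "wsum n I \<omega> \<le> wsum n S \<omega>" "wsum n S \<omega> \<le> wsum n U \<omega>"
        by (rule sum_mono, rule mult_left_mono, rule ind, simp, rule f_nonneg)+
      have kL: "(2 * c + 3) * k \<le> (2 * c + 3) * k * L"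
        using mult_left_mono[OF L, of "(2 * c + 3) * k"] k c by (simp only: mult_1_right) simp
      have "wsum n S \<omega> - n * wmean S \<le> B0 * (sqrt (n * mass U * L) + L) + (2 * c + 3) * k"
        using dev[OF \<omega> IU(2)] means(1) sums(2) by linarith
      also have "\<dots> \<le> B0 * (sqrt (n * mass S * L) + (k + 1) * L + L) + (2 * c + 3) * k * L"
        by (intro add_mono mult_left_mono order_refl qU B0 kL)
      also have "\<dots> = B0 * sqrt (n * mass S * L) + (B0 * (k + 2) + (2 * c + 3) * k) * L"
        by (simp add: algebra_simps)
      finally have up: "wsum n S \<omega> - n * wmean S \<le> B0 * sqrt (n * mass S * L) + (B0 * (k + 2) + (2 * c + 3) * k) * L" .
      have "n * wmean S - wsum n S \<omega> \<le> B0 * (sqrt (n * mass I * L) + L) + (2 * c + 3) * k"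
        using dev[OF \<omega> IU(1)] means(2) sums(1) by linarith
      also have "\<dots> \<le> B0 * (sqrt (n * mass S * L) + (k + 2) * L) + (2 * c + 3) * k * L"
      proof (intro add_mono mult_left_mono qI B0 kL)
        show "L \<le> (k + 2) * L" using mult_right_mono[of 1 "k + 2" L] k L by simp
      qed
      also have "\<dots> = B0 * sqrt (n * mass S * L) + (B0 * (k + 2) + (2 * c + 3) * k) * L"
        by (simp add: algebra_simps)
      finally have lo: "n * wmean S - wsum n S \<omega> \<le> B0 * sqrt (n * mass S * L) + (B0 * (k + 2) + (2 * c + 3) * k) * L" .
      have "B0 * sqrt (n * mass S * L) + (B0 * (k + 2) + (2 * c + 3) * k) * L \<le> B * sqrt (n * mass S * L) + B * L"
        using B(3) \<open>B \<ge> B0\<close> L by (intro add_mono mult_right_mono) auto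
      then show ?thesis using up lo by (simp add: S_def[symmetric] distrib_left)
    qed
    ultimately show "\<exists>A\<in>sets M. emeasure M A \<le> ennreal (B / n) \<and>
      (\<forall>\<omega>\<in>space M - A. \<forall>\<beta> J. norm \<beta> = 1 \<longrightarrow> is_interval J \<longrightarrow>
        \<bar>wsum n {x. \<beta> \<bullet> x \<in> J} \<omega> - n * wmean {x. \<beta> \<bullet> x \<in> J}\<bar>
          \<le> B * (sqrt (n * mass {x. \<beta> \<bullet> x \<in> J} * ln n) + ln n))"
      using A(1) unfolding L_def by blast
  qed
qed

end
end

text \<open>The supremum runs over a full ball of directions, which are not normalised and include 0
  when \<open>\<delta>\<^sub>0 \<ge> 1\<close>. A nonzero direction is normalised by rescaling the
  interval; for direction 0 the preimage is empty or everything, which any unit vector can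
  represent.\<close>

lemma interval_preimage_unit_direction:
  fixes \<alpha> :: "'a::euclidean_space"
  assumes J: "is_interval J"
  shows "\<exists>\<beta> J'. norm \<beta> = 1 \<and> is_interval J' \<and> {x. \<alpha> \<bullet> x \<in> J} = {x. \<beta> \<bullet> x \<in> J'}"
proof (cases "\<alpha> = 0")
  case True
  obtain \<beta> :: 'a where \<beta>: "norm \<beta> = 1"
    using nonempty_Basis norm_Basis by blast
  show ?thesis
  proof (cases "0 \<in> J")
    case 0: True
    show ?thesis using True 0 \<beta> by (intro exI[of _ \<beta>] exI[of _ UNIV]) (auto simp: is_interval_1)
  next
    case 0: False
    show ?thesis using True 0 \<beta> by (intro exI[of _ \<beta>] exI[of _ "{}"]) (auto simp: is_interval_1)
  qed
next
  case False
  have "is_interval {w. norm \<alpha> * w \<in> J}"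
    unfolding is_interval_1
  proof clarify
    fix a b x assume J': "norm \<alpha> * a \<in> J" "norm \<alpha> * b \<in> J" and "a \<le> x" "x \<le> b"
    then have "norm \<alpha> * a \<le> norm \<alpha> * x" "norm \<alpha> * x \<le> norm \<alpha> * b"
      by (auto intro!: mult_left_mono)
    then show "norm \<alpha> * x \<in> J" using J J' unfolding is_interval_1 by blast
  qed
  moreover have "{x. \<alpha> \<bullet> x \<in> J} = {x. (\<alpha> /\<^sub>R norm \<alpha>) \<bullet> x \<in> {w. norm \<alpha> * w \<in> J}}"
    using False by (simp add: mult.assoc[symmetric])
  moreover have "norm (\<alpha> /\<^sub>R norm \<alpha>) = 1" using False by simp
  ultimately show ?thesis by blast
qed

section \<open>Counts, response sums and single responses\<close>

context iid_sample
begin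

lemma hyperplane_mass_0:
  assumes "norm \<beta> = 1"
  shows "prob (X -` {x. \<beta> \<bullet> x = s} \<inter> space M) = 0"
proof -
  have H [measurable]: "{x. \<beta> \<bullet> x = s} \<in> sets borel"
    by (intro borel_closed closed_hyperplane)
  have "\<beta> \<noteq> 0" using assms by auto
  then have "{x. \<beta> \<bullet> x = s} \<in> null_sets lebesgue"
    using negligible_hyperplane[of \<beta> s] negligible_iff_null_sets by blast
  then have "{x. \<beta> \<bullet> x = s} \<in> null_sets lborel"
    using H by (auto simp: null_sets_def)
  then have "cball 0 R \<inter> {x. \<beta> \<bullet> x = s} \<in> null_sets lborel"
    by (rule null_set_Int1) simp
  then have "measure lborel (cball 0 R \<inter> {x. \<beta> \<bullet> x = s}) = 0"
    by (auto simp: null_sets_def measure_def)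
  then have 0: "prob (X -` (cball 0 R \<inter> {x. \<beta> \<bullet> x = s}) \<inter> space M) \<le> 0"
    using density[of "cball 0 R \<inter> {x. \<beta> \<bullet> x = s}"] H by simp
  have "prob (X -` {x. \<beta> \<bullet> x = s} \<inter> space M) \<le> prob (X -` (cball 0 R \<inter> {x. \<beta> \<bullet> x = s}) \<inter> space M)"
  proof (rule finite_measure_mono_AE)
    show "AE \<omega> in M. \<omega> \<in> X -` {x. \<beta> \<bullet> x = s} \<inter> space M \<longrightarrow> \<omega> \<in> X -` (cball 0 R \<inter> {x. \<beta> \<bullet> x = s}) \<inter> space M"
      using X_ball by eventually_elim blast
    show "X -` (cball 0 R \<inter> {x. \<beta> \<bullet> x = s}) \<inter> space M \<in> sets M"
      by (intro measurable_sets[OF X] sets.Int H) simp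
  qed
  then show ?thesis using 0 measure_nonneg[of M] by (metis antisym order_trans)
qed

text \<open>Counts come from the weight 1, response sums from the difference of the positive and
  negative parts. The bound on single responses is the same inequality for hyperplanes: their mass
  is 0, so the permitted deviation shrinks to a multiple of \<open>ln n\<close>.\<close>

lemma uniform_deviation:
  "\<exists>B\<ge>1. \<forall>n\<ge>(3::nat). \<exists>A\<in>sets M. emeasure M A \<le> ennreal (B / n) \<and>
    (\<forall>\<omega>\<in>space M - A. (\<forall>i<n. \<bar>Ys i \<omega>\<bar> \<le> B * ln n) \<and>
      (\<forall>\<alpha> J. is_interval J \<longrightarrow>
        \<bar>card {i. i < n \<and> \<alpha> \<bullet> Xs i \<omega> \<in> J} - n * prob (X -` {x. \<alpha> \<bullet> x \<in> J} \<inter> space M)\<bar>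
          \<le> B * (sqrt (n * prob (X -` {x. \<alpha> \<bullet> x \<in> J} \<inter> space M) * ln n) + ln n) \<and>
        \<bar>(\<Sum>i | i < n \<and> \<alpha> \<bullet> Xs i \<omega> \<in> J. Ys i \<omega>) - n * expectation (\<lambda>\<omega>. Y \<omega> * indicator {x. \<alpha> \<bullet> x \<in> J} (X \<omega>))\<bar>
          \<le> B * (sqrt (n * prob (X -` {x. \<alpha> \<bullet> x \<in> J} \<inter> space M) * ln n) + ln n)))"
proof -
  define q where "q n S = sqrt (real n * prob (X -` S \<inter> space M) * ln n) + ln n" for n S
  define ok where "ok f B n \<omega> \<longleftrightarrow> (\<forall>\<beta> J. norm \<beta> = 1 \<longrightarrow> is_interval J \<longrightarrow>
      \<bar>wsum f n {x. \<beta> \<bullet> x \<in> J} \<omega> - real n * wmean f {x. \<beta> \<bullet> x \<in> J}\<bar> \<le> B * q n {x. \<beta> \<bullet> x \<in> J})"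
    for f B n \<omega>
  have main: "\<exists>B\<ge>1. \<forall>n\<ge>3. \<exists>A\<in>sets M. emeasure M A \<le> ennreal (B / n) \<and> (\<forall>\<omega>\<in>space M - A. ok f B n \<omega>)"
    if "f \<in> borel_measurable borel" "\<And>y. 0 \<le> f y" "\<And>y. f y \<le> max 1 \<bar>y\<bar>" for f
    unfolding ok_def q_def by (rule uniform_slab_deviation[OF that])
  let ?f1 = "\<lambda>y::real. 1 :: real" and ?f2 = "\<lambda>y::real. max 0 y" and ?f3 = "\<lambda>y::real. max 0 (- y)"
  have f2: "?f2 \<in> borel_measurable borel" "0 \<le> ?f2 y" "?f2 y \<le> max 1 \<bar>y\<bar>" for y by auto
  have f3: "?f3 \<in> borel_measurable borel" "0 \<le> ?f3 y" "?f3 y \<le> max 1 \<bar>y\<bar>" for y by auto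
  obtain B1 where B1: "B1 \<ge> 1" "\<And>n. n \<ge> 3 \<Longrightarrow> \<exists>A\<in>sets M. emeasure M A \<le> ennreal (B1 / n) \<and> (\<forall>\<omega>\<in>space M - A. ok ?f1 B1 n \<omega>)"
    using main[of ?f1] by auto
  obtain B2 where B2: "B2 \<ge> 1" "\<And>n. n \<ge> 3 \<Longrightarrow> \<exists>A\<in>sets M. emeasure M A \<le> ennreal (B2 / n) \<and> (\<forall>\<omega>\<in>space M - A. ok ?f2 B2 n \<omega>)"
    using main[OF f2] by blast
  obtain B3 where B3: "B3 \<ge> 1" "\<And>n. n \<ge> 3 \<Longrightarrow> \<exists>A\<in>sets M. emeasure M A \<le> ennreal (B3 / n) \<and> (\<forall>\<omega>\<in>space M - A. ok ?f3 B3 n \<omega>)"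
    using main[OF f3] by blast
  define B where "B = B1 + B2 + B3"
  have q0: "q n S \<ge> 0" if "n \<ge> 3" for n S
    using that by (simp add: q_def)
  show ?thesis
    unfolding q_def[symmetric]
  proof (intro exI[of _ B] conjI allI impI)
    show "B \<ge> 1" using B1 B2 B3 by (simp add: B_def)
    fix n :: nat assume n: "n \<ge> 3"
    obtain A1 where A1: "A1 \<in> sets M" "emeasure M A1 \<le> ennreal (B1 / n)" "\<And>\<omega>. \<omega> \<in> space M - A1 \<Longrightarrow> ok ?f1 B1 n \<omega>"
      using B1(2)[OF n] by blast
    obtain A2 where A2: "A2 \<in> sets M" "emeasure M A2 \<le> ennreal (B2 / n)" "\<And>\<omega>. \<omega> \<in> space M - A2 \<Longrightarrow> ok ?f2 B2 n \<omega>"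
      using B2(2)[OF n] by blast
    obtain A3 where A3: "A3 \<in> sets M" "emeasure M A3 \<le> ennreal (B3 / n)" "\<And>\<omega>. \<omega> \<in> space M - A3 \<Longrightarrow> ok ?f3 B3 n \<omega>"
      using B3(2)[OF n] by blast
    have "emeasure M (A1 \<union> A2 \<union> A3) \<le> emeasure M A1 + emeasure M A2 + emeasure M A3"
      using A1(1) A2(1) A3(1)
      by (intro order_trans[OF emeasure_subadditive] add_mono order_refl) auto
    also have "\<dots> \<le> ennreal (B1 / n) + ennreal (B2 / n) + ennreal (B3 / n)"
      by (intro add_mono A1(2) A2(2) A3(2))
    also have "\<dots> = ennreal (B / n)"
      using B1(1) B2(1) B3(1) by (simp add: B_def add_divide_distrib)
    finally have meas: "emeasure M (A1 \<union> A2 \<union> A3) \<le> ennreal (B / n)" .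
    show "\<exists>A\<in>sets M. emeasure M A \<le> ennreal (B / n) \<and>
    (\<forall>\<omega>\<in>space M - A. (\<forall>i<n. \<bar>Ys i \<omega>\<bar> \<le> B * ln n) \<and>
      (\<forall>\<alpha> J. is_interval J \<longrightarrow>
        \<bar>card {i. i < n \<and> \<alpha> \<bullet> Xs i \<omega> \<in> J} - n * prob (X -` {x. \<alpha> \<bullet> x \<in> J} \<inter> space M)\<bar> \<le> B * q n {x. \<alpha> \<bullet> x \<in> J} \<and>
        \<bar>(\<Sum>i | i < n \<and> \<alpha> \<bullet> Xs i \<omega> \<in> J. Ys i \<omega>) - n * expectation (\<lambda>\<omega>. Y \<omega> * indicator {x. \<alpha> \<bullet> x \<in> J} (X \<omega>))\<bar>
          \<le> B * q n {x. \<alpha> \<bullet> x \<in> J}))"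
    proof (rule bexI[of _ "A1 \<union> A2 \<union> A3"], intro conjI ballI allI impI)
      show "A1 \<union> A2 \<union> A3 \<in> sets M" using A1(1) A2(1) A3(1) by auto
      fix \<omega> assume \<omega>: "\<omega> \<in> space M - (A1 \<union> A2 \<union> A3)"
      have ok: "ok ?f1 B1 n \<omega>" "ok ?f2 B2 n \<omega>" "ok ?f3 B3 n \<omega>"
        using \<omega> by (auto intro!: A1(3) A2(3) A3(3))
      {
        fix \<alpha> :: 'a and J :: "real set" assume J: "is_interval J"
        define S where "S = {x. \<alpha> \<bullet> x \<in> J}"
        obtain \<beta> J' where \<beta>: "norm \<beta> = 1" "is_interval J'" "S = {x. \<beta> \<bullet> x \<in> J'}"
          using interval_preimage_unit_direction[OF J, of \<alpha>] unfolding S_def by blast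
        have dev: "\<bar>wsum ?f1 n S \<omega> - real n * wmean ?f1 S\<bar> \<le> B1 * q n S"
          "\<bar>wsum ?f2 n S \<omega> - real n * wmean ?f2 S\<bar> \<le> B2 * q n S"
          "\<bar>wsum ?f3 n S \<omega> - real n * wmean ?f3 S\<bar> \<le> B3 * q n S"
          using ok \<beta>(1,2) unfolding ok_def \<beta>(3) by blast+
        have "S = (\<lambda>x. \<alpha> \<bullet> x) -` J \<inter> space borel" by (auto simp: S_def)
        also have "\<dots> \<in> sets borel"
          by (rule measurable_sets[OF _ real_interval_borel_measurable[OF J]]) measurable
        finally have S [measurable]: "S \<in> sets borel" .
        have Bq: "B1 * q n S \<le> B * q n S" "B2 * q n S + B3 * q n S \<le> B * q n S"
          using q0[OF n, of S] B1(1) B2(1) B3(1) unfolding B_def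
          by (auto simp: distrib_right)
        have c1: "wsum ?f1 n S \<omega> = card {i. i < n \<and> \<alpha> \<bullet> Xs i \<omega> \<in> J}"
          by (simp add: S_def indicator_def sum.If_cases Int_def conj_commute)
        have c2: "wmean ?f1 S = prob (X -` S \<inter> space M)"
        proof -
          have "wmean ?f1 S = (\<integral>\<omega>. indicator (X -` S \<inter> space M) \<omega> \<partial>M)"
            by (intro Bochner_Integration.integral_cong) (auto simp: indicator_def)
          then show ?thesis by simp
        qed
        show "\<bar>card {i. i < n \<and> \<alpha> \<bullet> Xs i \<omega> \<in> J} - n * prob (X -` {x. \<alpha> \<bullet> x \<in> J} \<inter> space M)\<bar>
            \<le> B * q n {x. \<alpha> \<bullet> x \<in> J}"
          using order_trans[OF dev(1) Bq(1)] unfolding S_def[symmetric] c1 c2 .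
        have "wsum ?f2 n S \<omega> - wsum ?f3 n S \<omega> = (\<Sum>i<n. Ys i \<omega> * indicator S (Xs i \<omega>))"
          unfolding sum_subtractf[symmetric] by (intro sum.cong) (auto simp: indicator_def)
        also have "\<dots> = (\<Sum>i | i < n \<and> \<alpha> \<bullet> Xs i \<omega> \<in> J. Ys i \<omega>)"
          by (simp add: S_def indicator_def if_distrib sum.If_cases Int_def conj_commute cong: if_cong)
        finally have 1: "(\<Sum>i | i < n \<and> \<alpha> \<bullet> Xs i \<omega> \<in> J. Ys i \<omega>) = wsum ?f2 n S \<omega> - wsum ?f3 n S \<omega>" ..
        have "wmean ?f2 S - wmean ?f3 S = (\<integral>\<omega>. ?f2 (Y \<omega>) * indicator S (X \<omega>) - ?f3 (Y \<omega>) * indicator S (X \<omega>) \<partial>M)"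
          by (intro Bochner_Integration.integral_diff[symmetric] weighted_integrable) auto
        also have "\<dots> = expectation (\<lambda>\<omega>. Y \<omega> * indicator S (X \<omega>))"
          by (intro Bochner_Integration.integral_cong) (auto simp: indicator_def)
        finally have d: "wmean ?f2 S - wmean ?f3 S = expectation (\<lambda>\<omega>. Y \<omega> * indicator S (X \<omega>))" .
        have 2: "n * expectation (\<lambda>\<omega>. Y \<omega> * indicator S (X \<omega>)) = n * wmean ?f2 S - n * wmean ?f3 S"
          unfolding d[symmetric] by (rule right_diff_distrib)
        show "\<bar>(\<Sum>i | i < n \<and> \<alpha> \<bullet> Xs i \<omega> \<in> J. Ys i \<omega>) - n * expectation (\<lambda>\<omega>. Y \<omega> * indicator {x. \<alpha> \<bullet> x \<in> J} (X \<omega>))\<bar>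
            \<le> B * q n {x. \<alpha> \<bullet> x \<in> J}"
          unfolding S_def[symmetric] 1 2 using dev(2,3) Bq(2) by linarith
      }
      fix i assume i: "i < n"
      obtain \<beta> :: 'a where \<beta>: "norm \<beta> = 1" using nonempty_Basis norm_Basis by blast
      \<comment> \<open>The hyperplane passes through the observation itself. This choice may depend
        on the data because the event covers all intervals, singletons included.\<close>
      define H where "H = {x. \<beta> \<bullet> x \<in> {\<beta> \<bullet> Xs i \<omega>}}"
      have iv: "is_interval {\<beta> \<bullet> Xs i \<omega>}" by (simp add: is_interval_1)
      have H: "H \<in> sets borel" unfolding H_def by (auto intro!: borel_closed closed_hyperplane)
      have mass: "prob (X -` H \<inter> space M) = 0" using hyperplane_mass_0[OF \<beta>] by (simp add: H_def)
      then have qH: "q n H = ln n" by (simp add: q_def)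
      have point: "f (Ys i \<omega>) \<le> B' * ln n"
        if f: "f \<in> borel_measurable borel" "\<And>y. 0 \<le> f y" "\<And>y. f y \<le> max 1 \<bar>y\<bar>" and ok: "ok f B' n \<omega>" for f B'
      proof -
        have "indicator H (Xs i \<omega>) = (1 :: real)" by (simp add: H_def)
        then have "f (Ys i \<omega>) = f (Ys i \<omega>) * indicator H (Xs i \<omega>)" by simp
        also have "\<dots> \<le> wsum f n H \<omega>"
          using i f(2) by (intro member_le_sum[of i "{..<n}" "\<lambda>i. f (Ys i \<omega>) * indicator H (Xs i \<omega>)"]) auto
        finally have "f (Ys i \<omega>) \<le> wsum f n H \<omega>" .
        moreover have "\<bar>wsum f n H \<omega> - real n * wmean f H\<bar> \<le> B' * q n H"
          using ok \<beta> iv unfolding ok_def H_def by blast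
        moreover have "wmean f H \<le> 0" using wmean_le[OF f H] mass by simp
        then have "real n * wmean f H \<le> 0" by (simp add: mult_nonneg_nonpos)
        ultimately show ?thesis unfolding qH by linarith
      qed
      have "?f2 (Ys i \<omega>) \<le> B2 * ln n" "?f3 (Ys i \<omega>) \<le> B3 * ln n"
        using point[OF f2 ok(2)] point[OF f3 ok(3)] .
      moreover have "B2 * ln n \<le> B * ln n" "B3 * ln n \<le> B * ln n"
        using n B1 B2 B3 by (auto simp: B_def intro!: mult_right_mono)
      ultimately show "\<bar>Ys i \<omega>\<bar> \<le> B * ln n" by linarith
    qed (rule meas)
  qed
qed

end

section \<open>Regression functions and the rate\<close>

text \<open>The complement of the support is a union of open null sets, and by second countability
  countably many of them already cover it.\<close>

lemma AE_measure_support: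
  fixes N :: "'a::second_countable_topology measure"
  assumes "sets N = sets borel"
  shows "AE x in N. x \<in> measure_support N"
proof -
  define F where "F = {U. open U \<and> emeasure N U = 0}"
  obtain F' where F': "F' \<subseteq> F" "countable F'" "\<Union>F' = \<Union>F"
    using Lindelof[of F] by (auto simp: F_def)
  have "(\<Union>U\<in>F'. U) \<in> null_sets N"
    using F'(1,2) assms by (intro null_sets_UN') (auto simp: F_def null_sets_def)
  moreover have "{x \<in> space N. x \<notin> measure_support N} \<subseteq> (\<Union>U\<in>F'. U)"
    using F'(3) by (auto simp: measure_support_def F_def zero_less_iff_neq_zero)
  ultimately show ?thesis by (rule AE_I'[rotated, rotated])
qed

lemma closed_measure_support: "closed (measure_support N)"
proof -
  have "- measure_support N = \<Union>{U. open U \<and> emeasure N U = 0}"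
    by (auto simp: measure_support_def zero_less_iff_neq_zero)
  then have "open (- measure_support N)" by (auto intro: open_Union)
  then show ?thesis by (simp add: closed_def)
qed

text \<open>A3 gives monotonicity on the projected support only, and a version of the regression
  function may exceed the bound on a null set. The extension is the running supremum of the
  truncated function; the inserted \<open>- K\<close> is its value to the left of
  \<open>I\<close>.\<close>

lemma bounded_mono_extension:
  fixes h :: "real \<Rightarrow> real"
  assumes h: "mono_on I h" and K: "K \<ge> 0"
  shows "\<exists>m. mono m \<and> (\<forall>u. \<bar>m u\<bar> \<le> K) \<and> (\<forall>u\<in>I. \<bar>h u\<bar> \<le> K \<longrightarrow> m u = h u)"
proof -
  define g where "g u = max (- K) (min K (h u))" for u
  define V where "V u = insert (- K) (g ` {w \<in> I. w \<le> u})" for u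
  have g: "- K \<le> g u" "g u \<le> K" "\<bar>g u\<bar> \<le> K" for u using K by (auto simp: g_def)
  have bdd: "bdd_above (V u)" for u
    using g K by (auto simp: V_def intro!: bdd_aboveI[of _ K])
  have m1: "mono (\<lambda>u. Sup (V u))"
    using bdd by (intro monoI cSup_subset_mono) (auto simp: V_def)
  have m2: "\<bar>Sup (V u)\<bar> \<le> K" for u
    using g K by (intro cSup_abs_le) (auto simp: V_def)
  have "Sup (V u) = h u" if u: "u \<in> I" "\<bar>h u\<bar> \<le> K" for u
  proof -
    have "g w \<le> g u" if "w \<in> I" "w \<le> u" for w
      using mono_onD[OF h that(1) u(1) that(2)] by (auto simp: g_def)
    then have "Sup (V u) = g u"
      using u g by (intro cSup_eq_maximum) (auto simp: V_def)
    then show ?thesis using u(2) by (auto simp: g_def)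
  qed
  then show ?thesis using m1 m2 by blast
qed

section \<open>Regression functions as conditional expectations\<close>

context prob_space
begin

lemma sigma_gen_subalgebra:
  assumes "T \<in> borel_measurable M"
  shows "subalgebra M (sigma_gen M T)" "finite_measure_subalgebra M (sigma_gen M T)"
    and "T \<in> borel_measurable (sigma_gen M T)"
proof -
  have *: "T \<in> space M \<rightarrow> space borel" by simp
  show sub: "subalgebra M (sigma_gen M T)"
    unfolding subalgebra_def sigma_gen_def using assms
    by (auto simp: sets_vimage_algebra2[OF *] measurable_sets)
  show "finite_measure_subalgebra M (sigma_gen M T)"
    by (intro finite_measure_subalgebra.intro finite_measure_axioms finite_measure_subalgebra_axioms.intro sub)
  show "T \<in> borel_measurable (sigma_gen M T)"
    unfolding sigma_gen_def by (rule measurable_vimage_algebra1[OF *])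
qed

text \<open>The indicator of \<open>T \<in> J\<close> is measurable for the sigma-algebra of
  \<open>T\<close>, so the defining property of conditional expectation applies, whichever version
  \<open>h\<close> is taken.\<close>

lemma regression_integral:
  assumes T: "T \<in> borel_measurable M" and Z: "integrable M Z"
    and h: "is_regression_function M Z T h" and J: "J \<in> sets borel"
  shows "(\<integral>\<omega>. Z \<omega> * indicator J (T \<omega>) \<partial>M) = (\<integral>\<omega>. h (T \<omega>) * indicator J (T \<omega>) \<partial>M)"
proof -
  interpret F: finite_measure_subalgebra M "sigma_gen M T" by (rule sigma_gen_subalgebra[OF T])
  have ind: "(\<lambda>\<omega>. indicator J (T \<omega>) :: real) \<in> borel_measurable (sigma_gen M T)"
    by (rule measurable_compose[OF sigma_gen_subalgebra(3)[OF T]]) (use J in measurable)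
  have indM [measurable]: "(\<lambda>\<omega>. indicator J (T \<omega>) :: real) \<in> borel_measurable M"
    by (rule measurable_compose[OF T]) (use J in measurable)
  have [measurable]: "Z \<in> borel_measurable M" using Z by auto
  have int: "integrable M (\<lambda>\<omega>. indicator J (T \<omega>) * Z \<omega>)"
    by (rule Bochner_Integration.integrable_bound[OF Z borel_measurable_times[OF indM]]) (auto simp: indicator_def)
  have "(\<integral>\<omega>. indicator J (T \<omega>) * Z \<omega> \<partial>M) = (\<integral>\<omega>. indicator J (T \<omega>) * real_cond_exp M (sigma_gen M T) Z \<omega> \<partial>M)"
    by (rule F.real_cond_exp_intg(2)[symmetric, OF int ind]) measurable
  also have "\<dots> = (\<integral>\<omega>. indicator J (T \<omega>) * h (T \<omega>) \<partial>M)"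
  proof (rule integral_cong_AE)
    show "AE \<omega> in M. indicator J (T \<omega>) * real_cond_exp M (sigma_gen M T) Z \<omega> = indicator J (T \<omega>) * h (T \<omega>)"
      using h unfolding is_regression_function_def by (auto elim: eventually_mono)
    have [measurable]: "h \<in> borel_measurable borel" using h by (simp add: is_regression_function_def)
    show "(\<lambda>\<omega>. indicator J (T \<omega>) * h (T \<omega>)) \<in> borel_measurable M"
      using T by measurable
  qed measurable
  finally show ?thesis by (simp add: mult.commute)
qed

lemma regression_bounded:
  assumes T: "T \<in> borel_measurable M" and Z: "integrable M Z"
    and h: "is_regression_function M Z T h" and K: "AE \<omega> in M. \<bar>Z \<omega>\<bar> \<le> K"
  shows "AE \<omega> in M. \<bar>h (T \<omega>)\<bar> \<le> K"
proof -
  interpret F: finite_measure_subalgebra M "sigma_gen M T" by (rule sigma_gen_subalgebra[OF T])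
  have "AE \<omega> in M. real_cond_exp M (sigma_gen M T) Z \<omega> \<le> K"
    using K by (intro F.real_cond_exp_le_c Z) (auto elim: eventually_mono)
  moreover have "AE \<omega> in M. real_cond_exp M (sigma_gen M T) Z \<omega> \<ge> - K"
    using K by (intro F.real_cond_exp_ge_c Z) (auto elim: eventually_mono)
  moreover have "AE \<omega> in M. real_cond_exp M (sigma_gen M T) Z \<omega> = h (T \<omega>)"
    using h by (simp add: is_regression_function_def)
  ultimately show ?thesis by eventually_elim auto
qed

lemma cond_mean_zero_integral:
  assumes T: "T \<in> borel_measurable M" and Z: "integrable M Z"
    and 0: "AE \<omega> in M. real_cond_exp M (sigma_gen M T) Z \<omega> = 0" and S: "S \<in> sets borel"
  shows "(\<integral>\<omega>. Z \<omega> * indicator S (T \<omega>) \<partial>M) = 0"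
  using regression_integral[OF T Z _ S, of "\<lambda>_. 0"] 0 by (simp add: is_regression_function_def)

lemma cond_moment_le:
  assumes T: "T \<in> borel_measurable M" and [measurable]: "Z \<in> borel_measurable M"
    and le: "AE \<omega> in M. nn_cond_exp M (sigma_gen M T) Z \<omega> \<le> a" and S: "S \<in> sets borel"
  shows "(\<integral>\<^sup>+\<omega>. Z \<omega> * indicator S (T \<omega>) \<partial>M) \<le> a * emeasure M (T -` S \<inter> space M)"
proof -
  interpret F: finite_measure_subalgebra M "sigma_gen M T" by (rule sigma_gen_subalgebra[OF T])
  have ind: "(\<lambda>\<omega>. indicator S (T \<omega>) :: ennreal) \<in> borel_measurable (sigma_gen M T)"
    by (rule measurable_compose[OF sigma_gen_subalgebra(3)[OF T]]) (use S in measurable)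
  have TS: "T -` S \<inter> space M \<in> sets M" by (rule measurable_sets[OF T S])
  have "(\<integral>\<^sup>+\<omega>. Z \<omega> * indicator S (T \<omega>) \<partial>M) = (\<integral>\<^sup>+\<omega>. indicator S (T \<omega>) * Z \<omega> \<partial>M)"
    by (simp add: mult.commute)
  also have "\<dots> = (\<integral>\<^sup>+\<omega>. indicator S (T \<omega>) * nn_cond_exp M (sigma_gen M T) Z \<omega> \<partial>M)"
    by (rule F.nn_cond_exp_intg[symmetric, OF ind]) measurable
  also have "\<dots> \<le> (\<integral>\<^sup>+\<omega>. a * indicator (T -` S \<inter> space M) \<omega> \<partial>M)"
    using le by (intro nn_integral_mono_AE) (auto elim!: eventually_mono simp: indicator_def)
  also have "\<dots> = a * emeasure M (T -` S \<inter> space M)"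
    by (rule nn_integral_cmult_indicator[OF TS])
  finally show ?thesis .
qed

end

text \<open>The density is controlled on \<open>T\<close> only, so \<open>S\<close> is first cut
  down to \<open>S \<inter> T\<close>, which loses no probability.\<close>

lemma measure_le_of_bounded_density:
  fixes g :: "'a::euclidean_space \<Rightarrow> real"
  assumes "prob_space M" and dist: "distributed M lborel X (\<lambda>x. ennreal (g x))"
    and T: "T \<in> sets borel" and AE: "AE \<omega> in M. X \<omega> \<in> T" and g: "\<And>x. x \<in> T \<Longrightarrow> g x \<le> D" and D: "D \<ge> 0"
    and S: "S \<in> sets borel" "bounded S"
  shows "measure M (X -` S \<inter> space M) \<le> D * measure lborel S"
proof -
  interpret prob_space M by fact
  have X: "X \<in> borel_measurable M" using distributed_measurable[OF dist] by simp
  have ST: "X -` (S \<inter> T) \<inter> space M \<in> sets M" by (rule measurable_sets[OF X sets.Int[OF S(1) T]])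
  have "prob (X -` S \<inter> space M) \<le> prob (X -` (S \<inter> T) \<inter> space M)"
  proof (rule finite_measure_mono_AE[OF _ ST])
    show "AE \<omega> in M. \<omega> \<in> X -` S \<inter> space M \<longrightarrow> \<omega> \<in> X -` (S \<inter> T) \<inter> space M"
      using AE by eventually_elim blast
  qed
  then have "ennreal (prob (X -` S \<inter> space M)) \<le> emeasure M (X -` (S \<inter> T) \<inter> space M)"
    by (simp add: emeasure_eq_measure)
  also have "\<dots> = (\<integral>\<^sup>+x. ennreal (g x) * indicator (S \<inter> T) x \<partial>lborel)"
    by (rule distributed_emeasure[OF dist]) (use sets.Int[OF S(1) T] in simp)
  also have "\<dots> \<le> (\<integral>\<^sup>+x. ennreal D * indicator S x \<partial>lborel)"
    using g by (intro nn_integral_mono) (auto simp: indicator_def intro: ennreal_leI)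
  also have "\<dots> = ennreal D * emeasure lborel S"
    by (rule nn_integral_cmult_indicator) (simp add: S)
  also have "emeasure lborel S = ennreal (measure lborel S)"
    by (rule emeasure_eq_ennreal_measure) (use emeasure_bounded_finite[OF S(2)] in auto)
  also have "ennreal D * ennreal (measure lborel S) = ennreal (D * measure lborel S)"
    using D by (simp add: ennreal_mult)
  finally show ?thesis using D by (simp add: ennreal_le_iff)
qed

theorem proposition2:
  fixes M :: "'w measure"
    and X :: "'w \<Rightarrow> real ^ 'd" and Y \<epsilon> :: "'w \<Rightarrow> real"
    and Xs :: "nat \<Rightarrow> 'w \<Rightarrow> real ^ 'd" and Ys :: "nat \<Rightarrow> 'w \<Rightarrow> real"
    and \<psi>\<^sub>0 :: "real \<Rightarrow> real" and \<alpha>\<^sub>0 :: "real ^ 'd"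
    and G :: "(real ^ 'd) measure" and \<X> :: "(real ^ 'd) set"
    and \<psi> :: "real ^ 'd \<Rightarrow> real \<Rightarrow> real"
    and \<psi>hat :: "nat \<Rightarrow> 'w \<Rightarrow> real ^ 'd \<Rightarrow> real \<Rightarrow> real"
    and g :: "real ^ 'd \<Rightarrow> real"
    and R K\<^sub>0 \<delta>\<^sub>0 a\<^sub>0 b\<^sub>0 c0_lo c0_hi c1_lo c1_hi c\<^sub>0 M\<^sub>0 :: real
  assumes "prob_space M"
    and X: "X \<in> borel_measurable M"
    and Y: "Y \<in> borel_measurable M"
    and G: "G = distr M borel X"
    and supp: "\<X> = measure_support G"
    and mono: "mono \<psi>\<^sub>0"
    and unit: "norm \<alpha>\<^sub>0 = 1"
    and model: "\<And>\<omega>. \<omega> \<in> space M \<Longrightarrow> Y \<omega> = \<psi>\<^sub>0 (\<alpha>\<^sub>0 \<bullet> X \<omega>) + \<epsilon> \<omega>"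
    and err_int: "integrable M \<epsilon>"
    and err: "AE \<omega> in M. real_cond_exp M (sigma_gen M X) \<epsilon> \<omega> = 0"
    and indep: "prob_space.indep_vars M (\<lambda>_. borel) (\<lambda>i \<omega>. (Xs i \<omega>, Ys i \<omega>)) UNIV"
    and ident: "\<And>i. distr M borel (\<lambda>\<omega>. (Xs i \<omega>, Ys i \<omega>)) = distr M borel (\<lambda>\<omega>. (X \<omega>, Y \<omega>))"
    and psi: "\<And>\<alpha>. is_regression_function M (\<lambda>\<omega>. \<psi>\<^sub>0 (\<alpha>\<^sub>0 \<bullet> X \<omega>)) (\<lambda>\<omega>. \<alpha> \<bullet> X \<omega>) (\<psi> \<alpha>)"
    and psi_hat: "\<And>n \<omega> \<alpha>. n \<ge> 1 \<Longrightarrow> \<omega> \<in> space M \<Longrightarrow>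
      is_monotone_LSE n (\<lambda>i. \<alpha> \<bullet> Xs i \<omega>) (\<lambda>i. Ys i \<omega>) (\<psi>hat n \<omega> \<alpha>)"
    and A1: "convex \<X>" "interior \<X> \<noteq> {}" "R > 0" "\<X> \<subseteq> cball 0 R"
    and A2: "K\<^sub>0 > 0" "\<And>x \<alpha>. x \<in> \<X> \<Longrightarrow> norm \<alpha> = 1 \<Longrightarrow> \<bar>\<psi>\<^sub>0 (\<alpha> \<bullet> x)\<bar> \<le> K\<^sub>0"
    and A3: "\<delta>\<^sub>0 > 0" "\<And>\<alpha>. \<alpha> \<in> cball \<alpha>\<^sub>0 \<delta>\<^sub>0 \<Longrightarrow> mono_on ((\<lambda>x. \<alpha> \<bullet> x) ` \<X>) (\<psi> \<alpha>)"
    and A4: "a\<^sub>0 = Inf ((\<lambda>x. \<alpha>\<^sub>0 \<bullet> x) ` \<X>)" "b\<^sub>0 = Sup ((\<lambda>x. \<alpha>\<^sub>0 \<bullet> x) ` \<X>)"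
      "\<psi>\<^sub>0 C1_differentiable_on {a\<^sub>0 - \<delta>\<^sub>0 * R <..< b\<^sub>0 + \<delta>\<^sub>0 * R}"
    and A5: "\<And>x. 0 \<le> g x" "distributed M lborel X (\<lambda>x. ennreal (g x))"
      "g differentiable_on \<X>"
      "c0_lo > 0" "c0_hi > 0" "\<And>x. x \<in> \<X> \<Longrightarrow> c0_lo \<le> g x \<and> g x \<le> c0_hi"
      "c1_lo > 0" "c1_hi > 0"
      "\<And>x i. x \<in> \<X> \<Longrightarrow> c1_lo \<le> frechet_derivative g (at x within \<X>) (axis i 1)
                   \<and> frechet_derivative g (at x within \<X>) (axis i 1) \<le> c1_hi"
    and A6: "c\<^sub>0 > 0" "M\<^sub>0 > 0"
      "\<And>m::nat. m \<ge> 2 \<Longrightarrow> AE \<omega> in M.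
         nn_cond_exp M (sigma_gen M X) (\<lambda>\<omega>. ennreal (\<bar>Y \<omega>\<bar> ^ m)) \<omega>
           \<le> ennreal (fact m * M\<^sub>0 ^ (m - 2) * c\<^sub>0)"
  shows "bigO_outer_prob M
    (\<lambda>n \<omega>. SUP \<alpha>\<in>cball \<alpha>\<^sub>0 \<delta>\<^sub>0. \<integral>\<^sup>+ x. ennreal ((\<psi>hat n \<omega> \<alpha> (\<alpha> \<bullet> x) - \<psi> \<alpha> (\<alpha> \<bullet> x))\<^sup>2) \<partial>G)
    (\<lambda>n. (ln (real n))\<^sup>2 * real n powr (-2/3))"
proof -
  interpret prob_space M by fact
  have G_sets: "sets G = sets borel" by (simp add: G)
  have X_supp: "AE \<omega> in M. X \<omega> \<in> \<X>"
    using AE_measure_support[OF G_sets] unfolding supp G by (rule AE_distrD[OF X])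
  have \<X>_borel: "\<X> \<in> sets borel"
    unfolding supp by (intro borel_closed closed_measure_support)
  have X_ball: "AE \<omega> in M. X \<omega> \<in> cball 0 R"
    using X_supp by eventually_elim (use A1(4) in blast)
  have dens: "prob (X -` S \<inter> space M) \<le> c0_hi * measure lborel S"
    if "S \<in> sets borel" "S \<subseteq> cball 0 R" for S
    using that A5(5,6) bounded_subset[OF bounded_cball that(2)]
    by (intro measure_le_of_bounded_density[OF \<open>prob_space M\<close> A5(2) \<X>_borel X_supp]) auto
  \<comment> \<open>Raising \<open>M\<^sub>0\<close> to at least 1 only weakens A6 and meets the
    requirement \<open>b \<ge> 1\<close> of \<open>iid_sample\<close>.\<close>
  have moments: "(\<integral>\<^sup>+\<omega>. ennreal (\<bar>Y \<omega>\<bar> ^ m) * indicator S (X \<omega>) \<partial>M)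
      \<le> ennreal (fact m * (max M\<^sub>0 1) ^ (m - 2) * (c\<^sub>0 * prob (X -` S \<inter> space M)))"
    if m: "m \<ge> 2" and S: "S \<in> sets borel" for m S
  proof -
    have "(\<lambda>\<omega>. ennreal (\<bar>Y \<omega>\<bar> ^ m)) \<in> borel_measurable M" using Y by measurable
    then have "(\<integral>\<^sup>+\<omega>. ennreal (\<bar>Y \<omega>\<bar> ^ m) * indicator S (X \<omega>) \<partial>M)
        \<le> ennreal (fact m * M\<^sub>0 ^ (m - 2) * c\<^sub>0) * emeasure M (X -` S \<inter> space M)"
      by (rule cond_moment_le[OF X _ A6(3)[OF m] S])
    also have "\<dots> = ennreal (fact m * M\<^sub>0 ^ (m - 2) * c\<^sub>0 * prob (X -` S \<inter> space M))"
      using A6(1,2) by (simp add: emeasure_eq_measure ennreal_mult)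
    also have "\<dots> \<le> ennreal (fact m * (max M\<^sub>0 1) ^ (m - 2) * c\<^sub>0 * prob (X -` S \<inter> space M))"
      using A6(1,2) by (intro ennreal_leI mult_right_mono mult_left_mono power_mono) auto
    finally show ?thesis by (simp only: mult.assoc)
  qed
  interpret S: iid_sample M X Y Xs Ys "max M\<^sub>0 1" c\<^sub>0 R c0_hi
    by unfold_locales (use X Y indep ident moments A1(3) X_ball dens A5(5) A6(1) in auto)
  obtain B where B: "B \<ge> 1" and event: "\<And>n::nat. n \<ge> 3 \<Longrightarrow> \<exists>A\<in>sets M. emeasure M A \<le> ennreal (B / n) \<and>
    (\<forall>\<omega>\<in>space M - A. (\<forall>i<n. \<bar>Ys i \<omega>\<bar> \<le> B * ln n) \<and>
      (\<forall>\<alpha> J. is_interval J \<longrightarrow>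
        \<bar>card {i. i < n \<and> \<alpha> \<bullet> Xs i \<omega> \<in> J} - n * prob (X -` {x. \<alpha> \<bullet> x \<in> J} \<inter> space M)\<bar>
          \<le> B * (sqrt (n * prob (X -` {x. \<alpha> \<bullet> x \<in> J} \<inter> space M) * ln n) + ln n) \<and>
        \<bar>(\<Sum>i | i < n \<and> \<alpha> \<bullet> Xs i \<omega> \<in> J. Ys i \<omega>) - n * expectation (\<lambda>\<omega>. Y \<omega> * indicator {x. \<alpha> \<bullet> x \<in> J} (X \<omega>))\<bar>
          \<le> B * (sqrt (n * prob (X -` {x. \<alpha> \<bullet> x \<in> J} \<inter> space M) * ln n) + ln n)))"
    using S.uniform_deviation by blast
  define C where "C = 2 * fit_const K\<^sub>0 B"
  have C: "C > 0" using A2(1) by (simp add: C_def fit_const_def add_pos_nonneg)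
  let ?Z = "\<lambda>\<omega>. \<psi>\<^sub>0 (\<alpha>\<^sub>0 \<bullet> X \<omega>)"
  have psi0_meas: "\<psi>\<^sub>0 \<in> borel_measurable borel" by (rule borel_measurable_mono[OF mono])
  have inner_meas [measurable]: "(\<lambda>\<omega>. \<alpha> \<bullet> X \<omega>) \<in> borel_measurable M" for \<alpha>
    using X by measurable
  have Z_meas [measurable]: "?Z \<in> borel_measurable M"
    by (rule measurable_compose[OF inner_meas psi0_meas])
  have Z_le: "AE \<omega> in M. \<bar>?Z \<omega>\<bar> \<le> K\<^sub>0"
    using X_supp by eventually_elim (use A2(2) unit in blast)
  have Z_int: "integrable M ?Z"
    using Z_le by (intro integrable_const_bound[where B=K\<^sub>0]) auto
  have bound: "(\<integral>\<^sup>+x. ennreal ((\<psi>hat n \<omega> \<alpha> (\<alpha> \<bullet> x) - \<psi> \<alpha> (\<alpha> \<bullet> x))\<^sup>2) \<partial>G) \<le> ennreal (C * ((ln n)\<^sup>2 * n powr (-2/3)))"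
    if n: "n \<ge> 3" and \<omega>: "\<omega> \<in> space M" and \<alpha>: "\<alpha> \<in> cball \<alpha>\<^sub>0 \<delta>\<^sub>0"
      and y: "\<And>i. i < n \<Longrightarrow> \<bar>Ys i \<omega>\<bar> \<le> B * ln n"
      and count: "\<And>J. is_interval J \<Longrightarrow>
        \<bar>card {i. i < n \<and> \<alpha> \<bullet> Xs i \<omega> \<in> J} - n * prob (X -` {x. \<alpha> \<bullet> x \<in> J} \<inter> space M)\<bar>
          \<le> B * (sqrt (n * prob (X -` {x. \<alpha> \<bullet> x \<in> J} \<inter> space M) * ln n) + ln n)"
      and sums: "\<And>J. is_interval J \<Longrightarrow>
        \<bar>(\<Sum>i | i < n \<and> \<alpha> \<bullet> Xs i \<omega> \<in> J. Ys i \<omega>) - n * expectation (\<lambda>\<omega>. Y \<omega> * indicator {x. \<alpha> \<bullet> x \<in> J} (X \<omega>))\<bar>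
          \<le> B * (sqrt (n * prob (X -` {x. \<alpha> \<bullet> x \<in> J} \<inter> space M) * ln n) + ln n)"
    for n :: nat and \<omega> \<alpha>
  proof -
    have fit: "iso_fit n (\<lambda>i. \<alpha> \<bullet> Xs i \<omega>) (\<lambda>i. Ys i \<omega>) (\<psi>hat n \<omega> \<alpha>)"
      using n \<omega> by (intro monotone_LSE_imp_iso_fit psi_hat) auto
    \<comment> \<open>\<open>m\<close> stands in for \<open>\<psi> \<alpha>\<close>: it is monotone
      and bounded on the whole line and agrees with it almost surely along
      \<open>\<alpha> \<bullet> X\<close>. The restriction of \<open>\<alpha>\<close> to the ball
      enters here, through A3.\<close>
    obtain m where m: "mono m" "\<And>u. \<bar>m u\<bar> \<le> K\<^sub>0"
      and m_eq: "\<And>u. u \<in> (\<lambda>x. \<alpha> \<bullet> x) ` \<X> \<Longrightarrow> \<bar>\<psi> \<alpha> u\<bar> \<le> K\<^sub>0 \<Longrightarrow> m u = \<psi> \<alpha> u"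
      using bounded_mono_extension[OF A3(2)[OF \<alpha>], of K\<^sub>0] A2(1) by force
    have m_meas: "m \<in> borel_measurable borel" by (rule borel_measurable_mono[OF m(1)])
    have psi_meas: "\<psi> \<alpha> \<in> borel_measurable borel" using psi[of \<alpha>] by (simp add: is_regression_function_def)
    have "AE \<omega> in M. \<bar>\<psi> \<alpha> (\<alpha> \<bullet> X \<omega>)\<bar> \<le> K\<^sub>0"
      by (rule regression_bounded[OF inner_meas Z_int psi Z_le])
    then have AE_eq: "AE \<omega> in M. m (\<alpha> \<bullet> X \<omega>) = \<psi> \<alpha> (\<alpha> \<bullet> X \<omega>)"
      using X_supp by eventually_elim (use m_eq in blast)
    define \<mu> where "\<mu> = distr M borel (\<lambda>\<omega>. \<alpha> \<bullet> X \<omega>)"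
    have mass: "measure \<mu> J = prob (X -` {x. \<alpha> \<bullet> x \<in> J} \<inter> space M)" if J: "is_interval J" for J
    proof -
      have "(\<lambda>\<omega>. \<alpha> \<bullet> X \<omega>) -` J \<inter> space M = X -` {x. \<alpha> \<bullet> x \<in> J} \<inter> space M" by auto
      then show ?thesis
        unfolding \<mu>_def using measure_distr[OF inner_meas[of \<alpha>] real_interval_borel_measurable[OF J]] by simp
    qed
    \<comment> \<open>This identifies the target of a direction. The event depends on
      \<open>\<alpha> \<bullet> X\<close>, so the true signal may be exchanged for its regression on
      \<open>\<alpha> \<bullet> X\<close>; it is also an event in \<open>X\<close>, on which the
      error integrates to 0.\<close>
    have mean: "(\<integral>w. m w * indicator J w \<partial>\<mu>) = expectation (\<lambda>\<omega>. Y \<omega> * indicator {x. \<alpha> \<bullet> x \<in> J} (X \<omega>))"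
      if "is_interval J" for J
    proof -
      have J: "J \<in> sets borel" by (rule real_interval_borel_measurable[OF that])
      define S where "S = {x. \<alpha> \<bullet> x \<in> J}"
      have "S = (\<lambda>x. \<alpha> \<bullet> x) -` J \<inter> space borel" by (auto simp: S_def)
      also have "\<dots> \<in> sets borel" by (rule measurable_sets[OF _ J]) measurable
      finally have S: "S \<in> sets borel" .
      have ind: "indicator J (\<alpha> \<bullet> X \<omega>) = (indicator S (X \<omega>) :: real)" for \<omega>
        by (simp add: S_def indicator_def)
      have ind_meas [measurable]: "(\<lambda>\<omega>. indicator S (X \<omega>) :: real) \<in> borel_measurable M"
        by (rule measurable_compose[OF X]) (use S in measurable)
      have mult_int: "integrable M (\<lambda>\<omega>. h \<omega> * indicator S (X \<omega>))" if "integrable M h" for h :: "'w \<Rightarrow> real"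
      proof (rule Bochner_Integration.integrable_bound[OF that])
        show "(\<lambda>\<omega>. h \<omega> * indicator S (X \<omega>)) \<in> borel_measurable M"
          by (rule borel_measurable_times[OF borel_measurable_integrable[OF that] ind_meas])
      qed (auto simp: indicator_def)
      have "(\<integral>w. m w * indicator J w \<partial>\<mu>) = (\<integral>\<omega>. m (\<alpha> \<bullet> X \<omega>) * indicator J (\<alpha> \<bullet> X \<omega>) \<partial>M)"
        unfolding \<mu>_def by (rule integral_distr[OF inner_meas]) (use m_meas J in measurable)
      also have "\<dots> = (\<integral>\<omega>. \<psi> \<alpha> (\<alpha> \<bullet> X \<omega>) * indicator J (\<alpha> \<bullet> X \<omega>) \<partial>M)"
      proof (rule integral_cong_AE)
        show "AE \<omega> in M. m (\<alpha> \<bullet> X \<omega>) * indicator J (\<alpha> \<bullet> X \<omega>) = \<psi> \<alpha> (\<alpha> \<bullet> X \<omega>) * indicator J (\<alpha> \<bullet> X \<omega>)"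
          using AE_eq by eventually_elim simp
      qed (use m_meas psi_meas J in measurable)
      also have "\<dots> = (\<integral>\<omega>. ?Z \<omega> * indicator J (\<alpha> \<bullet> X \<omega>) \<partial>M)"
        by (rule regression_integral[OF inner_meas Z_int psi J, symmetric])
      also have "\<dots> = (\<integral>\<omega>. ?Z \<omega> * indicator S (X \<omega>) \<partial>M) + (\<integral>\<omega>. \<epsilon> \<omega> * indicator S (X \<omega>) \<partial>M)"
        using cond_mean_zero_integral[OF X err_int err S] by (simp add: ind)
      also have "\<dots> = (\<integral>\<omega>. ?Z \<omega> * indicator S (X \<omega>) + \<epsilon> \<omega> * indicator S (X \<omega>) \<partial>M)"
        by (rule Bochner_Integration.integral_add[OF mult_int[OF Z_int] mult_int[OF err_int], symmetric])
      also have "\<dots> = expectation (\<lambda>\<omega>. Y \<omega> * indicator S (X \<omega>))"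
        by (rule Bochner_Integration.integral_cong) (simp_all add: model distrib_right)
      finally show ?thesis by (simp add: S_def)
    qed
    have ln1: "ln (real n) \<ge> 1"
      using n exp_le ln_ge_iff[of "real n" 1] by simp
    have hat_meas: "\<psi>hat n \<omega> \<alpha> \<in> borel_measurable borel"
      using fit by (intro borel_measurable_mono) (simp add: iso_fit_def)
    have "(\<integral>\<^sup>+x. ennreal ((\<psi>hat n \<omega> \<alpha> (\<alpha> \<bullet> x) - \<psi> \<alpha> (\<alpha> \<bullet> x))\<^sup>2) \<partial>G)
        = (\<integral>\<^sup>+\<omega>'. ennreal ((\<psi>hat n \<omega> \<alpha> (\<alpha> \<bullet> X \<omega>') - \<psi> \<alpha> (\<alpha> \<bullet> X \<omega>'))\<^sup>2) \<partial>M)"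
      unfolding G by (rule nn_integral_distr[OF X]) (use hat_meas psi_meas in measurable)
    also have "\<dots> = (\<integral>\<^sup>+\<omega>'. ennreal ((\<psi>hat n \<omega> \<alpha> (\<alpha> \<bullet> X \<omega>') - m (\<alpha> \<bullet> X \<omega>'))\<^sup>2) \<partial>M)"
      by (rule nn_integral_cong_AE) (use AE_eq in \<open>eventually_elim, simp\<close>)
    also have "\<dots> = (\<integral>\<^sup>+u. ennreal ((\<psi>hat n \<omega> \<alpha> u - m u)\<^sup>2) \<partial>\<mu>)"
      unfolding \<mu>_def by (rule nn_integral_distr[OF inner_meas, symmetric]) (use hat_meas m_meas in measurable)
    also have "\<dots> \<le> ennreal (2 * fit_const K\<^sub>0 B * ((ln n)\<^sup>2 * n powr (-2/3)))"
    proof (rule monotone_fit_error[OF _ _ fit m B ln1 refl])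
      show "prob_space \<mu>" unfolding \<mu>_def by (rule prob_space_distr[OF inner_meas])
      show "sets \<mu> = sets borel" by (simp add: \<mu>_def)
    qed (use count sums y mass mean in simp_all)
    finally show ?thesis by (simp only: C_def)
  qed
  show ?thesis
    unfolding bigO_outer_prob_def
  proof (intro allI impI exI conjI)
    \<comment> \<open>One \<open>C\<close> serves every \<open>e\<close>: the exceptional
      probability \<open>B / n\<close> tends to 0, so only the threshold for \<open>n\<close>
      depends on \<open>e\<close>.\<close>
    show "C > 0" by (rule C)
    fix e :: real and n :: nat assume e: "e > 0" and n: "n \<ge> max 3 (nat \<lceil>B / e\<rceil>)"
    let ?bad = "{\<omega> \<in> space M. ennreal (C * ((ln (real n))\<^sup>2 * real n powr (-2/3)))
      < (SUP \<alpha>\<in>cball \<alpha>\<^sub>0 \<delta>\<^sub>0. \<integral>\<^sup>+ x. ennreal ((\<psi>hat n \<omega> \<alpha> (\<alpha> \<bullet> x) - \<psi> \<alpha> (\<alpha> \<bullet> x))\<^sup>2) \<partial>G)}"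
    have n3: "n \<ge> 3" using n by simp
    obtain A where A: "A \<in> sets M" "emeasure M A \<le> ennreal (B / n)"
      and good: "\<And>\<omega>. \<omega> \<in> space M - A \<Longrightarrow> (\<forall>i<n. \<bar>Ys i \<omega>\<bar> \<le> B * ln n) \<and>
      (\<forall>\<alpha> J. is_interval J \<longrightarrow>
        \<bar>card {i. i < n \<and> \<alpha> \<bullet> Xs i \<omega> \<in> J} - n * prob (X -` {x. \<alpha> \<bullet> x \<in> J} \<inter> space M)\<bar>
          \<le> B * (sqrt (n * prob (X -` {x. \<alpha> \<bullet> x \<in> J} \<inter> space M) * ln n) + ln n) \<and>
        \<bar>(\<Sum>i | i < n \<and> \<alpha> \<bullet> Xs i \<omega> \<in> J. Ys i \<omega>) - n * expectation (\<lambda>\<omega>. Y \<omega> * indicator {x. \<alpha> \<bullet> x \<in> J} (X \<omega>))\<bar>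
          \<le> B * (sqrt (n * prob (X -` {x. \<alpha> \<bullet> x \<in> J} \<inter> space M) * ln n) + ln n))"
      using event[OF n3] by blast
    have "?bad \<subseteq> A"
    proof
      fix \<omega> assume \<omega>: "\<omega> \<in> ?bad"
      show "\<omega> \<in> A"
      proof (rule ccontr)
        assume "\<omega> \<notin> A"
        with \<omega> have g: "\<omega> \<in> space M - A" by blast
        have "(SUP \<alpha>\<in>cball \<alpha>\<^sub>0 \<delta>\<^sub>0. \<integral>\<^sup>+ x. ennreal ((\<psi>hat n \<omega> \<alpha> (\<alpha> \<bullet> x) - \<psi> \<alpha> (\<alpha> \<bullet> x))\<^sup>2) \<partial>G)
            \<le> ennreal (C * ((ln (real n))\<^sup>2 * real n powr (-2/3)))"
        proof (rule SUP_least, rule bound[OF n3])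
          show "\<omega> \<in> space M" using g by blast
        qed (use good[OF g] in blast)+
        then show False using \<omega> by (simp add: not_less[symmetric])
      qed
    qed
    \<comment> \<open>Outer measure is an infimum over measurable supersets, so it is enough that
      the measurable \<open>A\<close> covers the possibly nonmeasurable bad event.\<close>
    then have "outer_measure_of M ?bad \<le> emeasure M A"
      unfolding outer_measure_of_def using A(1) by (intro INF_lower) auto
    also have "\<dots> \<le> ennreal (B / n)" by (rule A(2))
    also have "\<dots> \<le> ennreal e"
    proof (rule ennreal_leI)
      have "B / e \<le> n" using n by linarith
      then show "B / n \<le> e" using e n3 by (simp add: field_simps)
    qed
    finally show "outer_measure_of M ?bad \<le> ennreal e" .
  qed
qed

end
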